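(* Let $X$ be an infinite-dimensional complex Banach space and $T\in\mathcal{L}(X)$. Then either $T$ admits an almost-invariant halfspace of defect $\leq 1$, or else there are a finite-codimensional closed subspace $V$ of $X$, a continuous linear projection $P_V\in\mathcal{L}(X)$ onto $V$, an eigenvalue $\lambda\in\sigma_p(T)\cap\sigma_p(P_VT|_V)$, and a linearly independent sequence $(v_n)_{n=1}^\infty\subseteq V$ such that $[v_n]_{n=1}^\infty=V$ and \[Sv_{n+1}=v_n\ \text{ for all integers } n\geq 1,\quad\text{and}\quad Sv_1=0,\] where \[S:=P_V(\lambda-T)|_V=\lambda-P_VT|_V\in\mathcal{L}(V).\]
   Context: $\mathcal{L}(X)$ denotes the algebra of all continuous linear operators on $X$. For a sequence $(x_n)$, $[x_n]$ denotes its closed linear span. For an operator $R$ on a complex Banach space, $\sigma_p(R)=\{\lambda\in\mathbb{C}:\lambda-R\text{ is not injective}\}$ is the point spectrum, where $\lambda$ also denotes $\lambda$ times the identity operator. The operator $P_VT|_V$ (apply $T$ to a vector of $V$, then apply $P_V$) is regarded as an element of $\mathcal{L}(V)$. A halfspace of $X$ is a closed subspace of $X$ with both infinite dimension and infinite codimension in $X$. A subspace $Y$ of $X$ is almost-invariant under $T$ if $TY\subseteq Y+E$ for some finite-dimensional subspace $E$ of $X$; the smallest possible dimension of such an $E$ is called the defect. *)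

theory Defs
  imports "HOL-Analysis.Analysis"
begin

text \<open>
  The distribution has only real normed spaces, so complex ones are introduced as real normed
  spaces with a compatible complex scalar multiplication. Every complex Banach space is of this
  kind, with \<^const>\<open>scaleR\<close> the restriction of the scalar multiplication to the reals.
\<close>

class complex_vector = real_vector +
  fixes scaleC :: "complex \<Rightarrow> 'a \<Rightarrow> 'a"  (infixr \<open>*\<^sub>C\<close> 75)
  assumes scaleC_add_right: "a *\<^sub>C (x + y) = a *\<^sub>C x + a *\<^sub>C y"
    and scaleC_add_left: "(a + b) *\<^sub>C x = a *\<^sub>C x + b *\<^sub>C x"
    and scaleC_scaleC: "a *\<^sub>C b *\<^sub>C x = (a * b) *\<^sub>C x"
    and scaleC_one: "1 *\<^sub>C x = x"
    and scaleR_scaleC: "r *\<^sub>R x = complex_of_real r *\<^sub>C x"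

class complex_normed_vector = complex_vector + real_normed_vector +
  assumes norm_scaleC: "norm (a *\<^sub>C x) = cmod a * norm x"

class complex_banach = complex_normed_vector + banach

instantiation complex :: complex_banach
begin

definition scaleC_complex :: "complex \<Rightarrow> complex \<Rightarrow> complex"
  where "scaleC_complex a x = a * x"

instance
  by standard
    (simp_all add: scaleC_complex_def algebra_simps norm_mult scaleR_conv_of_real)

end

global_interpretation complex_vector: vector_space
  "scaleC :: complex \<Rightarrow> 'a \<Rightarrow> 'a::complex_vector"
  defines csubspace = complex_vector.subspace
    and cspan = complex_vector.span
    and cdependent = complex_vector.dependent
    and cdim = complex_vector.dim
  by unfold_locales
    (simp_all add: scaleC_add_right scaleC_add_left scaleC_scaleC scaleC_one)

definition clinear :: "('a::complex_vector \<Rightarrow> 'a) \<Rightarrow> bool"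
  where "clinear T \<longleftrightarrow> Vector_Spaces.linear scaleC scaleC T"

definition operators :: "('a::complex_normed_vector \<Rightarrow> 'a) set"
  where "operators = {T. clinear T \<and> continuous_on UNIV T}"

definition finite_dimensional :: "'a::complex_vector set \<Rightarrow> bool"
  where "finite_dimensional V \<longleftrightarrow> (\<exists>B. finite B \<and> cspan B = V)"

text \<open>The quotient space by \<open>Y\<close> is spanned by the cosets of finitely many vectors.\<close>

definition finite_codimensional :: "'a::complex_vector set \<Rightarrow> bool"
  where "finite_codimensional Y \<longleftrightarrow>
    csubspace Y \<and> (\<exists>B. finite B \<and> (\<forall>x. \<exists>b\<in>cspan B. x - b \<in> Y))"

definition halfspace :: "'a::complex_normed_vector set \<Rightarrow> bool"
  where "halfspace Y \<longleftrightarrow>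
    csubspace Y \<and> closed Y \<and> \<not> finite_dimensional Y \<and> \<not> finite_codimensional Y"

definition invariant_modulo ::
    "('a::complex_vector \<Rightarrow> 'a) \<Rightarrow> 'a set \<Rightarrow> 'a set \<Rightarrow> bool"
  where "invariant_modulo T Y E \<longleftrightarrow> T ` Y \<subseteq> {y + e | y e. y \<in> Y \<and> e \<in> E}"

definition almost_invariant :: "('a::complex_vector \<Rightarrow> 'a) \<Rightarrow> 'a set \<Rightarrow> bool"
  where "almost_invariant T Y \<longleftrightarrow>
    (\<exists>E. csubspace E \<and> finite_dimensional E \<and> invariant_modulo T Y E)"

text \<open>Meaningful only if \<open>Y\<close> is almost-invariant under \<open>T\<close>.\<close>

definition defect :: "('a::complex_vector \<Rightarrow> 'a) \<Rightarrow> 'a set \<Rightarrow> nat"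
  where "defect T Y =
    (LEAST d. \<exists>E. csubspace E \<and> finite_dimensional E \<and> invariant_modulo T Y E \<and> cdim E = d)"

definition projection_onto :: "'a::complex_normed_vector set \<Rightarrow> ('a \<Rightarrow> 'a) \<Rightarrow> bool"
  where "projection_onto V P \<longleftrightarrow> P \<in> operators \<and> P \<circ> P = P \<and> range P = V"

text \<open>
  The point spectrum of \<open>R\<close> as an operator on the subspace \<open>V\<close>; an operator on \<open>V\<close> is
  represented by a function on the whole space, of which only the values on \<open>V\<close> matter.
\<close>

definition point_spectrum :: "'a::complex_vector set \<Rightarrow> ('a \<Rightarrow> 'a) \<Rightarrow> complex set"
  where "point_spectrum V R = {\<mu>. \<not> inj_on (\<lambda>x. \<mu> *\<^sub>C x - R x) V}"

end

theory Submission
  imports Defs "HOL-Complex_Analysis.Conformal_Mappings"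
begin

text \<open>
  Let \<open>A = \<mu> - T\<close>. There are three ways to reach the conclusion, depending on \<open>\<mu>\<close>.

  If \<open>ker A\<close> is infinite-dimensional, it contains a halfspace of the whole space, and all closed
  subspaces of \<open>ker A\<close> are invariant (\<open>halfspace_in_infinite_kernel\<close>).

  If \<open>ker A\<close> is finite-dimensional and the kernels of the powers of \<open>A\<close> never stop growing,
  there is an infinite chain \<open>A w\<^sub>0 = 0\<close>, \<open>A w\<^sub>n\<^sub>+\<^sub>1 = w\<^sub>n\<close> (lemma \<open>backward_chain_exists\<close>). Its closed
  span \<open>V\<close> is invariant under \<open>T\<close>. It is a halfspace unless it has finite codimension, and then
  \<open>V\<close>, with any projection onto it, satisfies the second alternative (\<open>chain_dichotomy\<close>).

  Otherwise the kernels of the powers of \<open>A\<close> become stationary at a finite-dimensional space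
  \<open>N\<close>, and \<open>A\<close> is injective modulo \<open>N\<close>. Suppose that \<open>\<nu>\<^sub>n \<longlonglongrightarrow> \<mu>\<close> in the resolvent set and that
  \<open>h\<^sub>n = (\<nu>\<^sub>n - T)\<^sup>-\<^sup>1 e\<close> is unbounded modulo \<open>N\<close> for some \<open>e\<close>. As \<open>T h\<^sub>n = \<nu>\<^sub>n h\<^sub>n - e\<close>, every closed
  subspace spanned by some of the \<open>h\<^sub>n\<close> and \<open>N\<close> is invariant up to the vector \<open>e\<close>. To get a
  halfspace the \<open>h\<^sub>n\<close> must be thinned out. Normalised modulo \<open>N\<close> they become vectors \<open>x\<^sub>n\<close>
  that an injective operator maps to a null sequence, and such a sequence has a subsequence with
  biorthogonal functionals (\<open>minimal_subsequence\<close>); keep every other term of it. In a reflexive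
  space the \<open>x\<^sub>n\<close> tend weakly to \<open>0\<close>. In general the evaluations at the \<open>x\<^sub>n\<close> have a
  cluster point \<open>\<phi>\<close> in the bidual, which is either \<open>0\<close> or at positive distance from the space
  itself, and in both cases functionals in the kernel of \<open>\<phi>\<close> can be chosen inductively.

  It remains to see that one of these cases occurs for some \<open>\<mu>\<close>. If none does, the uniform
  boundedness principle shows that \<open>\<mu> - T\<close> is invertible modulo \<open>N\<close> for every \<open>\<mu>\<close> in the
  closure of the resolvent set. Then the spectrum consists of finitely many points, and by
  Liouville's theorem the corresponding spaces \<open>N\<close> together span the whole space, which is thus
  finite-dimensional (\<open>finite_dimensional_if_no_blow_up\<close>).
\<close>

section \<open>Bounded complex linear maps\<close>

definition bounded_clinear ::
    "('a::complex_normed_vector \<Rightarrow> 'b::complex_normed_vector) \<Rightarrow> bool"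
  where "bounded_clinear f \<longleftrightarrow> bounded_linear f \<and> (\<forall>c x. f (c *\<^sub>C x) = c *\<^sub>C f x)"

lemma scaleC_complex [simp]: "a *\<^sub>C (x::complex) = a * x"
  by (simp add: scaleC_complex_def)

lemma scaleC_zero [simp]: "a *\<^sub>C (0::'a::complex_vector) = 0" "0 *\<^sub>C (x::'a) = 0"
  by (rule complex_vector.scale_zero_right, rule complex_vector.scale_zero_left)

lemma scaleC_1 [simp]: "1 *\<^sub>C (x::'a::complex_vector) = x"
  by (rule scaleC_one)

lemma scaleC_assoc [simp]: "a *\<^sub>C b *\<^sub>C (x::'a::complex_vector) = (a * b) *\<^sub>C x"
  by (rule scaleC_scaleC)

lemmas norm_scaleC_simp [simp] = norm_scaleC

lemma bounded_clinearD:
  assumes "bounded_clinear f"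
  shows "bounded_linear f" "f (c *\<^sub>C x) = c *\<^sub>C f x" "f (x + y) = f x + f y"
    "f (x - y) = f x - f y" "f 0 = 0" "f (- x) = - f x" "f (sum g I) = (\<Sum>i\<in>I. f (g i))"
  using assms
  by (auto simp: bounded_clinear_def linear_simps bounded_linear.linear linear_sum)

lemma bounded_clinear_bound:
  assumes "bounded_clinear f"
  obtains K where "K > 0" "\<And>x. norm (f x) \<le> K * norm x"
  using bounded_linear.pos_bounded[OF bounded_clinearD(1)[OF assms]]
  by (metis mult.commute)

lemma bounded_clinearI:
  assumes "\<And>x y. f (x + y) = f x + f y" "\<And>c x. f (c *\<^sub>C x) = c *\<^sub>C f x"
    and "\<And>x. norm (f x) \<le> K * norm x"
  shows "bounded_clinear f"
  unfolding bounded_clinear_def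
proof (intro conjI allI bounded_linear_intro[where K = K])
  show "f (r *\<^sub>R x) = r *\<^sub>R f x" for r x
    by (simp add: scaleR_scaleC assms(2))
qed (use assms in \<open>auto simp: mult.commute\<close>)

lemma bounded_clinear_ident: "bounded_clinear (\<lambda>x. x)"
  by (auto simp: bounded_clinear_def)

lemma bounded_clinear_zero: "bounded_clinear (\<lambda>x. 0)"
  by (auto simp: bounded_clinear_def)

lemma bounded_clinear_add:
  assumes "bounded_clinear f" "bounded_clinear g"
  shows "bounded_clinear (\<lambda>x. f x + g x)"
  using assms by (auto simp: bounded_clinear_def bounded_linear_add scaleC_add_right)

lemma bounded_clinear_scale:
  assumes "bounded_clinear f"
  shows "bounded_clinear (\<lambda>x. c *\<^sub>C f x)"
proof -
  obtain K where "\<And>x. norm (f x) \<le> K * norm x"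
    using bounded_clinear_bound[OF assms] by blast
  then show ?thesis
    by (intro bounded_clinearI[where K = "cmod c * K"])
      (simp_all add: bounded_clinearD[OF assms] scaleC_add_right mult.assoc mult_left_mono
        mult.left_commute[of c] mult.commute[of c])
qed

lemma scaleC_minus1: "(- 1) *\<^sub>C (x::'a::complex_vector) = - x"
  using complex_vector.scale_minus_left[of 1 x] by simp

lemma bounded_clinear_diff:
  assumes "bounded_clinear f" "bounded_clinear g"
  shows "bounded_clinear (\<lambda>x. f x - g x)"
  using bounded_clinear_add[OF assms(1) bounded_clinear_scale[OF assms(2), of "- 1"]]
  by (simp add: scaleC_minus1)

lemma bounded_clinear_compose:
  assumes "bounded_clinear f" "bounded_clinear g"
  shows "bounded_clinear (\<lambda>x. f (g x))"
  using assms bounded_linear_compose[of f g] by (simp add: bounded_clinear_def)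

lemma bounded_clinear_sum:
  assumes "\<And>i. i \<in> I \<Longrightarrow> bounded_clinear (f i)"
  shows "bounded_clinear (\<lambda>x. \<Sum>i\<in>I. f i x)"
  using assms
  by (induction I rule: infinite_finite_induct)
    (simp_all add: bounded_clinear_add bounded_clinear_zero)

lemma bounded_clinear_scale_left:
  assumes "bounded_clinear (f :: 'a::complex_normed_vector \<Rightarrow> complex)"
  shows "bounded_clinear (\<lambda>x. f x *\<^sub>C b)"
proof -
  obtain K where "\<And>x. cmod (f x) \<le> K * norm x"
    using bounded_clinear_bound[OF assms] by blast
  then show ?thesis
    by (intro bounded_clinearI[where K = "K * norm b"])
      (simp_all add: bounded_clinearD[OF assms] scaleC_add_left mult_right_mono
        mult.assoc mult.commute[of "norm b"] mult_right_mono[of _ "K * _" "norm b", simplified mult.assoc])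
qed

lemma bounded_clinear_continuous:
  assumes "bounded_clinear f" shows "continuous_on S f"
  using assms by (simp add: bounded_clinear_def linear_continuous_on)

lemma operators_iff_bounded_clinear: "T \<in> operators \<longleftrightarrow> bounded_clinear T"
proof
  assume T: "T \<in> operators"
  then interpret T: Vector_Spaces.linear scaleC scaleC T
    by (simp add: operators_def clinear_def)
  have real: "linear T"
    by (rule linearI) (simp_all add: T.add T.scale scaleR_scaleC)
  have "continuous (at 0) T"
    using T by (auto simp: operators_def continuous_on_eq_continuous_at)
  then obtain d where d: "d > 0" "\<And>x. norm x < d \<Longrightarrow> norm (T x) < 1"
    unfolding continuous_at_eps_delta dist_norm
    by (metis T.zero diff_zero zero_less_one)
  have "norm (T x) \<le> (2 / d) * norm x" for x
  proof (cases "x = 0")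
    case False
    define t where "t = d / (2 * norm x)"
    have "t > 0" "norm (t *\<^sub>R x) < d"
      using d False by (auto simp: t_def)
    then have "t * norm (T x) < 1"
      using d(2)[of "t *\<^sub>R x"] by (simp add: linear_scale[OF real])
    then show ?thesis
      using False d by (simp add: t_def field_simps)
  qed (simp add: T.zero)
  then show "bounded_clinear T"
    by (intro bounded_clinearI[OF T.add T.scale])
next
  assume T: "bounded_clinear T"
  have "Vector_Spaces.linear scaleC scaleC T"
    by (intro Vector_Spaces.linear.intro complex_vector.vector_space_axioms
        module_hom.intro module_hom_axioms.intro complex_vector.module_axioms)
      (rule bounded_clinearD[OF T])+
  then show "T \<in> operators"
    using bounded_clinear_continuous[OF T] by (simp add: operators_def clinear_def)
qed

section \<open>The Hahn--Banach theorem\<close>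

text \<open>
  A linear functional on a subspace is given by its graph, which has to be a subspace of the
  product; a bound on the functional makes the graph single-valued. In this form Zorn's lemma
  applies to inclusion of graphs, and functionals given on a span need no well-definedness
  argument.
\<close>

lemma hahn_banach_real:
  fixes G :: "('a::real_normed_vector \<times> real) set"
  assumes "subspace G" and K: "0 \<le> K" and "\<And>x t. (x, t) \<in> G \<Longrightarrow> t \<le> K * norm x"
  obtains g where "linear g" "\<And>x t. (x, t) \<in> G \<Longrightarrow> g x = t" "\<And>x. \<bar>g x\<bar> \<le> K * norm x"
proof -
  define \<A> where
    "\<A> = {H. subspace H \<and> G \<subseteq> H \<and> (\<forall>x t. (x, t) \<in> H \<longrightarrow> t \<le> K * norm x)}"
  have "\<exists>M\<in>\<A>. \<forall>H\<in>\<A>. M \<subseteq> H \<longrightarrow> H = M"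
  proof (rule subset_Zorn_nonempty)
    show "\<A> \<noteq> {}"
      using assms by (auto simp: \<A>_def)
  next
    fix \<C> assume \<C>: "\<C> \<noteq> {}" "subset.chain \<A> \<C>"
    have sub: "\<And>H. H \<in> \<C> \<Longrightarrow> H \<in> \<A>"
      and tot: "\<And>H H'. H \<in> \<C> \<Longrightarrow> H' \<in> \<C> \<Longrightarrow> H \<subseteq> H' \<or> H' \<subseteq> H"
      using \<C>(2) by (auto simp: subset.chain_def)
    have sp: "subspace H" if "H \<in> \<C>" for H
      using sub[OF that] by (simp add: \<A>_def)
    have "subspace (\<Union>\<C>)"
      unfolding subspace_def
    proof (intro conjI ballI allI)
      show "0 \<in> \<Union>\<C>"
        using \<C>(1) sp subspace_0 by blast
    next
      fix x y assume "x \<in> \<Union>\<C>" "y \<in> \<Union>\<C>"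
      then obtain H where "H \<in> \<C>" "x \<in> H" "y \<in> H"
        using tot by (meson UnionE subsetD)
      then show "x + y \<in> \<Union>\<C>"
        using sp subspace_add by blast
    next
      fix c x assume "x \<in> \<Union>\<C>"
      then show "c *\<^sub>R x \<in> \<Union>\<C>"
        using sp subspace_scale by blast
    qed
    then show "\<Union>\<C> \<in> \<A>"
      using sub \<C>(1) unfolding \<A>_def by blast
  qed
  then obtain M where "M \<in> \<A>" and max: "\<And>H. H \<in> \<A> \<Longrightarrow> M \<subseteq> H \<Longrightarrow> H = M"
    by blast
  then have M: "subspace M" "G \<subseteq> M" and bd: "\<And>x t. (x, t) \<in> M \<Longrightarrow> t \<le> K * norm x"
    by (auto simp: \<A>_def)
  have add: "(x + y, s + t) \<in> M" if "(x, s) \<in> M" "(y, t) \<in> M" for x y s t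
    using subspace_add[OF M(1) that] by simp
  have scale: "(c *\<^sub>R x, c * t) \<in> M" if "(x, t) \<in> M" for c x t
    using subspace_scale[OF M(1) that, of c] by simp
  have zero: "(0, 0) \<in> M"
    using subspace_0[OF M(1)] by (simp add: zero_prod_def)
  have uniq: "s = t" if "(x, s) \<in> M" "(x, t) \<in> M" for x s t
    using bd[OF add[OF that(1) scale[OF that(2), of "-1"]]]
      bd[OF add[OF that(2) scale[OF that(1), of "-1"]]] by simp
  have total: "\<exists>t. (z, t) \<in> M" for z
  proof (rule ccontr)
    assume z: "\<nexists>t. (z, t) \<in> M"
    define L where "L = {s - K * norm (x - z) |x s. (x, s) \<in> M}"
    have le: "s - K * norm (x - z) \<le> K * norm (y + z) - t"
      if "(x, s) \<in> M" "(y, t) \<in> M" for x s y t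
    proof -
      have "s + t \<le> K * norm (x + y)"
        using bd[OF add[OF that]] .
      also have "\<dots> \<le> K * (norm (x - z) + norm (y + z))"
        using norm_triangle_ineq[of "x - z" "y + z"] K by (intro mult_left_mono) auto
      finally show ?thesis by (simp add: algebra_simps)
    qed
    define \<xi> where "\<xi> = Sup L"
    have "L \<noteq> {}" "bdd_above L"
      using zero le[OF _ zero] unfolding L_def bdd_above_def by blast+
    then have lower: "s - K * norm (x - z) \<le> \<xi>" if "(x, s) \<in> M" for x s
      unfolding \<xi>_def using that by (intro cSup_upper) (auto simp: L_def)
    have upper: "\<xi> \<le> K * norm (y + z) - t" if "(y, t) \<in> M" for y t
      unfolding \<xi>_def using \<open>L \<noteq> {}\<close> le[OF _ that] by (intro cSup_least) (auto simp: L_def)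
    define H where "H = {(x + c *\<^sub>R z, s + c * \<xi>) |x s c. (x, s) \<in> M}"
    have "subspace H"
      unfolding subspace_def
    proof (intro conjI ballI allI)
      show "0 \<in> H"
        unfolding H_def zero_prod_def using zero by (force intro!: exI[of _ 0])
    next
      fix p q assume "p \<in> H" "q \<in> H"
      then obtain x s c y t d where "p = (x + c *\<^sub>R z, s + c * \<xi>)" "q = (y + d *\<^sub>R z, t + d * \<xi>)"
        and "(x, s) \<in> M" "(y, t) \<in> M"
        unfolding H_def by blast
      then show "p + q \<in> H"
        unfolding H_def using add
        by (intro CollectI exI[of _ "x + y"] exI[of _ "s + t"] exI[of _ "c + d"])
          (auto simp: algebra_simps)
    next
      fix r p assume "p \<in> H"
      then obtain x s c where "p = (x + c *\<^sub>R z, s + c * \<xi>)" "(x, s) \<in> M"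
        unfolding H_def by blast
      then show "r *\<^sub>R p \<in> H"
        unfolding H_def using scale[of x s r]
        by (intro CollectI exI[of _ "r *\<^sub>R x"] exI[of _ "r * s"] exI[of _ "r * c"])
          (simp add: scaleR_add_right distrib_left)
    qed
    moreover have "M \<subseteq> H"
    proof
      fix p assume "p \<in> M"
      then show "p \<in> H"
        unfolding H_def
        by (intro CollectI exI[of _ "fst p"] exI[of _ "snd p"] exI[of _ 0]) simp
    qed
    moreover have "s + c * \<xi> \<le> K * norm (x + c *\<^sub>R z)" if "(x, s) \<in> M" for x s c
    proof (cases c "0::real" rule: linorder_cases)
      case equal
      then show ?thesis using bd[OF that] by simp
    next
      case greater
      have "c * \<xi> \<le> c * (K * norm ((1 / c) *\<^sub>R x + z) - (1 / c) * s)"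
        using upper[OF scale[OF that, of "1 / c"]] greater by (intro mult_left_mono) auto
      also have "\<dots> = K * norm (c *\<^sub>R ((1 / c) *\<^sub>R x + z)) - s"
        unfolding norm_scaleR using greater by (simp add: right_diff_distrib)
      also have "c *\<^sub>R ((1 / c) *\<^sub>R x + z) = x + c *\<^sub>R z"
        using greater by (simp add: scaleR_add_right)
      finally show ?thesis by simp
    next
      case less
      have "(- c) * ((- 1 / c) * s - K * norm ((- 1 / c) *\<^sub>R x - z)) \<le> (- c) * \<xi>"
        using lower[OF scale[OF that, of "- 1 / c"]] less by (intro mult_left_mono) auto
      moreover have "(- c) * ((- 1 / c) * s - K * norm ((- 1 / c) *\<^sub>R x - z))
          = s - K * norm ((- c) *\<^sub>R ((- 1 / c) *\<^sub>R x - z))"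
        unfolding norm_scaleR using less by (simp add: right_diff_distrib)
      moreover have "(- c) *\<^sub>R ((- 1 / c) *\<^sub>R x - z) = x + c *\<^sub>R z"
        using less by (simp add: scaleR_diff_right)
      ultimately have "s - K * norm (x + c *\<^sub>R z) \<le> (- c) * \<xi>" by metis
      then show ?thesis by simp
    qed
    then have "\<forall>x t. (x, t) \<in> H \<longrightarrow> t \<le> K * norm x"
      unfolding H_def by auto
    ultimately have "H = M"
      using M(2) by (intro max) (auto simp: \<A>_def)
    moreover have "(z, \<xi>) \<in> H"
      unfolding H_def using zero by (intro CollectI exI[of _ 0] exI[of _ 1]) simp
    ultimately show False
      using z by blast
  qed
  define g where "g x = (THE t. (x, t) \<in> M)" for x
  have g: "(x, g x) \<in> M" for x
    unfolding g_def using total[of x] uniq by (metis theI)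
  show thesis
  proof
    show "linear g"
      by (rule linearI) (auto intro: uniq[OF g add[OF g g]] uniq[OF g scale[OF g]])
    show "g x = t" if "(x, t) \<in> G" for x t
      using uniq g that M(2) by blast
    show "\<bar>g x\<bar> \<le> K * norm x" for x
      using bd[OF g] bd[OF scale[OF g, of "-1"]] by (simp add: abs_le_iff)
  qed
qed

text \<open>
  The real part of a complex linear functional determines it, as
  \<open>f x = Re (f x) - \<i> * Re (f (\<i> * x))\<close>; so the real part is extended, and the extension of \<open>f\<close>
  is recovered by this formula. Rotating \<open>f x\<close> onto the positive real axis shows that the bound
  is preserved.
\<close>

lemma hahn_banach_graph:
  fixes G :: "('a::complex_normed_vector \<times> complex) set"
  assumes zero: "(0, 0) \<in> G"
    and add: "\<And>x y s t. (x, s) \<in> G \<Longrightarrow> (y, t) \<in> G \<Longrightarrow> (x + y, s + t) \<in> G"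
    and scale: "\<And>c x t. (x, t) \<in> G \<Longrightarrow> (c *\<^sub>C x, c * t) \<in> G"
    and bd: "\<And>x t. (x, t) \<in> G \<Longrightarrow> cmod t \<le> K * norm x" and K: "0 \<le> K"
  obtains g where "bounded_clinear g" "\<And>x t. (x, t) \<in> G \<Longrightarrow> g x = t"
    "\<And>x. cmod (g x) \<le> K * norm x"
proof -
  define R where "R = {(x, Re t) |x t. (x, t) \<in> G}"
  have "subspace R"
    unfolding subspace_def
  proof (intro conjI ballI allI)
    show "0 \<in> R"
      unfolding R_def zero_prod_def using zero by force
  next
    fix p q assume "p \<in> R" "q \<in> R"
    then obtain x s y t where "p = (x, Re s)" "q = (y, Re t)" "(x, s) \<in> G" "(y, t) \<in> G"
      unfolding R_def by blast
    then show "p + q \<in> R"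
      unfolding R_def using add by force
  next
    fix r p assume "p \<in> R"
    then obtain x s where "p = (x, Re s)" "(x, s) \<in> G"
      unfolding R_def by blast
    then show "r *\<^sub>R p \<in> R"
      unfolding R_def using scale[of x s "complex_of_real r"]
      by (intro CollectI exI[of _ "r *\<^sub>R x"] exI[of _ "complex_of_real r * s"])
        (auto simp: scaleR_scaleC)
  qed
  moreover have "t \<le> K * norm x" if "(x, t) \<in> R" for x t
    using that bd complex_Re_le_cmod order_trans unfolding R_def by blast
  ultimately obtain u where u: "linear u" "\<And>x t. (x, t) \<in> R \<Longrightarrow> u x = t"
      "\<And>x. \<bar>u x\<bar> \<le> K * norm x"
    using hahn_banach_real[OF _ K] by metis
  define g where "g x = Complex (u x) (- u (\<i> *\<^sub>C x))" for x
  have lin: "u (x + y) = u x + u y" "u (r *\<^sub>R x) = r * u x" "u (- x) = - u x"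
    "u (x - y) = u x - u y" for x y r
    using u(1) by (simp_all add: linear_add linear_scale linear_neg linear_diff)
  have gadd: "g (x + y) = g x + g y" for x y
    by (simp add: g_def lin scaleC_add_right complex_eq_iff)
  have split: "c *\<^sub>C x = Re c *\<^sub>R x + Im c *\<^sub>R (\<i> *\<^sub>C x)" for c and x :: 'a
    unfolding scaleR_scaleC scaleC_scaleC scaleC_add_left[symmetric]
    by (simp add: complex_eq mult.commute)
  have gscale: "g (c *\<^sub>C x) = c * g x" for c x
  proof -
    have "\<i> *\<^sub>C c *\<^sub>C x = Re c *\<^sub>R (\<i> *\<^sub>C x) + Im c *\<^sub>R (- x)"
      unfolding scaleR_scaleC scaleC_minus1[of x, symmetric] scaleC_scaleC scaleC_add_left[symmetric]
      by (rule arg_cong[where f = "\<lambda>d. d *\<^sub>C x"]) (simp add: complex_eq_iff)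
    then show ?thesis
      by (simp only: g_def split[of c x]) (simp add: lin complex_eq_iff)
  qed
  have bound: "cmod (g x) \<le> K * norm x" for x
  proof (cases "g x = 0")
    case False
    define c where "c = cnj (g x) / cmod (g x)"
    have c: "cmod c = 1" "c * g x = complex_of_real (cmod (g x))"
      using False
      by (simp_all add: c_def norm_divide complex_norm_square[symmetric] power2_eq_square
          mult.commute)
    have "cmod (g x) = Re (g (c *\<^sub>C x))"
      by (simp add: gscale c)
    also have "\<dots> = u (c *\<^sub>C x)"
      by (simp add: g_def)
    also have "\<dots> \<le> K * norm (c *\<^sub>C x)"
      using u(3) abs_le_iff by blast
    finally show ?thesis
      by (simp add: c)
  qed (use K in auto)
  show thesis
  proof
    show "bounded_clinear g"
      using bound by (intro bounded_clinearI[where K = K]) (simp_all add: gadd gscale)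
    show "g x = t" if "(x, t) \<in> G" for x t
    proof -
      have "(x, Re t) \<in> R" "(\<i> *\<^sub>C x, Re (\<i> * t)) \<in> R"
        unfolding R_def using that scale by blast+
      then show ?thesis
        by (simp add: g_def u(2) complex_eq_iff)
    qed
  qed (use bound in auto)
qed

lemma hahn_banach:
  assumes M: "csubspace M" and "\<And>x y. x \<in> M \<Longrightarrow> y \<in> M \<Longrightarrow> f (x + y) = f x + f y"
    and "\<And>c x. x \<in> M \<Longrightarrow> f (c *\<^sub>C x) = c * f x"
    and "\<And>x. x \<in> M \<Longrightarrow> cmod (f x) \<le> K * norm x" and "0 \<le> K"
  obtains g where "bounded_clinear g" "\<And>x. x \<in> M \<Longrightarrow> g x = f x"
    "\<And>x::'a::complex_normed_vector. cmod (g x) \<le> K * norm x"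
proof -
  have "f 0 = 0"
    using assms(3)[of 0 0] complex_vector.subspace_0[OF M] by simp
  obtain g where "bounded_clinear g" "\<And>x t. (x, t) \<in> {(x, f x) |x. x \<in> M} \<Longrightarrow> g x = t"
    "\<And>x. cmod (g x) \<le> K * norm x"
  proof (rule hahn_banach_graph[of "{(x, f x) |x. x \<in> M}" K])
    show "(0, 0) \<in> {(x, f x) |x. x \<in> M}"
      using \<open>f 0 = 0\<close> complex_vector.subspace_0[OF M] by force
  qed (use assms complex_vector.subspace_add[OF M] complex_vector.subspace_scale[OF M] in auto)
  then show thesis
    using that by blast
qed

lemma norming_functional:
  obtains g where "bounded_clinear g" "g x = complex_of_real (norm x)"
    "\<And>y::'a::complex_normed_vector. cmod (g y) \<le> norm y"
proof -
  let ?G = "{(c *\<^sub>C x, c * complex_of_real (norm x)) |c. True}"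
  obtain g where g: "bounded_clinear g" "\<And>y t. (y, t) \<in> ?G \<Longrightarrow> g y = t"
    "\<And>y. cmod (g y) \<le> 1 * norm y"
  proof (rule hahn_banach_graph[of ?G 1])
    show "(0, 0) \<in> ?G"
      by (force intro!: exI[of _ 0])
  next
    fix y z s t assume "(y, s) \<in> ?G" "(z, t) \<in> ?G"
    then obtain c d where "y = c *\<^sub>C x" "s = c * norm x" "z = d *\<^sub>C x" "t = d * norm x"
      by auto
    then show "(y + z, s + t) \<in> ?G"
      by (auto intro!: exI[of _ "c + d"] simp: scaleC_add_left algebra_simps)
  next
    fix c y t assume "(y, t) \<in> ?G"
    then obtain d where "y = d *\<^sub>C x" "t = d * norm x"
      by auto
    then show "(c *\<^sub>C y, c * t) \<in> ?G"
      by (auto intro!: exI[of _ "c * d"])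
  qed (auto simp: norm_mult)
  have "(x, complex_of_real (norm x)) \<in> ?G"
    by (force intro!: exI[of _ 1])
  then show thesis
    using that g by simp
qed

lemma separating_functional:
  fixes x :: "'a::complex_normed_vector"
  assumes M: "csubspace M" and x: "x \<notin> closure M"
  obtains g :: "'a \<Rightarrow> complex"
  where "bounded_clinear g" "\<And>y. y \<in> M \<Longrightarrow> g y = 0" "g x = 1"
proof -
  obtain d where d: "d > 0" "\<And>y. y \<in> M \<Longrightarrow> d \<le> dist y x"
    using x by (force simp: closure_approachable not_less)
  let ?G = "{(m + c *\<^sub>C x, c) |m c. m \<in> M}"
  obtain g where g: "bounded_clinear g" "\<And>y t. (y, t) \<in> ?G \<Longrightarrow> g y = t"
  proof (rule hahn_banach_graph[of ?G "1 / d"])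
    show "(0, 0) \<in> ?G"
      using complex_vector.subspace_0[OF M] by (force intro!: exI[of _ 0])
  next
    fix y z s t assume "(y, s) \<in> ?G" "(z, t) \<in> ?G"
    then obtain m n where "y = m + s *\<^sub>C x" "z = n + t *\<^sub>C x" "m \<in> M" "n \<in> M"
      by auto
    then show "(y + z, s + t) \<in> ?G"
      using complex_vector.subspace_add[OF M]
      by (auto intro!: exI[of _ "m + n"] simp: scaleC_add_left algebra_simps)
  next
    fix c y t assume "(y, t) \<in> ?G"
    then obtain m where "y = m + t *\<^sub>C x" "m \<in> M"
      by auto
    then show "(c *\<^sub>C y, c * t) \<in> ?G"
      using complex_vector.subspace_scale[OF M]
      by (auto intro!: exI[of _ "c *\<^sub>C m"] simp: scaleC_add_right)
  next
    fix y t assume "(y, t) \<in> ?G"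
    then obtain m where m: "y = m + t *\<^sub>C x" "m \<in> M"
      by auto
    show "cmod t \<le> 1 / d * norm y"
    proof (cases "t = 0")
      case False
      have "d \<le> norm ((- 1 / t) *\<^sub>C m - x)"
        using d(2)[OF complex_vector.subspace_scale[OF M m(2), of "- 1 / t"]]
        by (simp only: dist_norm)
      then have "cmod t * d \<le> norm (t *\<^sub>C ((- 1 / t) *\<^sub>C m - x))"
        by (simp add: mult_left_mono)
      also have "t *\<^sub>C ((- 1 / t) *\<^sub>C m - x) = - y"
        using False by (simp add: m complex_vector.scale_right_diff_distrib scaleC_minus1)
      finally show ?thesis
        using d(1) by (simp add: field_simps)
    qed (use d in simp)
  qed (use d in auto)
  show thesis
  proof
    show "g y = 0" if "y \<in> M" for y
      using that by (intro g(2) CollectI exI[of _ y] exI[of _ 0]) simp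
    show "g x = 1"
      using complex_vector.subspace_0[OF M] by (intro g(2) CollectI exI[of _ 0] exI[of _ 1]) simp
  qed (rule g(1))
qed

section \<open>Finite-dimensional and finite-codimensional subspaces\<close>

lemma bounded_clinear_preimage:
  assumes f: "bounded_clinear f" and V: "csubspace V"
  shows "csubspace {x. f x \<in> V}" "closed V \<Longrightarrow> closed {x. f x \<in> V}"
proof -
  show "csubspace {x. f x \<in> V}"
    using complex_vector.subspace_0[OF V] complex_vector.subspace_add[OF V]
      complex_vector.subspace_scale[OF V]
    by (auto intro!: complex_vector.subspaceI simp: bounded_clinearD[OF f])
  show "closed {x. f x \<in> V}" if "closed V"
    using continuous_closed_vimage[OF that, of f] bounded_clinear_continuous[OF f, of UNIV]
    by (auto simp: continuous_on_eq_continuous_at vimage_def)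
qed

lemma csubspace_zero: "csubspace {0}"
  by (rule complex_vector.subspace_single_0)

lemma cspan_csubspace: "csubspace V \<Longrightarrow> cspan V = V"
  by (simp add: complex_vector.span_eq_iff)

lemmas bounded_clinear_kernel =
  bounded_clinear_preimage[OF _ csubspace_zero, simplified]

lemma csubspace_closure:
  fixes M :: "'a::complex_normed_vector set"
  assumes M: "csubspace M" shows "csubspace (closure M)"
proof (rule complex_vector.subspaceI)
  show "0 \<in> closure M"
    using complex_vector.subspace_0[OF M] closure_subset by blast
next
  fix x y assume "x \<in> closure M" "y \<in> closure M"
  then obtain a b where "\<And>n. a n \<in> M" "a \<longlonglongrightarrow> x" "\<And>n. b n \<in> M" "b \<longlonglongrightarrow> y"
    unfolding closure_sequential by blast
  then show "x + y \<in> closure M"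
    unfolding closure_sequential
    by (intro exI[of _ "\<lambda>n. a n + b n"]) (auto intro: tendsto_add complex_vector.subspace_add[OF M])
next
  fix c x assume "x \<in> closure M"
  then obtain a where a: "\<And>n. a n \<in> M" "a \<longlonglongrightarrow> x"
    unfolding closure_sequential by blast
  have "(\<lambda>n. c *\<^sub>C a n) \<longlonglongrightarrow> c *\<^sub>C x"
    using bounded_linear.tendsto[OF bounded_clinearD(1)[OF bounded_clinear_scale[OF
      bounded_clinear_ident]] a(2)] .
  then show "c *\<^sub>C x \<in> closure M"
    unfolding closure_sequential
    by (intro exI[of _ "\<lambda>n. c *\<^sub>C a n"]) (auto intro: complex_vector.subspace_scale[OF M] a(1))
qed

lemma bounded_clinear_closure_image:
  assumes "bounded_clinear f" "csubspace W" "closed W" "\<And>x. x \<in> M \<Longrightarrow> f x \<in> W" "x \<in> closure M"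
  shows "f x \<in> W"
  using closure_minimal[of M "{x. f x \<in> W}"] bounded_clinear_preimage[OF assms(1,2)] assms by auto

text \<open>
  A functional that vanishes on \<open>M\<close> and is \<open>1\<close> at \<open>x\<close> computes the coefficient of \<open>x\<close>
  continuously, so the sum of \<open>M\<close> and the line through \<open>x\<close> is a preimage of \<open>M\<close>.
\<close>

lemma closed_cspan_insert:
  fixes M :: "'a::complex_normed_vector set"
  assumes M: "csubspace M" "closed M"
  shows "closed (cspan (insert x M))"
proof (cases "x \<in> M")
  case True
  then show ?thesis
    using M by (simp add: insert_absorb cspan_csubspace)
next
  case False
  then obtain g :: "'a \<Rightarrow> complex"
    where g: "bounded_clinear g" "\<And>y. y \<in> M \<Longrightarrow> g y = 0" "g x = 1"
    using separating_functional[OF M(1), of x] M(2) by auto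
  have spanM: "cspan M = M"
    using M(1) by (rule cspan_csubspace)
  have "g y = k" if "y - k *\<^sub>C x \<in> M" for y k
    using g(2)[OF that] g(3) by (simp add: bounded_clinearD[OF g(1)])
  then have "cspan (insert x M) = {y. y - g y *\<^sub>C x \<in> M}"
    unfolding complex_vector.span_insert spanM by auto
  then show ?thesis
    using bounded_clinear_preimage(2)[OF bounded_clinear_diff[OF bounded_clinear_ident
      bounded_clinear_scale_left[OF g(1)]] M] by simp
qed

lemma closed_cspan_Un_finite:
  fixes V :: "'a::complex_normed_vector set"
  assumes V: "csubspace V" "closed V" and "finite B"
  shows "closed (cspan (B \<union> V))"
  using \<open>finite B\<close>
proof induction
  case empty
  then show ?case using V by (simp add: cspan_csubspace)
next
  case (insert b B)
  have "cspan (insert b (B \<union> V)) = cspan (insert b (cspan (B \<union> V)))"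
    unfolding complex_vector.span_insert complex_vector.span_span ..
  then show ?case
    using closed_cspan_insert[OF complex_vector.subspace_span insert.IH] by simp
qed

text \<open>
  After discarding redundant elements of \<open>B\<close>, each remaining one has positive distance from the
  closed span of \<open>V\<close> and the others, so the Hahn--Banach theorem gives coordinates modulo \<open>V\<close>
  that are continuous on the whole space. With \<open>V = {0}\<close> this produces a projection onto a
  finite-dimensional space; with \<open>V\<close> of finite codimension it produces one along a complement.
\<close>

lemma coordinates_modulo:
  fixes V :: "'a::complex_normed_vector set"
  assumes V: "csubspace V" "closed V" and "finite B"
  obtains C and f :: "'a \<Rightarrow> 'a \<Rightarrow> complex"
  where "C \<subseteq> B" "\<And>b. b \<in> C \<Longrightarrow> bounded_clinear (f b)" "\<And>b v. b \<in> C \<Longrightarrow> v \<in> V \<Longrightarrow> f b v = 0"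
    "\<And>b c. b \<in> C \<Longrightarrow> c \<in> C \<Longrightarrow> f b c = (if b = c then 1 else 0)"
    "\<And>x. x \<in> cspan (B \<union> V) \<Longrightarrow> x - (\<Sum>b\<in>C. f b x *\<^sub>C b) \<in> V"
proof -
  define ok where "ok C \<longleftrightarrow> C \<subseteq> B \<and> cspan (C \<union> V) = cspan (B \<union> V)" for C
  have "ok B"
    by (simp add: ok_def)
  then obtain C where C: "ok C" and min: "\<And>D. ok D \<Longrightarrow> card C \<le> card D"
    using ex_has_least_nat[of ok B card] by blast
  then have "finite C"
    using \<open>finite B\<close> finite_subset by (auto simp: ok_def)
  have ex: "\<exists>g :: 'a \<Rightarrow> complex. bounded_clinear g \<and> (\<forall>y\<in>V. g y = 0) \<and>
      (\<forall>c\<in>C. g c = (if b = c then 1 else 0))" if b: "b \<in> C" for b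
  proof -
    let ?M = "cspan ((C - {b}) \<union> V)"
    have "b \<notin> ?M"
    proof
      assume "b \<in> ?M"
      then have "cspan (insert b ((C - {b}) \<union> V)) = ?M"
        by (rule complex_vector.span_redundant)
      moreover have "insert b ((C - {b}) \<union> V) = C \<union> V"
        using b by blast
      ultimately have "ok (C - {b})"
        using C by (auto simp: ok_def)
      then show False
        using min[of "C - {b}"] \<open>finite C\<close> b card_Diff1_less[of C b] by linarith
    qed
    moreover have "closed ?M"
      using V \<open>finite C\<close> by (intro closed_cspan_Un_finite) auto
    ultimately obtain g :: "'a \<Rightarrow> complex"
      where g: "bounded_clinear g" "\<And>y. y \<in> ?M \<Longrightarrow> g y = 0" "g b = 1"
      using separating_functional[OF complex_vector.subspace_span, of b "(C - {b}) \<union> V"] by auto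
    then show ?thesis
      by (intro exI[of _ g]) (auto intro!: g(2) complex_vector.span_base)
  qed
  then obtain f :: "'a \<Rightarrow> 'a \<Rightarrow> complex" where f: "\<And>b. b \<in> C \<Longrightarrow> bounded_clinear (f b)"
      "\<And>b v. b \<in> C \<Longrightarrow> v \<in> V \<Longrightarrow> f b v = 0"
      "\<And>b c. b \<in> C \<Longrightarrow> c \<in> C \<Longrightarrow> f b c = (if b = c then 1 else 0)"
    by metis
  let ?W = "{x. x - (\<Sum>b\<in>C. f b x *\<^sub>C b) \<in> V}"
  have "cspan (C \<union> V) \<subseteq> ?W"
  proof (rule complex_vector.span_minimal)
    show "csubspace ?W"
      using f V
      by (intro bounded_clinear_preimage bounded_clinear_diff bounded_clinear_ident
          bounded_clinear_sum bounded_clinear_scale_left)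
    show "C \<union> V \<subseteq> ?W"
    proof
      fix x assume "x \<in> C \<union> V"
      then consider "x \<in> C" | "x \<in> V" by blast
      then show "x \<in> ?W"
      proof cases
        case 1
        then have "(\<Sum>b\<in>C. f b x *\<^sub>C b) = (\<Sum>b\<in>C. if b = x then x else 0)"
          by (intro sum.cong) (auto simp: f(3))
        then show ?thesis
          using 1 \<open>finite C\<close> complex_vector.subspace_0[OF V(1)] by simp
      next
        case 2
        then show ?thesis by (simp add: f(2))
      qed
    qed
  qed
  then show thesis
    using that[of C f] C f by (auto simp: ok_def)
qed

lemma finite_dimensional_closed:
  fixes V :: "'a::complex_normed_vector set"
  assumes "finite_dimensional V" shows "csubspace V" "closed V"
  using assms closed_cspan_Un_finite[OF csubspace_zero closed_singleton]
  by (auto simp: finite_dimensional_def)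

lemma finite_dimensional_iff:
  "finite_dimensional V \<longleftrightarrow> csubspace V \<and> (\<exists>B. finite B \<and> V \<subseteq> cspan B)"
proof
  assume "csubspace V \<and> (\<exists>B. finite B \<and> V \<subseteq> cspan B)"
  then obtain B where V: "csubspace V" and B: "finite B" "V \<subseteq> cspan B" by blast
  obtain C where C: "C \<subseteq> V" "\<not> cdependent C" "V \<subseteq> cspan C"
    using complex_vector.maximal_independent_subset[of V] by blast
  then have "finite C"
    using complex_vector.independent_span_bound[OF B(1) C(2)] B by blast
  moreover have "cspan C = V"
    using C complex_vector.span_minimal[OF C(1) V] by blast
  ultimately show "finite_dimensional V"
    by (auto simp: finite_dimensional_def)
qed (auto simp: finite_dimensional_def)

lemma finite_dimensional_subset:
  assumes "finite_dimensional V" "csubspace W" "W \<subseteq> V"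
  shows "finite_dimensional W"
  using assms by (auto simp: finite_dimensional_iff)

lemma finite_dimensional_projection:
  fixes N :: "'a::complex_normed_vector set"
  assumes "finite_dimensional N"
  obtains R where "bounded_clinear R" "\<And>x. R x \<in> N" "\<And>x. x \<in> N \<Longrightarrow> R x = x"
proof -
  obtain B where B: "finite B" "cspan B = N"
    using assms by (auto simp: finite_dimensional_def)
  show thesis
  proof (rule coordinates_modulo[OF csubspace_zero closed_singleton B(1)], rule that)
    fix C and f :: "'a \<Rightarrow> 'a \<Rightarrow> complex"
    assume C: "C \<subseteq> B"
      "\<And>b. b \<in> C \<Longrightarrow> bounded_clinear (f b)" "\<And>b v. b \<in> C \<Longrightarrow> v \<in> {0} \<Longrightarrow> f b v = 0"
      "\<And>b c. b \<in> C \<Longrightarrow> c \<in> C \<Longrightarrow> f b c = (if b = c then 1 else 0)"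
      "\<And>x. x \<in> cspan (B \<union> {0}) \<Longrightarrow> x - (\<Sum>b\<in>C. f b x *\<^sub>C b) \<in> {0}"
    show "bounded_clinear (\<lambda>x. \<Sum>b\<in>C. f b x *\<^sub>C b)"
      using C by (intro bounded_clinear_sum bounded_clinear_scale_left)
    show "(\<Sum>b\<in>C. f b x *\<^sub>C b) \<in> N" for x
      unfolding B(2)[symmetric] using C(1)
      by (intro complex_vector.span_sum complex_vector.span_scale complex_vector.span_base) auto
    show "(\<Sum>b\<in>C. f b x *\<^sub>C b) = x" if "x \<in> N" for x
    proof -
      have "x \<in> cspan (B \<union> {0})"
        using that B by simp
      then show ?thesis
        using C(5)[of x] eq_iff_diff_eq_0 by (metis singletonD)
    qed
  qed
qed

lemma finite_codimensional_projection:
  fixes V :: "'a::complex_normed_vector set"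
  assumes "finite_codimensional V" "closed V"
  obtains P where "bounded_clinear P" "\<And>x. P x \<in> V" "\<And>x. x \<in> V \<Longrightarrow> P x = x"
proof -
  obtain B where V: "csubspace V" and B: "finite B" "\<And>x. \<exists>b\<in>cspan B. x - b \<in> V"
    using assms by (auto simp: finite_codimensional_def)
  have all: "x \<in> cspan (B \<union> V)" for x
  proof -
    obtain b where "b \<in> cspan B" "x - b \<in> V"
      using B(2) by blast
    then have "b \<in> cspan (B \<union> V)" "x - b \<in> cspan (B \<union> V)"
      using complex_vector.span_mono[of B "B \<union> V"] complex_vector.span_superset[of "B \<union> V"]
      by auto
    then show ?thesis
      using complex_vector.span_add by force
  qed
  show thesis
  proof (rule coordinates_modulo[OF V assms(2) B(1)], rule that)
    fix C and f :: "'a \<Rightarrow> 'a \<Rightarrow> complex"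
    assume C: "C \<subseteq> B"
      "\<And>b. b \<in> C \<Longrightarrow> bounded_clinear (f b)" "\<And>b v. b \<in> C \<Longrightarrow> v \<in> V \<Longrightarrow> f b v = 0"
      "\<And>b c. b \<in> C \<Longrightarrow> c \<in> C \<Longrightarrow> f b c = (if b = c then 1 else 0)"
      "\<And>x. x \<in> cspan (B \<union> V) \<Longrightarrow> x - (\<Sum>b\<in>C. f b x *\<^sub>C b) \<in> V"
    show "bounded_clinear (\<lambda>x. x - (\<Sum>b\<in>C. f b x *\<^sub>C b))"
      using C by (intro bounded_clinear_diff bounded_clinear_ident bounded_clinear_sum
          bounded_clinear_scale_left)
    show "x - (\<Sum>b\<in>C. f b x *\<^sub>C b) \<in> V" for x
      using C(5) all by blast
    show "x - (\<Sum>b\<in>C. f b x *\<^sub>C b) = x" if "x \<in> V" for x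
    proof -
      have "(\<Sum>b\<in>C. f b x *\<^sub>C b) = 0"
        using C(3) that by (intro sum.neutral) simp
      then show ?thesis by simp
    qed
  qed
qed

lemma finite_dimensional_preimage:
  fixes A :: "'a::complex_normed_vector \<Rightarrow> 'a"
  assumes A: "bounded_clinear A" and F: "finite_dimensional F"
    and ker: "finite_dimensional {x. A x = 0}"
  shows "finite_dimensional {x. A x \<in> F}"
proof -
  have sub: "csubspace {x. A x \<in> F}"
    using bounded_clinear_preimage[OF A] finite_dimensional_closed(1)[OF F] by blast
  let ?I = "A ` {x. A x \<in> F}"
  have "csubspace ?I"
  proof (rule complex_vector.subspaceI)
    show "0 \<in> ?I"
      using complex_vector.subspace_0[OF sub] bounded_clinearD(5)[OF A]
      by (intro image_eqI[of _ _ 0]) auto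
    show "x + y \<in> ?I" if xy: "x \<in> ?I" "y \<in> ?I" for x y
    proof -
      obtain u v where "x = A u" "y = A v" "A u \<in> F" "A v \<in> F"
        using xy by auto
      then show ?thesis
        using complex_vector.subspace_add[OF sub, of u v]
        by (auto simp: bounded_clinearD[OF A] intro!: image_eqI[of _ _ "u + v"])
    qed
    show "c *\<^sub>C x \<in> ?I" if x: "x \<in> ?I" for c x
    proof -
      obtain u where "x = A u" "A u \<in> F"
        using x by auto
      then show ?thesis
        using complex_vector.subspace_scale[OF sub, of u c]
        by (auto simp: bounded_clinearD[OF A] intro!: image_eqI[of _ _ "c *\<^sub>C u"])
    qed
  qed
  then have "finite_dimensional ?I"
    using finite_dimensional_subset[OF F] by blast
  then obtain B where B: "finite B" "cspan B = ?I"
    by (auto simp: finite_dimensional_def)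
  then have "\<forall>b\<in>B. \<exists>x. A x = b"
    using complex_vector.span_superset[of B] by fastforce
  then obtain s where s: "\<And>b. b \<in> B \<Longrightarrow> A (s b) = b"
    by metis
  obtain D where D: "finite D" "cspan D = {x. A x = 0}"
    using ker by (auto simp: finite_dimensional_def)
  have "x \<in> cspan (D \<union> s ` B)" if "A x \<in> F" for x
  proof -
    have "A x \<in> cspan B"
      using that B by blast
    then have "\<exists>z\<in>cspan (s ` B). A z = A x"
    proof (induction rule: complex_vector.span_induct_alt)
      case base
      then show ?case
        using complex_vector.span_zero bounded_clinearD(5)[OF A] by blast
    next
      case (step c b y)
      then obtain z where "z \<in> cspan (s ` B)" "A z = y"
        by blast
      then show ?case
        using step s
        by (intro bexI[of _ "c *\<^sub>C s b + z"])
          (simp_all add: bounded_clinearD[OF A] complex_vector.span_add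
            complex_vector.span_scale complex_vector.span_base)
    qed
    then obtain z where z: "z \<in> cspan (s ` B)" "A z = A x"
      by blast
    then have "x - z \<in> cspan D"
      using D by (simp add: bounded_clinearD[OF A])
    then have "z + (x - z) \<in> cspan (D \<union> s ` B)"
      using z complex_vector.span_mono[of D "D \<union> s ` B"]
        complex_vector.span_mono[of "s ` B" "D \<union> s ` B"]
      by (intro complex_vector.span_add) auto
    then show ?thesis by simp
  qed
  then show ?thesis
    unfolding finite_dimensional_iff using sub D(1) B(1)
    by (intro conjI exI[of _ "D \<union> s ` B"]) auto
qed

section \<open>Halfspaces from biorthogonal sequences\<close>

lemma biorthogonal_independent:
  fixes b :: "'i \<Rightarrow> 'a::complex_normed_vector" and u :: "'i \<Rightarrow> 'a \<Rightarrow> complex"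
  assumes u: "\<And>k. bounded_clinear (u k)" and bi: "\<And>j k. u k (b j) = (if j = k then 1 else 0)"
  shows "\<not> cdependent (range b)" "inj b"
proof -
  show "\<not> cdependent (range b)"
    unfolding complex_vector.dependent_def
  proof (clarify)
    fix k assume k: "b k \<in> cspan (range b - {b k})"
    have "cspan (range b - {b k}) \<subseteq> {x. u k x = 0}"
      using bounded_clinear_kernel(1)[OF u[of k]] bi
      by (intro complex_vector.span_minimal) (auto split: if_splits)
    then show False
      using k bi[of k k] by auto
  qed
  show "inj b"
    using bi by (metis injI zero_neq_one)
qed

lemma biorthogonal_infinite_dimensional:
  fixes b :: "nat \<Rightarrow> 'a::complex_normed_vector" and u :: "nat \<Rightarrow> 'a \<Rightarrow> complex"
  assumes u: "\<And>k. bounded_clinear (u k)" and bi: "\<And>j k. u k (b j) = (if j = k then 1 else 0)"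
    and "finite B"
  shows "\<not> range b \<subseteq> cspan B"
  using complex_vector.independent_span_bound[OF \<open>finite B\<close> biorthogonal_independent(1)[of u b]]
    biorthogonal_independent(2)[of u b] u bi finite_imageD[of b UNIV] by auto

text \<open>
  The vectors with even index make \<open>Y\<close> infinite-dimensional. The functionals with odd index
  pass to the quotient by \<open>Y\<close>, where they are biorthogonal to the vectors with odd index.
\<close>

lemma halfspace_biorthogonal:
  fixes x :: "nat \<Rightarrow> 'a::complex_normed_vector" and u :: "nat \<Rightarrow> 'a \<Rightarrow> complex"
  assumes u: "\<And>k. bounded_clinear (u k)" and bi: "\<And>j k. u k (x j) = (if j = k then 1 else 0)"
    and Y: "csubspace Y" "closed Y" and even: "\<And>k. x (2 * k) \<in> Y"
    and odd: "\<And>k y. y \<in> Y \<Longrightarrow> u (2 * k + 1) y = 0"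
  shows "halfspace Y"
  unfolding halfspace_def
proof (intro conjI Y notI)
  assume "finite_dimensional Y"
  then obtain B where "finite B" "Y = cspan B"
    by (auto simp: finite_dimensional_def)
  then show False
    using biorthogonal_infinite_dimensional[of "\<lambda>k. u (2 * k)" "\<lambda>k. x (2 * k)" B] u bi even
    by auto
next
  assume "finite_codimensional Y"
  then obtain B where B: "finite B" "\<And>x. \<exists>b\<in>cspan B. x - b \<in> Y"
    by (auto simp: finite_codimensional_def)
  have "\<forall>k. \<exists>b. b \<in> cspan B \<and> x (2 * k + 1) - b \<in> Y"
    using B(2) by blast
  then obtain b where b: "\<And>k. b k \<in> cspan B" "\<And>k. x (2 * k + 1) - b k \<in> Y"
    by metis
  have "u (2 * k + 1) (b j) = (if j = k then 1 else 0)" for j k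
    using odd[OF b(2), of k j] bi[of "2 * k + 1" "2 * j + 1"]
    by (auto simp: bounded_clinearD[OF u] split: if_splits)
  then show False
    using biorthogonal_infinite_dimensional[of "\<lambda>k. u (2 * k + 1)" b B] u b B by auto
qed

lemma biorthogonal_sequence_exists:
  fixes K :: "'a::complex_normed_vector set"
  assumes K: "csubspace K" and inf: "\<not> finite_dimensional K"
  obtains x and u :: "nat \<Rightarrow> 'a \<Rightarrow> complex"
  where "\<And>k. x k \<in> K" "\<And>k. bounded_clinear (u k)"
    "\<And>j k. u k (x j) = (if j = k then 1 else 0)"
proof -
  define P where "P s k p \<longleftrightarrow> fst p \<in> K \<and> bounded_clinear (snd p) \<and> snd p (fst p) = 1 \<and>
      (\<forall>j<k. snd (s j) (fst p) = 0 \<and> snd p (fst (s j)) = 0)"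
    for s :: "nat \<Rightarrow> 'a \<times> ('a \<Rightarrow> complex)" and k and p :: "'a \<times> ('a \<Rightarrow> complex)"
  have "\<exists>s. \<forall>k. P s k (s k)"
  proof (rule dependent_wellorder_choice)
    show "P f k p = P g k p" if "\<And>j. j < k \<Longrightarrow> f j = g j" for f g k p
      using that by (simp add: P_def)
    show "\<exists>p. P s k p" if prev: "\<And>j. j < k \<Longrightarrow> P s j (s j)" for s k
    proof -
      define x u where "x j = fst (s j)" and "u j = snd (s j)" for j
      have x: "x j \<in> K" and u: "bounded_clinear (u j)" if "j < k" for j
        using prev[OF that] by (auto simp: P_def x_def u_def)
      have bi: "u i (x j) = (if j = i then 1 else 0)" if "i < k" "j < k" for i j
        using prev[OF that(1)] prev[OF that(2)]
        by (cases i j rule: linorder_cases) (auto simp: P_def x_def u_def)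
      let ?E = "cspan (x ` {..<k})"
      have "finite_dimensional ?E"
        unfolding finite_dimensional_def by (intro exI[of _ "x ` {..<k}"]) simp
      then have E: "csubspace ?E" "closed ?E" "?E \<subseteq> K"
        using finite_dimensional_closed[of ?E] complex_vector.span_minimal[OF _ K, of "x ` {..<k}"] x
        by auto
      have "\<not> K \<subseteq> ?E"
        using inf K by (auto simp: finite_dimensional_iff)
      then obtain y where y: "y \<in> K" "y \<notin> ?E"
        by blast
      define z where "z = y - (\<Sum>j<k. u j y *\<^sub>C x j)"
      have sum: "(\<Sum>j<k. u j y *\<^sub>C x j) \<in> ?E"
        by (intro complex_vector.span_sum complex_vector.span_scale complex_vector.span_base) auto
      have z: "z \<in> K"
        using y E(3) sum complex_vector.subspace_diff[OF K] by (auto simp: z_def)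
      have z': "z \<notin> ?E"
        using y(2) complex_vector.span_add[OF _ sum, of z] by (auto simp: z_def)
      obtain g :: "'a \<Rightarrow> complex"
        where g: "bounded_clinear g" "\<And>y. y \<in> ?E \<Longrightarrow> g y = 0" "g z = 1"
        using separating_functional[OF E(1), of z] E(2) z' by auto
      have "u i z = 0" if i: "i < k" for i
      proof -
        have "(\<Sum>j<k. u j y * u i (x j)) = (\<Sum>j<k. if j = i then u i y else 0)"
          using i bi by (intro sum.cong) auto
        then show ?thesis
          using i by (simp add: z_def bounded_clinearD[OF u[OF i]])
      qed
      then have "P s k (z, g)"
        using z g by (auto simp: P_def x_def u_def intro!: g(2) complex_vector.span_base)
      then show ?thesis ..
    qed
  qed
  then obtain s where s: "\<And>k. P s k (s k)"
    by blast
  show thesis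
  proof
    show "fst (s k) \<in> K" "bounded_clinear (snd (s k))" for k
      using s[of k] by (auto simp: P_def)
    show "snd (s k) (fst (s j)) = (if j = k then 1 else 0)" for j k
      using s[of k] s[of j] by (cases j k rule: linorder_cases) (auto simp: P_def)
  qed
qed

text \<open>
  The halfspaces of the theorem are all found in this form: one extra vector \<open>e\<close> suffices,
  and \<open>e = 0\<close> is allowed.
\<close>

lemma almost_invariant_one_vector:
  assumes Y: "csubspace Y" and T: "\<And>y. y \<in> Y \<Longrightarrow> T y \<in> cspan (insert e Y)"
  shows "almost_invariant T Y" "defect T Y \<le> 1"
proof -
  have E: "csubspace (cspan {e})" "finite_dimensional (cspan {e})"
    by (auto simp: finite_dimensional_def)
  have "\<exists>z w. T y = z + w \<and> z \<in> Y \<and> w \<in> cspan {e}" if y: "y \<in> Y" for y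
  proof -
    obtain k where "T y - k *\<^sub>C e \<in> Y"
      using T[OF y] Y by (auto simp: complex_vector.span_insert cspan_csubspace)
    then show ?thesis
      by (intro exI[of _ "T y - k *\<^sub>C e"] exI[of _ "k *\<^sub>C e"])
        (auto intro: complex_vector.span_scale complex_vector.span_base)
  qed
  then have inv: "invariant_modulo T Y (cspan {e})"
    by (auto simp: invariant_modulo_def)
  then show "almost_invariant T Y"
    using E by (auto simp: almost_invariant_def)
  have "defect T Y \<le> cdim (cspan {e})"
    unfolding defect_def using E inv by (intro Least_le) blast
  also have "\<dots> \<le> card {e}"
    by (rule complex_vector.dim_le_card) auto
  finally show "defect T Y \<le> 1"
    by simp
qed

lemma halfspace_in_infinite_kernel:
  fixes T :: "'a::complex_normed_vector \<Rightarrow> 'a"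
  assumes T: "bounded_clinear T" and inf: "\<not> finite_dimensional {x. \<mu> *\<^sub>C x - T x = 0}"
  shows "\<exists>Y. halfspace Y \<and> almost_invariant T Y \<and> defect T Y \<le> 1"
proof -
  have A: "bounded_clinear (\<lambda>x. \<mu> *\<^sub>C x - T x)"
    by (intro bounded_clinear_diff bounded_clinear_scale bounded_clinear_ident T)
  show ?thesis
  proof (rule biorthogonal_sequence_exists[OF bounded_clinear_kernel(1)[OF A] inf])
    fix x and u :: "nat \<Rightarrow> 'a \<Rightarrow> complex"
    assume x: "\<And>k. x k \<in> {x. \<mu> *\<^sub>C x - T x = 0}"
      and u: "\<And>k. bounded_clinear (u k)" "\<And>j k. u k (x j) = (if j = k then 1 else 0)"
    define Y where "Y = closure (cspan (range (\<lambda>k. x (2 * k))))"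
    have Y: "csubspace Y" "closed Y"
      unfolding Y_def by (auto intro: csubspace_closure)
    have "range (\<lambda>k. x (2 * k)) \<subseteq> Y"
      unfolding Y_def by (rule order_trans[OF complex_vector.span_superset closure_subset])
    then have mem: "x (2 * k) \<in> Y" for k
      by blast
    have "T y = \<mu> *\<^sub>C y" if "y \<in> Y" for y
    proof -
      have "\<mu> *\<^sub>C y - T y \<in> {0}"
      proof (rule bounded_clinear_closure_image[OF A csubspace_zero])
        show "y \<in> closure (cspan (range (\<lambda>k. x (2 * k))))"
          using that by (simp add: Y_def)
        show "\<mu> *\<^sub>C z - T z \<in> {0}" if "z \<in> cspan (range (\<lambda>k. x (2 * k)))" for z
          using complex_vector.span_minimal[OF _ bounded_clinear_kernel(1)[OF A],
              of "range (\<lambda>k. x (2 * k))"] x that by auto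
      qed auto
      then show ?thesis by simp
    qed
    then have "T y \<in> cspan (insert 0 Y)" if "y \<in> Y" for y
      using that by (simp add: complex_vector.span_base complex_vector.span_scale)
    moreover have "u (2 * k + 1) y = 0" if "y \<in> Y" for k y
    proof -
      have "u (2 * k + 1) y \<in> {0}"
      proof (rule bounded_clinear_closure_image[OF u(1) csubspace_zero])
        show "y \<in> closure (cspan (range (\<lambda>k. x (2 * k))))"
          using that by (simp add: Y_def)
        have "range (\<lambda>k. x (2 * k)) \<subseteq> {x. u (2 * k + 1) x = 0}"
          using u(2) by (auto, presburger)
        then show "u (2 * k + 1) z \<in> {0}" if "z \<in> cspan (range (\<lambda>k. x (2 * k)))" for z
          using complex_vector.span_minimal[OF _ bounded_clinear_kernel(1)[OF u(1), of "2 * k + 1"],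
              of "range (\<lambda>k. x (2 * k))"] that by auto
      qed auto
      then show ?thesis by simp
    qed
    ultimately show ?thesis
      using halfspace_biorthogonal[OF u Y mem] almost_invariant_one_vector[OF Y(1)] by blast
  qed
qed

section \<open>Chains of generalised eigenvectors\<close>

lemma bounded_clinear_funpow:
  fixes A :: "'a::complex_normed_vector \<Rightarrow> 'a"
  assumes "bounded_clinear A" shows "bounded_clinear (A ^^ p)"
proof (induction p)
  case 0
  then show ?case by (simp add: id_def bounded_clinear_ident)
next
  case (Suc p)
  then show ?case
    using bounded_clinear_compose[OF assms Suc] by (simp add: comp_def)
qed

lemma csubspace_range:
  fixes f :: "'a::complex_normed_vector \<Rightarrow> 'b::complex_normed_vector"
  assumes f: "bounded_clinear f" shows "csubspace (range f)"
proof (rule complex_vector.subspaceI)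
  show "0 \<in> range f"
    using bounded_clinearD(5)[OF f] by (metis rangeI)
  show "x + y \<in> range f" if "x \<in> range f" "y \<in> range f" for x y
    using that bounded_clinearD(3)[OF f, symmetric] by blast
  show "c *\<^sub>C x \<in> range f" if "x \<in> range f" for c x
    using that bounded_clinearD(2)[OF f, symmetric] by blast
qed

lemma decreasing_finite_dimensional_stabilises:
  fixes E :: "nat \<Rightarrow> 'a::complex_normed_vector set"
  assumes fin: "finite_dimensional (E 0)" and sub: "\<And>p. csubspace (E p)"
    and dec: "\<And>p. E (Suc p) \<subseteq> E p"
  obtains p\<^sub>0 where "\<And>p. p\<^sub>0 \<le> p \<Longrightarrow> E p = E p\<^sub>0"
proof -
  obtain p\<^sub>0 where min: "\<And>p. cdim (E p\<^sub>0) \<le> cdim (E p)"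
    using ex_has_least_nat[of "\<lambda>_. True" _ "\<lambda>p. cdim (E p)"] by auto
  have anti: "E q \<subseteq> E p" if "p \<le> q" for p q
    using that dec by (rule lift_Suc_antimono_le[rotated])
  show thesis
  proof (rule that, rule ccontr)
    fix p assume "p\<^sub>0 \<le> p" and neq: "E p \<noteq> E p\<^sub>0"
    obtain C where C: "C \<subseteq> E p" "\<not> cdependent C" "E p \<subseteq> cspan C"
      using complex_vector.maximal_independent_subset[of "E p"] by blast
    obtain D where D: "C \<subseteq> D" "D \<subseteq> E p\<^sub>0" "\<not> cdependent D" "E p\<^sub>0 \<subseteq> cspan D"
      using complex_vector.maximal_independent_subset_extend[of C "E p\<^sub>0"] C
        anti[OF \<open>p\<^sub>0 \<le> p\<close>] by blast
    have "finite D"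
      using fin anti[of 0 p\<^sub>0] D complex_vector.independent_span_bound[OF _ D(3)]
      by (auto simp: finite_dimensional_def)
    moreover have "C \<noteq> D"
      using complex_vector.span_minimal[OF C(1) sub] D(4) anti[OF \<open>p\<^sub>0 \<le> p\<close>] neq by blast
    ultimately have "card C < card D"
      using D(1) by (intro psubset_card_mono) auto
    moreover have "card C = cdim (E p)" "card D = cdim (E p\<^sub>0)"
      using C D by (auto intro: complex_vector.basis_card_eq_dim)
    ultimately show False
      using min[of p] by simp
  qed
qed

text \<open>
  Let \<open>H\<close> be the intersection of the ranges of all powers of \<open>A\<close>. The subspaces
  \<open>ker A \<inter> A\<^sup>p X\<close> decrease and are finite-dimensional, so they stabilise, and they are nonzero
  because the kernels of the powers grow; hence \<open>H\<close> meets the kernel. Moreover \<open>A\<close> maps \<open>H\<close>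
  onto \<open>H\<close>: any two preimages of \<open>w \<in> H\<close> that lie deep enough in the ranges differ by an
  element of the stable intersection, so one of them lies in all ranges. So a kernel vector in
  \<open>H\<close> can be lifted again and again.
\<close>

lemma backward_chain_exists:
  fixes A :: "'a::complex_normed_vector \<Rightarrow> 'a"
  assumes A: "bounded_clinear A" and ker: "finite_dimensional {x. A x = 0}"
    and grow: "\<And>p. \<exists>x. (A ^^ Suc p) x = 0 \<and> (A ^^ p) x \<noteq> 0"
  obtains w where "w 0 \<noteq> 0" "A (w 0) = 0" "\<And>n. A (w (Suc n)) = w n"
proof -
  define E where "E p = {x. A x = 0} \<inter> range (A ^^ p)" for p
  have anti: "range (A ^^ q) \<subseteq> range (A ^^ p)" if "p \<le> q" for p q
    using funpow_add[of p "q - p" A] that by auto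
  have "csubspace (E p)" for p
    unfolding E_def
    by (intro complex_vector.subspace_inter bounded_clinear_kernel A csubspace_range
        bounded_clinear_funpow)
  moreover have "finite_dimensional (E 0)"
    using ker by (simp add: E_def)
  moreover have "E (Suc p) \<subseteq> E p" for p
    using anti[of p "Suc p"] by (auto simp: E_def)
  ultimately obtain p\<^sub>0 where p\<^sub>0: "\<And>p. p\<^sub>0 \<le> p \<Longrightarrow> E p = E p\<^sub>0"
    using decreasing_finite_dimensional_stabilises by metis
  have deep: "x \<in> range (A ^^ p)" if "\<And>q. p\<^sub>0 \<le> q \<Longrightarrow> x \<in> range (A ^^ q)" for x p
    using that[of "max p\<^sub>0 p"] anti[of p "max p\<^sub>0 p"] by auto
  define H where "H = (\<Inter>p. range (A ^^ p))"
  have start: "\<exists>w. w \<in> H \<and> w \<noteq> 0 \<and> A w = 0"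
  proof -
    obtain x where x: "(A ^^ Suc p\<^sub>0) x = 0" "(A ^^ p\<^sub>0) x \<noteq> 0"
      using grow by blast
    then have "(A ^^ p\<^sub>0) x \<in> E p\<^sub>0"
      by (simp add: E_def)
    then have "(A ^^ p\<^sub>0) x \<in> range (A ^^ q)" if "p\<^sub>0 \<le> q" for q
      using p\<^sub>0[OF that] by (auto simp: E_def)
    then have "(A ^^ p\<^sub>0) x \<in> H"
      unfolding H_def using deep by blast
    then show ?thesis using x by auto
  qed
  have lift: "\<exists>y. y \<in> H \<and> A y = w" if w: "w \<in> H" for w
  proof -
    have "w \<in> range (A ^^ Suc p\<^sub>0)"
      using w unfolding H_def by blast
    then obtain s where s: "w = A ((A ^^ p\<^sub>0) s)"
      by auto
    have "(A ^^ p\<^sub>0) s \<in> range (A ^^ p)" if "p\<^sub>0 \<le> p" for p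
    proof -
      have "w \<in> range (A ^^ Suc p)"
        using w unfolding H_def by blast
      then obtain r where r: "w = A ((A ^^ p) r)"
        by auto
      have "(A ^^ p) r \<in> range (A ^^ p\<^sub>0)"
        using anti[OF that] by blast
      then have "(A ^^ p\<^sub>0) s - (A ^^ p) r \<in> E p\<^sub>0"
        using s r complex_vector.subspace_diff[OF csubspace_range[OF bounded_clinear_funpow[OF A]]]
        by (auto simp: E_def bounded_clinearD[OF A])
      then have "(A ^^ p\<^sub>0) s - (A ^^ p) r \<in> range (A ^^ p)"
        using p\<^sub>0[OF that] by (auto simp: E_def)
      then have "((A ^^ p\<^sub>0) s - (A ^^ p) r) + (A ^^ p) r \<in> range (A ^^ p)"
        by (intro complex_vector.subspace_add csubspace_range bounded_clinear_funpow A) auto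
      then show ?thesis by simp
    qed
    then have "(A ^^ p\<^sub>0) s \<in> H"
      unfolding H_def using deep by blast
    then show ?thesis using s by blast
  qed
  have "\<exists>w. \<forall>n. (w n \<in> H \<and> (n = 0 \<longrightarrow> w n \<noteq> 0 \<and> A (w n) = 0)) \<and> A (w (Suc n)) = w n"
    by (rule dependent_nat_choice) (use start lift in auto)
  then show thesis
    using that by blast
qed

lemma independent_sequence:
  fixes w :: "nat \<Rightarrow> 'a::complex_vector"
  assumes w: "\<And>n. w n \<notin> cspan (w ` {..<n})"
  shows "inj w" "\<not> cdependent (range w)"
proof -
  show "inj w"
  proof (rule linorder_injI)
    fix m n :: nat assume "m < n"
    then have "w m \<in> cspan (w ` {..<n})"
      by (intro complex_vector.span_base) auto
    then show "w m \<noteq> w n"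
      using w[of n] by auto
  qed
  have ind: "\<not> cdependent (w ` {..<n})" for n
  proof (induction n)
    case (Suc n)
    then show ?case
      using w[of n] by (simp add: lessThan_Suc complex_vector.independent_insertI)
  qed (simp add: complex_vector.independent_empty)
  have "\<not> cdependent (\<Union>(range (\<lambda>n. w ` {..<n})))"
  proof (rule complex_vector.independent_Union_directed)
    show "c \<subseteq> d \<or> d \<subseteq> c" if cd: "c \<in> range (\<lambda>n. w ` {..<n})" "d \<in> range (\<lambda>n. w ` {..<n})" for c d
    proof -
      obtain m n where "c = w ` {..<m}" "d = w ` {..<n}"
        using cd by blast
      then show ?thesis
        using linear[of m n] by (auto intro!: image_mono)
    qed
  qed (use ind in auto)
  moreover have "\<Union>(range (\<lambda>n. w ` {..<n})) = range w"
    by blast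
  ultimately show "\<not> cdependent (range w)"
    by simp
qed

text \<open>
  The closed span \<open>V\<close> of a chain is invariant under \<open>T\<close>, so it is the desired halfspace unless
  its codimension is finite. In that case \<open>V\<close> is complemented, and the compression of
  \<open>\<mu> - T\<close> to \<open>V\<close> is its restriction, which shifts the chain backwards.
\<close>

lemma chain_dichotomy:
  fixes T :: "'a::complex_normed_vector \<Rightarrow> 'a"
  assumes T: "bounded_clinear T"
    and w: "w 0 \<noteq> 0" "\<mu> *\<^sub>C w 0 - T (w 0) = 0"
      "\<And>n. \<mu> *\<^sub>C w (Suc n) - T (w (Suc n)) = w n"
  shows "(\<exists>Y. halfspace Y \<and> almost_invariant T Y \<and> defect T Y \<le> 1) \<or>
    (\<exists>V P \<mu> v S.
       csubspace V \<and> closed V \<and> finite_codimensional V \<and>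
       projection_onto V P \<and>
       \<mu> \<in> point_spectrum UNIV T \<inter> point_spectrum V (P \<circ> T) \<and>
       inj_on v {1::nat..} \<and> \<not> cdependent (v ` {1..}) \<and> v ` {1..} \<subseteq> V \<and>
       closure (cspan (v ` {1..})) = V \<and>
       (\<forall>x\<in>V. S x = P (\<mu> *\<^sub>C x - T x) \<and> S x = \<mu> *\<^sub>C x - P (T x)) \<and>
       (\<forall>n\<ge>1. S (v (n + 1)) = v n) \<and> S (v 1) = 0)"
proof -
  define A where "A x = \<mu> *\<^sub>C x - T x" for x
  have A: "bounded_clinear A"
    unfolding A_def
    by (intro bounded_clinear_diff bounded_clinear_scale bounded_clinear_ident T)
  have Aw: "A (w 0) = 0" "\<And>n. A (w (Suc n)) = w n"
    using w by (auto simp: A_def)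
  have top: "(A ^^ n) (w n) = w 0" for n
    by (induction n) (simp_all add: Aw funpow_swap1 del: funpow.simps(2) add: funpow_Suc_right)
  have low: "(A ^^ n) (w m) = 0" if "m < n" for m n
    using that
  proof (induction n arbitrary: m)
    case (Suc n)
    then show ?case
      by (cases m) (auto simp: funpow_Suc_right Aw simp del: funpow.simps(2)
          intro: bounded_clinearD(5)[OF bounded_clinear_funpow[OF A]])
  qed simp
  have notin: "w n \<notin> cspan (w ` {..<n})" for n
  proof
    assume "w n \<in> cspan (w ` {..<n})"
    moreover have "cspan (w ` {..<n}) \<subseteq> {x. (A ^^ n) x = 0}"
      using low
      by (intro complex_vector.span_minimal bounded_clinear_kernel bounded_clinear_funpow A) auto
    ultimately show False
      using top w(1) by auto
  qed
  note ind = independent_sequence[OF notin]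
  define V where "V = closure (cspan (range w))"
  have V: "csubspace V" "closed V"
    unfolding V_def by (auto intro: csubspace_closure)
  have "range w \<subseteq> V"
    unfolding V_def by (rule order_trans[OF complex_vector.span_superset closure_subset])
  then have wV: "w n \<in> V" for n
    by blast
  have inf: "\<not> finite_dimensional V"
  proof
    assume "finite_dimensional V"
    then obtain B where "finite B" "V = cspan B"
      by (auto simp: finite_dimensional_def)
    then have "finite (range w)"
      using complex_vector.independent_span_bound[of B, OF _ ind(2)] \<open>range w \<subseteq> V\<close> by auto
    then show False
      using finite_imageD[OF _ ind(1)] by simp
  qed
  have AV: "A x \<in> V" if "x \<in> V" for x
  proof (rule bounded_clinear_closure_image[OF A V])
    have "A (w n) \<in> V" for n
      using Aw wV complex_vector.subspace_0[OF V(1)] by (cases n) auto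
    then show "A z \<in> V" if "z \<in> cspan (range w)" for z
      using complex_vector.span_minimal[OF _ bounded_clinear_preimage(1)[OF A V(1)], of "range w"]
        that by auto
    show "x \<in> closure (cspan (range w))"
      using that by (simp add: V_def)
  qed
  have TV: "T x \<in> V" if "x \<in> V" for x
  proof -
    have "\<mu> *\<^sub>C x - A x \<in> V"
      using AV[OF that] that V(1) complex_vector.subspace_diff complex_vector.subspace_scale by blast
    then show ?thesis by (simp add: A_def)
  qed
  show ?thesis
  proof (cases "finite_codimensional V")
    case False
    then have "halfspace V"
      using V inf by (simp add: halfspace_def)
    moreover have "T y \<in> cspan (insert 0 V)" if "y \<in> V" for y
      using TV[OF that] by (simp add: complex_vector.span_base)
    ultimately show ?thesis
      using almost_invariant_one_vector[OF V(1), of T 0]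
      by (intro disjI1 exI[of _ V] conjI) blast+
  next
    case True
    show ?thesis
    proof (rule finite_codimensional_projection[OF True V(2)])
      fix P
      assume P: "bounded_clinear P" "\<And>x. P x \<in> V" "\<And>x. x \<in> V \<Longrightarrow> P x = x"
      \<comment> \<open>The chain starts at index \<open>0\<close>, the sequence of the theorem at index \<open>1\<close>.\<close>
      define v where "v n = w (n - 1)" for n
      have v: "v ` {1..} = range w"
      proof -
        have "{1::nat..} = range Suc"
          by (auto simp: image_iff Suc_le_D)
        then show ?thesis
          by (simp add: v_def image_image)
      qed
      have "inj_on v {1..}"
        by (rule inj_onI) (auto simp: v_def dest!: injD[OF ind(1)])
      moreover have "projection_onto V P"
      proof -
        have "range P = V"
          using P(2) P(3) by (metis image_subsetI rangeI subset_antisym subsetI)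
        moreover have "P \<circ> P = P"
          using P(3)[OF P(2)] by (simp add: fun_eq_iff)
        ultimately show ?thesis
          using P(1) by (simp add: projection_onto_def operators_iff_bounded_clinear)
      qed
      moreover have "\<mu> \<in> point_spectrum UNIV T"
      proof -
        have "A (w 0) = A 0"
          using Aw(1) bounded_clinearD(5)[OF A] by simp
        then show ?thesis
          using w(1) unfolding point_spectrum_def A_def inj_on_def by blast
      qed
      moreover have "\<mu> \<in> point_spectrum V (P \<circ> T)"
      proof -
        have "P (T (w 0)) = \<mu> *\<^sub>C w 0" "P (T 0) = 0"
          using Aw(1) P(3)[OF TV[OF wV[of 0]]]
          by (auto simp: A_def bounded_clinearD[OF T] bounded_clinearD[OF P(1)])
        then have "\<mu> *\<^sub>C w 0 - (P \<circ> T) (w 0) = \<mu> *\<^sub>C 0 - (P \<circ> T) 0"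
          by simp
        then show ?thesis
          using w(1) wV[of 0] complex_vector.subspace_0[OF V(1)]
          unfolding point_spectrum_def inj_on_def by blast
      qed
      moreover have "P (\<mu> *\<^sub>C x - T x) = \<mu> *\<^sub>C x - P (T x)" if "x \<in> V" for x
        using P(3)[OF that] by (simp add: bounded_clinearD[OF P(1)])
      moreover have "P (\<mu> *\<^sub>C v (n + 1) - T (v (n + 1))) = v n" if "n \<ge> 1" for n
        using w(3)[of "n - 1"] that P(3)[OF wV] by (simp add: v_def)
      moreover have "P (\<mu> *\<^sub>C v 1 - T (v 1)) = 0"
        using w(2) by (simp add: v_def bounded_clinearD[OF P(1)])
      ultimately show ?thesis
        using V True v ind(2) \<open>range w \<subseteq> V\<close>
        by (intro disjI2 exI[of _ V] exI[of _ P] exI[of _ \<mu>] exI[of _ v]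
            exI[of _ "\<lambda>x. P (\<mu> *\<^sub>C x - T x)"]) (simp add: V_def)
    qed
  qed
qed

section \<open>The dual space\<close>

instantiation blinfun :: (real_normed_vector, complex_normed_vector) complex_normed_vector
begin

lift_definition scaleC_blinfun :: "complex \<Rightarrow> 'a \<Rightarrow>\<^sub>L 'b \<Rightarrow> 'a \<Rightarrow>\<^sub>L 'b" is "\<lambda>c f x. c *\<^sub>C f x"
  by (rule bounded_linear_compose[OF
      bounded_clinearD(1)[OF bounded_clinear_scale[OF bounded_clinear_ident]]])

instance
proof
  fix a b :: complex and f g :: "'a \<Rightarrow>\<^sub>L 'b" and r :: real
  show "a *\<^sub>C (f + g) = a *\<^sub>C f + a *\<^sub>C g"
    by transfer (simp add: scaleC_add_right)
  show "(a + b) *\<^sub>C f = a *\<^sub>C f + b *\<^sub>C f"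
    by transfer (simp add: scaleC_add_left)
  show "a *\<^sub>C b *\<^sub>C f = (a * b) *\<^sub>C f" "1 *\<^sub>C f = f"
    by (transfer, simp)+
  show "r *\<^sub>R f = complex_of_real r *\<^sub>C f"
    by transfer (simp add: scaleR_scaleC)
  have le: "norm (c *\<^sub>C h) \<le> cmod c * norm h" for c and h :: "'a \<Rightarrow>\<^sub>L 'b"
  proof (rule norm_blinfun_bound)
    show "norm (blinfun_apply (c *\<^sub>C h) x) \<le> cmod c * norm h * norm x" for x
      using norm_blinfun[of h x]
      by (simp add: scaleC_blinfun.rep_eq mult.assoc mult_left_mono)
  qed simp
  show "norm (a *\<^sub>C f) = cmod a * norm f"
  proof (cases "a = 0")
    case True
    then show ?thesis
      using le[of 0 f] by simp
  next
    case False
    have "(1 / a) *\<^sub>C a *\<^sub>C f = f"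
      using False by (transfer, simp)
    then have "norm f \<le> cmod (1 / a) * norm (a *\<^sub>C f)"
      using le[of "1 / a" "a *\<^sub>C f"] by simp
    then show ?thesis
      using le[of a f] False by (simp add: norm_divide field_simps)
  qed
qed

end

lemmas scaleC_blinfun_apply [simp] = scaleC_blinfun.rep_eq

text \<open>
  The Hahn--Banach theorem will be applied to functionals on the dual, so the dual has to lie in
  a complex normed space: it is a complex subspace of the continuous real linear maps into the
  complex numbers.
\<close>

definition dual :: "('a::complex_normed_vector \<Rightarrow>\<^sub>L complex) set"
  where "dual = {f. bounded_clinear (blinfun_apply f)}"

lemma dual_iff: "f \<in> dual \<longleftrightarrow> (\<forall>c x. blinfun_apply f (c *\<^sub>C x) = c * blinfun_apply f x)"
  by (auto simp: dual_def bounded_clinear_def blinfun.bounded_linear_right)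

lemma csubspace_dual: "csubspace dual"
  by (rule complex_vector.subspaceI)
    (auto simp: dual_iff blinfun.add_left algebra_simps)

lemma dual_functional:
  fixes g :: "'a::complex_normed_vector \<Rightarrow> complex"
  assumes g: "bounded_clinear g" "\<And>x. cmod (g x) \<le> K * norm x" and "0 \<le> K"
  shows "Blinfun g \<in> dual" "blinfun_apply (Blinfun g) = g" "norm (Blinfun g) \<le> K"
proof -
  show *: "blinfun_apply (Blinfun g) = g"
    using g(1) by (simp add: bounded_clinear_def bounded_linear_Blinfun_apply)
  show "Blinfun g \<in> dual"
    using g(1) * by (simp add: dual_def)
  show "norm (Blinfun g) \<le> K"
    using assms by (intro norm_blinfun_bound) (simp_all add: *)
qed

lemma dual_of_bounded_clinear:
  fixes g :: "'a::complex_normed_vector \<Rightarrow> complex"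
  assumes "bounded_clinear g"
  shows "Blinfun g \<in> dual" "blinfun_apply (Blinfun g) = g"
proof -
  obtain K where K: "K > 0" "\<And>x. cmod (g x) \<le> K * norm x"
    using bounded_clinear_bound[OF assms] by blast
  show "Blinfun g \<in> dual" "blinfun_apply (Blinfun g) = g"
    using dual_functional[OF assms K(2)] K(1) by auto
qed

lemma dual_separates:
  fixes x :: "'a::complex_normed_vector"
  obtains f where "f \<in> dual" "norm f \<le> 1" "blinfun_apply f x = complex_of_real (norm x)"
proof (rule norming_functional[of x])
  fix g :: "'a \<Rightarrow> complex"
  assume g: "bounded_clinear g" "g x = complex_of_real (norm x)" "\<And>y. cmod (g y) \<le> norm y"
  then show thesis
    using dual_functional[of g 1] that[of "Blinfun g"] by simp
qed

text \<open>
  Every functional can be changed by a combination of coordinate functionals so as to vanish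
  on a finite set; the coordinate functionals depend on the set only.
\<close>

lemma dual_coordinates:
  fixes F :: "'a::complex_normed_vector set"
  assumes "finite F"
  obtains C and f :: "'a \<Rightarrow> 'a \<Rightarrow>\<^sub>L complex"
  where "finite C" "\<And>b. b \<in> C \<Longrightarrow> f b \<in> dual"
    "\<And>g y. g \<in> dual \<Longrightarrow> y \<in> F \<Longrightarrow> blinfun_apply (g - (\<Sum>b\<in>C. blinfun_apply g b *\<^sub>C f b)) y = 0"
proof (rule coordinates_modulo[OF csubspace_zero closed_singleton \<open>finite F\<close>])
  fix C and f :: "'a \<Rightarrow> 'a \<Rightarrow> complex"
  assume C: "C \<subseteq> F" "\<And>b. b \<in> C \<Longrightarrow> bounded_clinear (f b)"
    and x: "\<And>x. x \<in> cspan (F \<union> {0}) \<Longrightarrow> x - (\<Sum>b\<in>C. f b x *\<^sub>C b) \<in> {0}"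
  show thesis
  proof (rule that[of C "\<lambda>b. Blinfun (f b)"])
    show "finite C"
      using C(1) \<open>finite F\<close> finite_subset by blast
    show "Blinfun (f b) \<in> dual" if "b \<in> C" for b
      using dual_of_bounded_clinear C(2)[OF that] by blast
    show "blinfun_apply (g - (\<Sum>b\<in>C. blinfun_apply g b *\<^sub>C Blinfun (f b))) y = 0"
      if g: "g \<in> dual" and y: "y \<in> F" for g y
    proof -
      have "y - (\<Sum>b\<in>C. f b y *\<^sub>C b) = 0"
        using x[of y] y complex_vector.span_base[of y "F \<union> {0}"] by blast
      then have "blinfun_apply g (y - (\<Sum>b\<in>C. f b y *\<^sub>C b)) = 0"
        by (simp only: blinfun.zero_right)
      moreover have "blinfun_apply (\<Sum>b\<in>C. blinfun_apply g b *\<^sub>C Blinfun (f b)) y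
          = (\<Sum>b\<in>C. blinfun_apply g b * f b y)"
        unfolding blinfun.sum_left
        by (intro sum.cong) (auto simp: dual_of_bounded_clinear(2)[OF C(2)])
      moreover have "blinfun_apply g (\<Sum>b\<in>C. f b y *\<^sub>C b) = (\<Sum>b\<in>C. blinfun_apply g b * f b y)"
        unfolding blinfun.sum_right using g by (intro sum.cong) (auto simp: dual_iff)
      ultimately show ?thesis
        by (simp add: blinfun.diff_left blinfun.diff_right)
    qed
  qed
qed

section \<open>Bidual functionals outside the canonical image\<close>

text \<open>
  If \<open>\<phi>\<close> is small on the annihilator of a finite set, extend the restriction to the annihilator
  with the same bound; the difference vanishes on an annihilator of finite codimension and is
  therefore evaluation at a vector.
\<close>

lemma bidual_near_evaluation:
  fixes \<phi> :: "('a::complex_normed_vector \<Rightarrow>\<^sub>L complex) \<Rightarrow> complex"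
  assumes \<phi>: "bounded_clinear \<phi>" and F: "finite F" and \<epsilon>: "0 \<le> \<epsilon>"
    and small: "\<And>v. v \<in> dual \<Longrightarrow> \<forall>y\<in>F. blinfun_apply v y = 0 \<Longrightarrow> cmod (\<phi> v) \<le> \<epsilon> * norm v"
  shows "\<exists>y. \<forall>f\<in>dual. cmod (\<phi> f - blinfun_apply f y) \<le> \<epsilon> * norm f"
proof -
  define M where "M = {v \<in> dual. \<forall>y\<in>F. blinfun_apply v y = 0}"
  have M: "csubspace M"
    using complex_vector.subspace_0[OF csubspace_dual] complex_vector.subspace_add[OF csubspace_dual]
      complex_vector.subspace_scale[OF csubspace_dual]
    by (auto intro!: complex_vector.subspaceI simp: M_def blinfun.add_left)
  obtain \<psi> where \<psi>: "bounded_clinear \<psi>" "\<And>v. v \<in> M \<Longrightarrow> \<psi> v = \<phi> v" "\<And>v. cmod (\<psi> v) \<le> \<epsilon> * norm v"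
    using hahn_banach[OF M, of \<phi> \<epsilon>] small \<epsilon> bounded_clinearD(2,3)[OF \<phi>]
    by (auto simp: M_def)
  define \<theta> where "\<theta> f = \<phi> f - \<psi> f" for f
  have \<theta>: "bounded_clinear \<theta>"
    unfolding \<theta>_def by (rule bounded_clinear_diff[OF \<phi> \<psi>(1)])
  show ?thesis
  proof (rule dual_coordinates[OF F])
    fix C and f :: "'a \<Rightarrow> 'a \<Rightarrow>\<^sub>L complex"
    assume C: "\<And>b. b \<in> C \<Longrightarrow> f b \<in> dual" and van: "\<And>g y. g \<in> dual \<Longrightarrow> y \<in> F \<Longrightarrow>
      blinfun_apply (g - (\<Sum>b\<in>C. blinfun_apply g b *\<^sub>C f b)) y = 0"
    define y where "y = (\<Sum>b\<in>C. \<theta> (f b) *\<^sub>C b)"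
    have "\<phi> g - blinfun_apply g y = \<psi> g" if g: "g \<in> dual" for g
    proof -
      have "(\<Sum>b\<in>C. blinfun_apply g b *\<^sub>C f b) \<in> dual"
        by (intro complex_vector.subspace_sum complex_vector.subspace_scale csubspace_dual C)
      then have "g - (\<Sum>b\<in>C. blinfun_apply g b *\<^sub>C f b) \<in> M"
        using van[OF g] g complex_vector.subspace_diff[OF csubspace_dual] by (simp add: M_def)
      then have "\<theta> (g - (\<Sum>b\<in>C. blinfun_apply g b *\<^sub>C f b)) = 0"
        by (simp add: \<theta>_def \<psi>(2))
      then have "\<theta> g = (\<Sum>b\<in>C. blinfun_apply g b * \<theta> (f b))"
        by (simp add: bounded_clinearD[OF \<theta>])
      also have "\<dots> = blinfun_apply g y"
        unfolding y_def blinfun.sum_right using g by (intro sum.cong) (auto simp: dual_iff)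
      finally show ?thesis
        by (simp add: \<theta>_def algebra_simps)
    qed
    then show ?thesis
      using \<psi>(3) by (intro exI[of _ y] ballI) simp
  qed
qed

text \<open>
  Without a uniform bound \<open>C\<close>, \<open>\<phi>\<close> would be arbitrarily small on suitable annihilators, hence a
  limit of evaluations at vectors; these form a Cauchy sequence since the canonical map into the
  bidual is isometric, and \<open>\<phi>\<close> would be evaluation at their limit.
\<close>

lemma bidual_not_evaluation:
  fixes \<phi> :: "('a::complex_banach \<Rightarrow>\<^sub>L complex) \<Rightarrow> complex"
  assumes \<phi>: "bounded_clinear \<phi>" and no: "\<nexists>y. \<forall>f\<in>dual. \<phi> f = blinfun_apply f y"
  obtains C where "\<And>F. finite F \<Longrightarrow>
    \<exists>v\<in>dual. (\<forall>y\<in>F. blinfun_apply v y = 0) \<and> \<phi> v = 1 \<and> norm v \<le> C"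
proof (rule ccontr)
  assume "\<not> thesis"
  then have bad: "\<exists>F. finite F \<and>
      (\<forall>v\<in>dual. (\<forall>y\<in>F. blinfun_apply v y = 0) \<longrightarrow> \<phi> v = 1 \<longrightarrow> C < norm v)" for C
    using that by (meson not_le)
  define \<epsilon> where "\<epsilon> n = inverse (real (Suc n))" for n
  have \<epsilon>: "\<epsilon> n > 0" for n
    by (simp add: \<epsilon>_def)
  have "\<exists>y. \<forall>f\<in>dual. cmod (\<phi> f - blinfun_apply f y) \<le> \<epsilon> n * norm f" for n
  proof -
    obtain F where F: "finite F"
      "\<And>v. v \<in> dual \<Longrightarrow> \<forall>y\<in>F. blinfun_apply v y = 0 \<Longrightarrow> \<phi> v = 1 \<Longrightarrow> real (Suc n) < norm v"
      using bad[of "real (Suc n)"] by metis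
    have "cmod (\<phi> v) \<le> \<epsilon> n * norm v" if v: "v \<in> dual" "\<forall>y\<in>F. blinfun_apply v y = 0" for v
    proof (cases "\<phi> v = 0")
      case False
      have "real (Suc n) < norm ((1 / \<phi> v) *\<^sub>C v)"
        using v False complex_vector.subspace_scale[OF csubspace_dual v(1)]
        by (intro F(2)) (auto simp: bounded_clinearD[OF \<phi>])
      then show ?thesis
        using False by (simp add: \<epsilon>_def norm_divide field_simps)
    qed (use \<epsilon>[of n] in simp)
    then show ?thesis
      using bidual_near_evaluation[OF \<phi> F(1)] \<epsilon>[of n] by simp
  qed
  then obtain y where y: "\<And>n f. f \<in> dual \<Longrightarrow> cmod (\<phi> f - blinfun_apply f (y n)) \<le> \<epsilon> n * norm f"
    by metis
  have dist: "norm (y m - y n) \<le> \<epsilon> m + \<epsilon> n" for m n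
  proof (rule dual_separates[of "y m - y n"])
    fix f :: "'a \<Rightarrow>\<^sub>L complex"
    assume f: "f \<in> dual" "norm f \<le> 1"
      "blinfun_apply f (y m - y n) = complex_of_real (norm (y m - y n))"
    have "norm (y m - y n) = cmod (blinfun_apply f (y m - y n))"
      by (simp add: f)
    also have "blinfun_apply f (y m - y n)
        = (\<phi> f - blinfun_apply f (y n)) - (\<phi> f - blinfun_apply f (y m))"
      by (simp add: blinfun.diff_right)
    also have "cmod \<dots> \<le> \<epsilon> n * norm f + \<epsilon> m * norm f"
      by (rule order_trans[OF norm_triangle_ineq4 add_mono]) (rule y[OF f(1)])+
    also have "\<dots> \<le> \<epsilon> n * 1 + \<epsilon> m * 1"
      using f(2) \<epsilon>[of n] \<epsilon>[of m] by (intro add_mono mult_left_mono) auto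
    finally show ?thesis by simp
  qed
  have \<epsilon>0: "\<epsilon> \<longlonglongrightarrow> 0"
    unfolding \<epsilon>_def by (rule LIMSEQ_inverse_real_of_nat)
  have "Cauchy y"
  proof (rule CauchyI)
    fix e :: real assume "e > 0"
    then obtain N where N: "\<And>n. n \<ge> N \<Longrightarrow> \<epsilon> n < e / 2"
      using order_tendstoD(2)[OF \<epsilon>0, of "e / 2"] by (auto simp: eventually_sequentially)
    have "norm (y m - y n) < e" if "m \<ge> N" "n \<ge> N" for m n
      using dist[of m n] N[OF that(1)] N[OF that(2)] by simp
    then show "\<exists>M. \<forall>m\<ge>M. \<forall>n\<ge>M. norm (y m - y n) < e"
      by blast
  qed
  then obtain z where z: "y \<longlonglongrightarrow> z"
    using Cauchy_convergent_iff convergent_def by blast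
  have "\<phi> f = blinfun_apply f z" if f: "f \<in> dual" for f
  proof -
    have "(\<lambda>n. blinfun_apply f (y n)) \<longlonglongrightarrow> \<phi> f"
    proof (rule Lim_null_comparison[THEN LIM_zero_cancel])
      show "\<forall>\<^sub>F n in sequentially. norm (blinfun_apply f (y n) - \<phi> f) \<le> \<epsilon> n * norm f"
        using y[OF f] by (simp add: norm_minus_commute)
      show "(\<lambda>n. \<epsilon> n * norm f) \<longlonglongrightarrow> 0"
        using tendsto_mult_left_zero[OF \<epsilon>0] by simp
    qed
    moreover have "(\<lambda>n. blinfun_apply f (y n)) \<longlonglongrightarrow> blinfun_apply f z"
      by (rule bounded_linear.tendsto[OF blinfun.bounded_linear_right z])
    ultimately show ?thesis
      using LIMSEQ_unique by blast
  qed
  then show False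
    using no by blast
qed

text \<open>
  By Tychonoff's theorem the evaluations at a bounded sequence have a pointwise cluster point.
\<close>

lemma cluster_functional:
  fixes x :: "nat \<Rightarrow> 'a::complex_normed_vector"
  assumes x: "\<And>n. norm (x n) \<le> 1"
  obtains \<phi> :: "('a \<Rightarrow>\<^sub>L complex) \<Rightarrow> complex"
  where "bounded_clinear \<phi>"
    "\<And>G e N. finite G \<Longrightarrow> e > 0 \<Longrightarrow> \<exists>n\<ge>N. \<forall>f\<in>G. cmod (blinfun_apply f (x n) - \<phi> f) < e"
proof -
  define K where "K = Pi\<^sub>E UNIV (\<lambda>f :: 'a \<Rightarrow>\<^sub>L complex. cball (0::complex) (norm f))"
  have "compactin (product_topology (\<lambda>_. euclidean) UNIV) K"
    unfolding K_def compactin_PiE by (auto simp: compactin_euclidean_iff)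
  then have K: "compact K"
    by (simp add: euclidean_product_topology compactin_euclidean_iff)
  define s where "s n = (\<lambda>f :: 'a \<Rightarrow>\<^sub>L complex. blinfun_apply f (x n))" for n
  have "s n \<in> K" for n
  proof -
    have "norm (blinfun_apply f (x n)) \<le> norm f" for f :: "'a \<Rightarrow>\<^sub>L complex"
      using norm_blinfun[of f "x n"] mult_left_mono[OF x[of n] norm_ge_zero[of f]] by simp
    then show ?thesis
      by (simp add: K_def s_def PiE_UNIV_domain Pi_iff)
  qed
  then have "eventually (\<lambda>g. g \<in> K) (filtermap s sequentially)"
    by (simp add: eventually_filtermap)
  then obtain \<phi> where \<phi>: "\<phi> \<in> K" "inf (nhds \<phi>) (filtermap s sequentially) \<noteq> bot"
    using K[unfolded compact_filter, rule_format, of "filtermap s sequentially"]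
    by (auto simp: filtermap_bot_iff)
  have near: "\<exists>n\<ge>N. \<forall>f\<in>G. cmod (blinfun_apply f (x n) - \<phi> f) < e"
    if "finite G" "e > 0" for G and e :: real and N
  proof (rule ccontr)
    assume neg: "\<not> ?thesis"
    have "eventually (\<lambda>g. \<forall>f\<in>G. dist (g f) (\<phi> f) < e) (nhds \<phi>)"
    proof (rule eventually_ball_finite[OF \<open>finite G\<close>], rule ballI)
      fix f assume "f \<in> G"
      have "((\<lambda>g. g f) \<longlongrightarrow> \<phi> f) (at \<phi> within UNIV)"
        using continuous_on_product_coordinates[of f] unfolding continuous_on_def by blast
      then have "((\<lambda>g. g f) \<longlongrightarrow> \<phi> f) (nhds \<phi>)"
        using tendsto_at_iff_tendsto_nhds[of "\<lambda>g. g f" \<phi>] by simp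
      then show "eventually (\<lambda>g. dist (g f) (\<phi> f) < e) (nhds \<phi>)"
        using \<open>e > 0\<close> by (rule tendstoD)
    qed
    moreover have "eventually (\<lambda>g. g \<in> s ` {N..}) (filtermap s sequentially)"
      unfolding eventually_filtermap eventually_sequentially by blast
    moreover have "\<not> (\<forall>f\<in>G. dist (g f) (\<phi> f) < e)" if "g \<in> s ` {N..}" for g
      using neg that by (auto simp: s_def dist_norm)
    ultimately have "eventually (\<lambda>g. False) (inf (nhds \<phi>) (filtermap s sequentially))"
      unfolding eventually_inf by blast
    then show False
      using \<phi>(2) by (simp add: trivial_limit_def)
  qed
  have zero: "z = 0" if "\<And>e. e > 0 \<Longrightarrow> cmod z \<le> e" for z
    using that field_le_epsilon[of "cmod z" 0] by auto
  show thesis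
  proof (rule that[OF bounded_clinearI[where K = 1] near])
    show "\<phi> (f + g) = \<phi> f + \<phi> g" for f g
    proof (rule zero[THEN iffD1[OF eq_iff_diff_eq_0[symmetric]]])
      fix e :: real assume "e > 0"
      then obtain n where n: "\<forall>h\<in>{f, g, f + g}. cmod (blinfun_apply h (x n) - \<phi> h) < e / 3"
        using near[of "{f, g, f + g}" "e / 3" 0] by auto
      have "cmod (\<phi> (f + g) - (\<phi> f + \<phi> g)) = cmod (- (blinfun_apply (f + g) (x n) - \<phi> (f + g))
          + (blinfun_apply f (x n) - \<phi> f) + (blinfun_apply g (x n) - \<phi> g))"
        by (simp add: blinfun.add_left algebra_simps)
      also have "\<dots> \<le> e / 3 + e / 3 + e / 3"
        using n by (intro order_trans[OF norm_triangle_ineq add_mono]) (auto intro: less_imp_le simp del: minus_diff_eq)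
      finally show "cmod (\<phi> (f + g) - (\<phi> f + \<phi> g)) \<le> e" by simp
    qed
    show "\<phi> (c *\<^sub>C f) = c *\<^sub>C \<phi> f" for c f
    proof (rule zero[THEN iffD1[OF eq_iff_diff_eq_0[symmetric]]])
      fix e :: real assume "e > 0"
      define d where "d = e / (1 + cmod c)"
      have d: "d > 0" "d + cmod c * d = e"
      proof -
        have "1 + cmod c > 0"
          using norm_ge_zero[of c] by linarith
        then have "d > 0" "(1 + cmod c) * d = e"
          using \<open>e > 0\<close> by (simp_all add: d_def)
        then show "d > 0" "d + cmod c * d = e"
          by (simp_all add: distrib_right)
      qed
      obtain n where n: "\<forall>h\<in>{f, c *\<^sub>C f}. cmod (blinfun_apply h (x n) - \<phi> h) < d"
        using near[of "{f, c *\<^sub>C f}" d 0] d by auto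
      have "cmod (\<phi> (c *\<^sub>C f) - c *\<^sub>C \<phi> f) = cmod (- (blinfun_apply (c *\<^sub>C f) (x n) - \<phi> (c *\<^sub>C f))
          + c * (blinfun_apply f (x n) - \<phi> f))"
        by (simp add: algebra_simps)
      also have "\<dots> \<le> d + cmod c * d"
        using n
        by (intro order_trans[OF norm_triangle_ineq add_mono])
          (auto simp: norm_mult intro: less_imp_le mult_left_mono simp del: minus_diff_eq)
      finally show "cmod (\<phi> (c *\<^sub>C f) - c *\<^sub>C \<phi> f) \<le> e"
        using d by simp
    qed
    show "cmod (\<phi> f) \<le> 1 * norm f" for f
      using \<phi>(1) by (auto simp: K_def PiE_iff)
  qed
qed

section \<open>Minimal subsequences\<close>

text \<open>
  If every \<open>u k\<close> vanishes on the earlier vectors and is very small on the later ones, the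
  coefficients of a linear combination \<open>z\<close> of the vectors are estimated by downward recursion:
  applying \<open>u k\<close> to \<open>z\<close> leaves the \<open>k\<close>-th coefficient and an error controlled by the later
  coefficients. The powers of \<open>1 / 2\<close> keep the total error below the norm of \<open>z\<close>. So no vector lies
  in the closed span of the others.
\<close>

lemma triangular_coefficient_bound:
  fixes y :: "nat \<Rightarrow> 'a::complex_normed_vector" and u :: "nat \<Rightarrow> 'a \<Rightarrow> complex"
    and a :: "nat \<Rightarrow> complex"
  assumes u: "\<And>k. bounded_clinear (u k)" and bd: "\<And>k z. cmod (u k z) \<le> C k * norm z"
    and C: "\<And>k. 1 \<le> C k"
    and low: "\<And>j k. j < k \<Longrightarrow> u k (y j) = 0" and one: "\<And>k. u k (y k) = 1"
    and high: "\<And>i k. i < k \<Longrightarrow> cmod (u i (y k)) * C k \<le> (1 / 2) ^ (k + 2)"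
    and "k < m"
  shows "cmod (a k) \<le> 2 * C k * norm (\<Sum>j<m. a j *\<^sub>C y j)"
  using \<open>k < m\<close>
proof (induction "m - k" arbitrary: k rule: less_induct)
  case less
  define z where "z = (\<Sum>j<m. a j *\<^sub>C y j)"
  have "u k z = (\<Sum>j<m. a j * u k (y j))"
    by (simp add: z_def bounded_clinearD[OF u])
  also have "\<dots> = (\<Sum>j\<in>{k..<m}. a j * u k (y j))"
    using low by (intro sum.mono_neutral_right) auto
  also have "\<dots> = a k + (\<Sum>j\<in>{Suc k..<m}. a j * u k (y j))"
    using less.prems by (simp add: sum.atLeast_Suc_lessThan one)
  finally have ak: "a k = u k z - (\<Sum>j\<in>{Suc k..<m}. a j * u k (y j))"
    by simp
  have term_le: "cmod (a j * u k (y j)) \<le> norm z * (1 / 2) ^ (j + 1)" if j: "j \<in> {Suc k..<m}" for j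
  proof -
    have "cmod (a j * u k (y j)) \<le> (2 * C j * norm z) * cmod (u k (y j))"
      unfolding norm_mult using less.hyps[of j] j by (intro mult_right_mono) (auto simp: z_def)
    also have "\<dots> = 2 * norm z * (cmod (u k (y j)) * C j)"
      by simp
    also have "\<dots> \<le> 2 * norm z * (1 / 2) ^ (j + 2)"
      using high[of k j] j by (intro mult_left_mono) auto
    finally show ?thesis by simp
  qed
  have "cmod (\<Sum>j\<in>{Suc k..<m}. a j * u k (y j)) \<le> (\<Sum>j\<in>{Suc k..<m}. norm z * (1 / 2) ^ (j + 1))"
    by (rule sum_norm_le) (rule term_le)
  also have "\<dots> \<le> (\<Sum>j<m. norm z * (1 / 2) ^ (j + 1))"
    by (rule sum_mono2) auto
  also have "\<dots> = norm z * (\<Sum>j<m. (1 / 2) ^ (j + 1))"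
    by (simp add: sum_distrib_left)
  also have "(\<Sum>j<m. (1 / 2::real) ^ (j + 1)) = 1 - (1 / 2) ^ m"
    by (induction m) auto
  also have "norm z * (1 - (1 / 2) ^ m) \<le> norm z"
    by (simp add: mult_left_le)
  finally have "cmod (a k) \<le> C k * norm z + norm z"
    unfolding ak using bd[of k z] by (intro order_trans[OF norm_triangle_ineq4]) auto
  also have "\<dots> \<le> C k * norm z + C k * norm z"
    using mult_right_mono[OF C[of k], of "norm z"] by simp
  finally show ?case
    by (simp add: z_def)
qed

lemma triangular_biorthogonal:
  fixes y :: "nat \<Rightarrow> 'a::complex_normed_vector" and u :: "nat \<Rightarrow> 'a \<Rightarrow> complex"
  assumes u: "\<And>k. bounded_clinear (u k)" and bd: "\<And>k z. cmod (u k z) \<le> C k * norm z"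
    and C: "\<And>k. 1 \<le> C k"
    and low: "\<And>j k. j < k \<Longrightarrow> u k (y j) = 0" and one: "\<And>k. u k (y k) = 1"
    and high: "\<And>i k. i < k \<Longrightarrow> cmod (u i (y k)) * C k \<le> (1 / 2) ^ (k + 2)"
  obtains g :: "nat \<Rightarrow> 'a \<Rightarrow> complex"
  where "\<And>k. bounded_clinear (g k)" "\<And>j k. g k (y j) = (if j = k then 1 else 0)"
proof -
  have "\<exists>g :: 'a \<Rightarrow> complex. bounded_clinear g \<and> (\<forall>j. g (y j) = (if j = k then 1 else 0))" for k
  proof -
    let ?M = "cspan (y ` (UNIV - {k}))"
    have far: "1 \<le> 2 * C k * norm (y k - z)" if z: "z \<in> ?M" for z
    proof -
      have "\<exists>a m. k < m \<and> a k = 0 \<and> z = (\<Sum>j<m. a j *\<^sub>C y j)"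
        using z
      proof (induction rule: complex_vector.span_induct_alt)
        case base
        show ?case
          by (intro exI[of _ "\<lambda>_. 0"] exI[of _ "Suc k"]) simp
      next
        case (step c x z)
        then obtain i a m where i: "x = y i" "i \<noteq> k"
          and a: "k < m" "a k = 0" "z = (\<Sum>j<m. a j *\<^sub>C y j)"
          by blast
        define m' where "m' = max m (Suc i)"
        define a' where "a' j = (if j < m then a j else 0) + (if j = i then c else 0)" for j
        have "(\<Sum>j<m'. (if j < m then a j else 0) *\<^sub>C y j) = z"
          unfolding a(3) by (rule sum.mono_neutral_cong_right) (auto simp: m'_def)
        moreover have "(\<Sum>j<m'. (if j = i then c else 0) *\<^sub>C y j) = c *\<^sub>C x"
        proof -
          have "(\<Sum>j<m'. (if j = i then c else 0) *\<^sub>C y j) = (\<Sum>j<m'. if j = i then c *\<^sub>C y i else 0)"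
            by (intro sum.cong) auto
          then show ?thesis by (simp add: i m'_def less_max_iff_disj)
        qed
        ultimately have "(\<Sum>j<m'. a' j *\<^sub>C y j) = c *\<^sub>C x + z"
          by (simp add: a'_def scaleC_add_left sum.distrib)
        moreover have "k < m'" "a' k = 0"
          using a i by (auto simp: m'_def a'_def)
        ultimately show ?case
          by metis
      qed
      then obtain a m where a: "k < m" "a k = 0" "z = (\<Sum>j<m. a j *\<^sub>C y j)"
        by blast
      define b where "b j = (if j = k then 1 else - a j)" for j
      have "(\<Sum>j<m. b j *\<^sub>C y j) = (\<Sum>j<m. (if j = k then y k else 0) - a j *\<^sub>C y j)"
        using a(2) by (intro sum.cong) (auto simp: b_def)
      also have "\<dots> = y k - z"
        using a(1) by (simp add: sum_subtractf a(3))
      finally show ?thesis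
        using triangular_coefficient_bound[OF u bd C low one high a(1), of b]
        by (simp add: b_def)
    qed
    have "y k \<notin> closure ?M"
    proof
      assume "y k \<in> closure ?M"
      moreover have "1 / (2 * C k) > 0"
        using C[of k] by simp
      ultimately obtain z where "z \<in> ?M" "dist z (y k) < 1 / (2 * C k)"
        unfolding closure_approachable by blast
      then show False
        using far[of z] C[of k] by (simp add: dist_norm norm_minus_commute field_simps)
    qed
    then obtain g :: "'a \<Rightarrow> complex"
      where g: "bounded_clinear g" "\<And>z. z \<in> ?M \<Longrightarrow> g z = 0" "g (y k) = 1"
      using separating_functional[OF complex_vector.subspace_span] by metis
    have "g (y j) = 0" if "j \<noteq> k" for j
      using that by (intro g(2) complex_vector.span_base) auto
    then show ?thesis
      using g(1,3) by auto
  qed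
  then obtain g :: "nat \<Rightarrow> 'a \<Rightarrow> complex" where
    "\<forall>k. bounded_clinear (g k) \<and> (\<forall>j. g k (y j) = (if j = k then 1 else 0))"
    by metis
  then show thesis
    using that by blast
qed

text \<open>
  The next vector of the subsequence and its functional: the functional should vanish on the
  finite set \<open>G\<close> of vectors already chosen and belong to the kernel of the cluster functional
  \<open>\<phi>\<close>, which makes it small on suitable later vectors. The bound \<open>C\<close> has to be known before the
  vector \<open>x n\<close> is chosen, because the smallness required of \<open>x n\<close> depends on it.

  If \<open>\<phi>\<close> is evaluation at \<open>y\<close>, then \<open>B y = 0\<close>, so \<open>y = 0\<close> and \<open>\<phi> = 0\<close>; then a norming
  functional of \<open>x n\<close> is corrected by coordinate functionals of \<open>G\<close>, which are small at \<open>x n\<close>.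
  Otherwise there are uniformly bounded functionals \<open>v\<close>, \<open>v'\<close> with \<open>\<phi> v = \<phi> v' = 1\<close>, the first
  vanishing on \<open>G\<close> and the second also at \<open>x n\<close>, and \<open>v - v'\<close> is normalised.
\<close>

lemma next_functional:
  fixes x :: "nat \<Rightarrow> 'a::complex_banach" and \<phi> :: "('a \<Rightarrow>\<^sub>L complex) \<Rightarrow> complex" and B :: "'a \<Rightarrow> 'a"
  assumes B: "bounded_clinear B" and inj: "\<And>z. B z = 0 \<Longrightarrow> z = 0" and lim: "(\<lambda>n. B (x n)) \<longlonglongrightarrow> 0"
    and x: "\<And>n. norm (x n) = 1" and \<phi>: "bounded_clinear \<phi>"
    and cluster: "\<And>G e N. finite G \<Longrightarrow> e > 0 \<Longrightarrow>
      \<exists>n\<ge>N. \<forall>f\<in>G. cmod (blinfun_apply f (x n) - \<phi> f) < e"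
    and G: "finite G"
  obtains C where "1 \<le> C" "\<And>H e. finite H \<Longrightarrow> (\<And>f. f \<in> H \<Longrightarrow> \<phi> f = 0) \<Longrightarrow> e > 0 \<Longrightarrow>
    \<exists>n. \<exists>u\<in>dual. \<phi> u = 0 \<and> (\<forall>y\<in>G. blinfun_apply u y = 0) \<and> blinfun_apply u (x n) = 1 \<and>
      norm u \<le> C \<and> (\<forall>f\<in>H. cmod (blinfun_apply f (x n)) < e)"
proof (cases "\<exists>y. \<forall>f\<in>dual. \<phi> f = blinfun_apply f y")
  case True
  then obtain y where y: "\<And>f. f \<in> dual \<Longrightarrow> \<phi> f = blinfun_apply f y"
    by blast
  have "B y = 0"
  proof (rule dual_separates[of "B y"])
    fix f :: "'a \<Rightarrow>\<^sub>L complex"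
    assume f: "f \<in> dual" "blinfun_apply f (B y) = complex_of_real (norm (B y))"
    define h where "h = Blinfun (\<lambda>z. blinfun_apply f (B z))"
    have "bounded_clinear (\<lambda>z. blinfun_apply f (B z))"
      using f(1) B by (intro bounded_clinear_compose[of "blinfun_apply f" B]) (auto simp: dual_def)
    note h = dual_of_bounded_clinear[OF this, folded h_def]
    have "(\<lambda>n. blinfun_apply h (x n)) \<longlonglongrightarrow> 0"
      using bounded_linear.tendsto[OF blinfun.bounded_linear_right lim, of f]
      by (simp add: h(2) blinfun.zero_right)
    have "cmod (\<phi> h) \<le> e" if e: "e > 0" for e
    proof -
      obtain N where N: "\<And>n. n \<ge> N \<Longrightarrow> cmod (blinfun_apply h (x n)) < e / 2"
        using LIMSEQ_D[OF \<open>(\<lambda>n. blinfun_apply h (x n)) \<longlonglongrightarrow> 0\<close>, of "e / 2"] e by auto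
      obtain n where "n \<ge> N" "cmod (blinfun_apply h (x n) - \<phi> h) < e / 2"
        using cluster[of "{h}" "e / 2" N] e by auto
      then show ?thesis
        using N[of n] norm_triangle_ineq4[of "blinfun_apply h (x n)" "blinfun_apply h (x n) - \<phi> h"]
        by simp
    qed
    then have "\<phi> h = 0"
      using field_le_epsilon[of "cmod (\<phi> h)" 0] by auto
    then show "B y = 0"
      using y[OF h(1)] f(2) by (simp add: h(2))
  qed
  then have \<phi>0: "\<phi> f = 0" if "f \<in> dual" for f
    using y[OF that] inj blinfun.zero_right by metis
  show ?thesis
  proof (rule dual_coordinates[OF G])
    fix D and f :: "'a \<Rightarrow> 'a \<Rightarrow>\<^sub>L complex"
    assume D: "finite D" and f: "\<And>b. b \<in> D \<Longrightarrow> f b \<in> dual"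
      and van: "\<And>g y. g \<in> dual \<Longrightarrow> y \<in> G \<Longrightarrow>
        blinfun_apply (g - (\<Sum>b\<in>D. blinfun_apply g b *\<^sub>C f b)) y = 0"
    define C where "C = 2 * (1 + (\<Sum>b\<in>D. norm b * norm (f b)))"
    have sums: "0 \<le> (\<Sum>b\<in>D. norm b * norm (f b))" "0 \<le> (\<Sum>b\<in>D. norm b)"
      by (simp_all add: sum_nonneg)
    show thesis
    proof (rule that[of C])
      show "1 \<le> C"
        using sums by (simp add: C_def)
    next
      fix H :: "('a \<Rightarrow>\<^sub>L complex) set" and e :: real
      assume H: "finite H" "\<And>f. f \<in> H \<Longrightarrow> \<phi> f = 0" "e > 0"
      define d where "d = 1 / (2 * (1 + (\<Sum>b\<in>D. norm b)))"
      have d: "d > 0" "(\<Sum>b\<in>D. norm b) * d \<le> 1 / 2"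
        using sums by (auto simp: d_def field_simps)
      obtain n where n: "\<forall>h\<in>H \<union> f ` D. cmod (blinfun_apply h (x n) - \<phi> h) < min d e"
        using cluster[of "H \<union> f ` D" "min d e" 0] H D d by auto
      have small: "cmod (blinfun_apply (f b) (x n)) \<le> d" if "b \<in> D" for b
        using n that \<phi>0[OF f[OF that]] by force
      show "\<exists>n. \<exists>u\<in>dual. \<phi> u = 0 \<and> (\<forall>y\<in>G. blinfun_apply u y = 0) \<and> blinfun_apply u (x n) = 1 \<and>
          norm u \<le> C \<and> (\<forall>f\<in>H. cmod (blinfun_apply f (x n)) < e)"
      proof (rule dual_separates[of "x n"])
        fix g :: "'a \<Rightarrow>\<^sub>L complex"
        assume g: "g \<in> dual" "norm g \<le> 1" "blinfun_apply g (x n) = complex_of_real (norm (x n))"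
        have gb: "cmod (blinfun_apply g b) \<le> norm b" for b
          using norm_blinfun[of g b] mult_right_mono[OF g(2), of "norm b"] by simp
        define s where "s = (\<Sum>b\<in>D. blinfun_apply g b *\<^sub>C f b)"
        define t where "t = blinfun_apply (g - s) (x n)"
        have s: "s \<in> dual"
          unfolding s_def
          by (intro complex_vector.subspace_sum complex_vector.subspace_scale csubspace_dual f)
        have "cmod (blinfun_apply s (x n)) \<le> (\<Sum>b\<in>D. norm b * d)"
          unfolding s_def blinfun.sum_left
          by (rule sum_norm_le) (auto simp: norm_mult intro!: mult_mono gb small)
        then have "cmod (blinfun_apply s (x n)) \<le> 1 / 2"
          using d(2) by (simp only: sum_distrib_right[symmetric])
        then have t: "1 / 2 \<le> cmod t"
          using norm_triangle_ineq2[of 1 "blinfun_apply s (x n)"] g(3) x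
          by (simp add: t_def blinfun.diff_left)
        have "norm s \<le> (\<Sum>b\<in>D. norm b * norm (f b))"
          unfolding s_def by (rule sum_norm_le) (simp add: gb mult_right_mono)
        then have gs: "norm (g - s) \<le> C / 2"
          using norm_triangle_ineq4[of g s] g(2) by (simp add: C_def)
        define u where "u = (1 / t) *\<^sub>C (g - s)"
        have "norm u = norm (g - s) / cmod t"
          by (simp add: u_def norm_divide)
        also have "\<dots> \<le> (C / 2) / (1 / 2)"
          using gs t order_trans[OF norm_ge_zero gs] by (intro frac_le) auto
        finally have "norm u \<le> C" by simp
        moreover have "u \<in> dual"
          unfolding u_def
          using s g(1) complex_vector.subspace_diff complex_vector.subspace_scale csubspace_dual
          by blast
        moreover have "blinfun_apply u (x n) = 1"
          using t by (auto simp: u_def t_def)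
        moreover have "blinfun_apply u y = 0" if "y \<in> G" for y
          using van[OF g(1) that] by (simp add: u_def s_def)
        moreover have "cmod (blinfun_apply h (x n)) < e" if "h \<in> H" for h
          using n H(2) that by force
        ultimately show ?thesis
          using \<phi>0 by blast
      qed
    qed
  qed
next
  case False
  obtain K where K: "\<And>F. finite F \<Longrightarrow>
      \<exists>v\<in>dual. (\<forall>y\<in>F. blinfun_apply v y = 0) \<and> \<phi> v = 1 \<and> norm v \<le> K"
    using bidual_not_evaluation[OF \<phi> False] by blast
  show ?thesis
  proof (rule that[of "max 1 (4 * K)"])
    fix H :: "('a \<Rightarrow>\<^sub>L complex) set" and e :: real
    assume H: "finite H" "\<And>f. f \<in> H \<Longrightarrow> \<phi> f = 0" "e > 0"
    obtain v where v: "v \<in> dual" "\<And>y. y \<in> G \<Longrightarrow> blinfun_apply v y = 0" "\<phi> v = 1" "norm v \<le> K"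
      using K[OF G] by blast
    obtain n where n: "\<forall>h\<in>insert v H. cmod (blinfun_apply h (x n) - \<phi> h) < min (1 / 2) e"
      using cluster[of "insert v H" "min (1 / 2) e" 0] H by auto
    obtain v' where v': "v' \<in> dual" "\<And>y. y \<in> insert (x n) G \<Longrightarrow> blinfun_apply v' y = 0"
        "\<phi> v' = 1" "norm v' \<le> K"
      using K[of "insert (x n) G"] G by blast
    define t where "t = blinfun_apply v (x n)"
    have "cmod (t - 1) < 1 / 2"
      using n v(3) by (simp add: t_def)
    then have t: "1 / 2 \<le> cmod t"
      using norm_triangle_ineq2[of 1 "1 - t"] by (simp add: norm_minus_commute)
    define u where "u = (1 / t) *\<^sub>C (v - v')"
    have vv: "norm (v - v') \<le> 2 * K"
      using norm_triangle_ineq4[of v v'] v(4) v'(4) by simp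
    have "norm u = norm (v - v') / cmod t"
      by (simp add: u_def norm_divide)
    also have "\<dots> \<le> (2 * K) / (1 / 2)"
      using vv t order_trans[OF norm_ge_zero vv] by (intro frac_le) auto
    finally have "norm u \<le> max 1 (4 * K)" by simp
    moreover have "u \<in> dual"
      unfolding u_def
      using v(1) v'(1) complex_vector.subspace_diff complex_vector.subspace_scale csubspace_dual
      by blast
    moreover have "\<phi> u = 0"
      using v(3) v'(3) by (simp add: u_def bounded_clinearD[OF \<phi>])
    moreover have "blinfun_apply u (x n) = 1"
      using t v'(2)[of "x n"] by (auto simp: u_def t_def blinfun.diff_left)
    moreover have "blinfun_apply u y = 0" if "y \<in> G" for y
      using that v(2) v'(2) by (simp add: u_def blinfun.diff_left)
    moreover have "cmod (blinfun_apply h (x n)) < e" if "h \<in> H" for h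
      using n H(2) that by force
    ultimately show "\<exists>n. \<exists>u\<in>dual. \<phi> u = 0 \<and> (\<forall>y\<in>G. blinfun_apply u y = 0) \<and>
        blinfun_apply u (x n) = 1 \<and> norm u \<le> max 1 (4 * K) \<and>
        (\<forall>f\<in>H. cmod (blinfun_apply f (x n)) < e)"
      by blast
  qed simp
qed

text \<open>
  In a reflexive space the hypothesis on \<open>B\<close> makes the vectors tend weakly to \<open>0\<close>, and the claim
  follows from the classical selection of basic sequences. In general it takes the place of weak
  convergence: it rules out nonzero evaluations as cluster functionals. The functionals found one
  after another are triangular with respect to the chosen vectors.
\<close>

lemma minimal_subsequence:
  fixes x :: "nat \<Rightarrow> 'a::complex_banach" and B :: "'a \<Rightarrow> 'a"
  assumes B: "bounded_clinear B" and inj: "\<And>z. B z = 0 \<Longrightarrow> z = 0" and lim: "(\<lambda>n. B (x n)) \<longlonglongrightarrow> 0"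
    and x: "\<And>n. norm (x n) = 1"
  obtains r and g :: "nat \<Rightarrow> 'a \<Rightarrow> complex"
  where "\<And>k. bounded_clinear (g k)" "\<And>j k. g k (x (r j)) = (if j = k then 1 else 0)"
proof (rule cluster_functional[of x])
  show "norm (x n) \<le> 1" for n
    by (simp add: x)
  fix \<phi> :: "('a \<Rightarrow>\<^sub>L complex) \<Rightarrow> complex"
  assume \<phi>: "bounded_clinear \<phi>" and cluster: "\<And>G e N. finite G \<Longrightarrow> e > 0 \<Longrightarrow>
    \<exists>n\<ge>N. \<forall>f\<in>G. cmod (blinfun_apply f (x n) - \<phi> f) < e"
  define P where "P s k p \<longleftrightarrow> (case p of (n, u, C) \<Rightarrow> u \<in> dual \<and> \<phi> u = 0 \<and> 1 \<le> C \<and> norm u \<le> C \<and>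
      blinfun_apply u (x n) = 1 \<and> (\<forall>j<k. blinfun_apply u (x (fst (s j))) = 0) \<and>
      (\<forall>j<k. cmod (blinfun_apply (fst (snd (s j))) (x n)) * C \<le> (1 / 2) ^ (k + 2)))"
    for s :: "nat \<Rightarrow> nat \<times> ('a \<Rightarrow>\<^sub>L complex) \<times> real" and k p
  have "\<exists>s. \<forall>k. P s k (s k)"
  proof (rule dependent_wellorder_choice)
    show "P f k p = P g k p" if "\<And>j. j < k \<Longrightarrow> f j = g j" for f g k p
      using that by (simp add: P_def)
    show "\<exists>p. P s k p" if prev: "\<And>j. j < k \<Longrightarrow> P s j (s j)" for s k
    proof -
      let ?G = "(\<lambda>j. x (fst (s j))) ` {..<k}" and ?H = "(\<lambda>j. fst (snd (s j))) ` {..<k}"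
      have \<phi>H: "\<phi> f = 0" if "f \<in> ?H" for f
        using that prev by (force simp: P_def split: prod.splits)
      obtain C where C: "1 \<le> C" "\<And>H e. finite H \<Longrightarrow> (\<And>f. f \<in> H \<Longrightarrow> \<phi> f = 0) \<Longrightarrow> e > 0 \<Longrightarrow>
        \<exists>n. \<exists>u\<in>dual. \<phi> u = 0 \<and> (\<forall>y\<in>?G. blinfun_apply u y = 0) \<and> blinfun_apply u (x n) = 1 \<and>
          norm u \<le> C \<and> (\<forall>f\<in>H. cmod (blinfun_apply f (x n)) < e)"
        using next_functional[OF B inj lim x \<phi> cluster, of ?G] by blast
      \<comment> \<open>The bound \<open>C\<close> of the functional to be found enters the smallness that its vector must
        have with respect to the functionals found before.\<close>
      define e where "e = (1 / 2) ^ (k + 2) / C"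
      have "e > 0"
        using C(1) by (simp add: e_def)
      obtain n u where nu: "u \<in> dual" "\<phi> u = 0" "\<forall>y\<in>?G. blinfun_apply u y = 0"
          "blinfun_apply u (x n) = 1" "norm u \<le> C" "\<forall>f\<in>?H. cmod (blinfun_apply f (x n)) < e"
        using C(2)[of ?H e] \<phi>H \<open>e > 0\<close> by blast
      have "cmod (blinfun_apply (fst (snd (s j))) (x n)) * C \<le> (1 / 2) ^ (k + 2)" if "j < k" for j
      proof -
        have "cmod (blinfun_apply (fst (snd (s j))) (x n)) \<le> e"
          using nu(6) that by (simp add: less_imp_le)
        then have "cmod (blinfun_apply (fst (snd (s j))) (x n)) * C \<le> e * C"
          using C(1) by (intro mult_right_mono) auto
        then show ?thesis
          using C(1) by (simp add: e_def)
      qed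
      then have "P s k (n, u, C)"
        using nu C(1) by (simp add: P_def)
      then show ?thesis ..
    qed
  qed
  then obtain s where s: "\<And>k. P s k (s k)"
    by blast
  define r u C where "r k = fst (s k)" and "u k = fst (snd (s k))" and "C k = snd (snd (s k))" for k
  have props: "u k \<in> dual \<and> 1 \<le> C k \<and> norm (u k) \<le> C k \<and> blinfun_apply (u k) (x (r k)) = 1 \<and>
      (\<forall>j<k. blinfun_apply (u k) (x (r j)) = 0) \<and>
      (\<forall>j<k. cmod (blinfun_apply (u j) (x (r k))) * C k \<le> (1 / 2) ^ (k + 2))" for k
    using s[of k] by (auto simp: P_def r_def u_def C_def split: prod.splits)
  show thesis
  proof (rule triangular_biorthogonal[of "\<lambda>k. blinfun_apply (u k)" C "\<lambda>k. x (r k)"])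
    show "bounded_clinear (blinfun_apply (u k))" for k
      using props[of k] by (simp add: dual_def)
    show "cmod (blinfun_apply (u k) z) \<le> C k * norm z" for k z
      using norm_blinfun[of "u k" z] props[of k] mult_right_mono[of "norm (u k)" "C k" "norm z"]
      by simp
    fix g :: "nat \<Rightarrow> 'a \<Rightarrow> complex"
    assume "\<And>k. bounded_clinear (g k)" "\<And>j k. g k (x (r j)) = (if j = k then 1 else 0)"
    then show thesis
      by (rule that)
  qed (use props in auto)
qed

section \<open>Uniform boundedness and stability of invertibility\<close>

text \<open>
  By the Baire category theorem one of the closed sets of vectors with orbit bounded by \<open>n\<close>
  has an interior point.
\<close>

lemma uniform_boundedness:
  fixes f :: "nat \<Rightarrow> 'a::complex_banach \<Rightarrow> 'b::complex_normed_vector"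
  assumes f: "\<And>n. bounded_clinear (f n)" and pw: "\<And>x. bounded (range (\<lambda>n. f n x))"
  obtains K where "K > 0" "\<And>n x. norm (f n x) \<le> K * norm x"
proof -
  define S where "S k = (\<Inter>n. {x. norm (f n x) \<le> real k})" for k
  have closed: "closed (S k)" for k
    unfolding S_def
    by (intro closed_INT ballI closed_Collect_le continuous_on_norm bounded_clinear_continuous f
        continuous_on_const)
  have cover: "\<exists>k. x \<in> S k" for x
  proof -
    obtain b where "\<And>n. norm (f n x) \<le> b"
      using pw[of x] by (auto simp: bounded_iff)
    then show ?thesis
      using real_arch_simple[of b] by (auto simp: S_def intro: order_trans)
  qed
  have "\<exists>k. interior (S k) \<noteq> {}"
  proof (rule ccontr)
    assume "\<nexists>k. interior (S k) \<noteq> {}"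
    then have "interior (\<Union>(range S)) = {}"
      using Met_TC.metric_Baire_category_alt[of "range S"] closed
      by (auto simp: complete_UNIV closed_closedin[symmetric])
    moreover have "\<Union>(range S) = UNIV"
      using cover by auto
    ultimately show False by simp
  qed
  then obtain k x0 where "x0 \<in> interior (S k)"
    by blast
  then obtain e where e: "e > 0" "cball x0 e \<subseteq> S k"
    using open_contains_cball[of "interior (S k)"] interior_subset by (meson open_interior subset_trans)
  have "norm (f n x) \<le> (2 * real k / e) * norm x" for n x
  proof (cases "x = 0")
    case False
    define t where "t = e / norm x"
    have t: "t > 0"
      using e False by (simp add: t_def)
    have "x0 + t *\<^sub>R x \<in> cball x0 e" "x0 \<in> cball x0 e"
      using e False by (auto simp: dist_norm t_def)
    then have "norm (f n (x0 + t *\<^sub>R x)) \<le> real k" "norm (f n x0) \<le> real k"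
      using subsetD[OF e(2)] unfolding S_def by blast+
    moreover have "f n (x0 + t *\<^sub>R x) - f n x0 = t *\<^sub>R f n x"
      by (simp add: bounded_clinearD[OF f] scaleR_scaleC)
    ultimately have "t * norm (f n x) \<le> 2 * real k"
      using norm_triangle_ineq4[of "f n (x0 + t *\<^sub>R x)" "f n x0"] t by simp
    then show ?thesis
      using e False by (simp add: t_def field_simps)
  qed (simp add: bounded_clinearD[OF f])
  then have "norm (f n x) \<le> (2 * real k / e + 1) * norm x" for n x
    by (rule order_trans) (simp add: distrib_right)
  moreover have "2 * real k / e + 1 > 0"
    using e by (simp add: add_nonneg_pos)
  ultimately show thesis
    using that by blast
qed

text \<open>
  Existence of a bounded inverse, stated without the inverse. The bound is a parameter because
  it has to be uniform along sequences of operators.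
\<close>

definition invertible_with_bound ::
    "real \<Rightarrow> ('a::complex_normed_vector \<Rightarrow> 'a) \<Rightarrow> bool"
  where "invertible_with_bound K f \<longleftrightarrow> surj f \<and> (\<forall>x. norm x \<le> K * norm (f x))"

lemma invertible_with_bound_inverse:
  assumes f: "bounded_clinear f" and inv: "invertible_with_bound K f"
  obtains R where "bounded_clinear R" "\<And>x. f (R x) = x" "\<And>x. R (f x) = x"
    "\<And>x. norm (R x) \<le> K * norm x"
proof -
  have bd: "norm x \<le> K * norm (f x)" for x
    using inv by (simp add: invertible_with_bound_def)
  have inj: "x = y" if "f x = f y" for x y
    using bd[of "x - y"] that by (simp add: bounded_clinearD[OF f])
  obtain R where R: "\<And>x. f (R x) = x"
    using inv unfolding invertible_with_bound_def by (metis surjD)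
  show thesis
  proof (rule that[OF bounded_clinearI])
    show "R (x + y) = R x + R y" "R (c *\<^sub>C x) = c *\<^sub>C R x" for x y c
      by (rule inj, simp add: R bounded_clinearD[OF f])+
    show "R (f x) = x" for x
      by (rule inj) (simp add: R)
    show "norm (R x) \<le> K * norm x" "norm (R x) \<le> K * norm x" for x
      using bd[of "R x"] by (simp_all add: R)
  qed (rule R)
qed

text \<open>
  Small perturbations keep invertibility: the equation \<open>(f + E) x = y\<close> is a fixed point
  equation for the contraction \<open>x \<mapsto> R (y - E x)\<close>, where \<open>R\<close> is the inverse of \<open>f\<close>.
\<close>

lemma invertible_with_bound_perturb:
  fixes f :: "'a::complex_banach \<Rightarrow> 'a"
  assumes f: "bounded_clinear f" and inv: "invertible_with_bound K f" and K: "K > 0"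
    and E: "bounded_clinear E" and small: "\<And>x. 2 * K * norm (E x) \<le> norm x"
  shows "invertible_with_bound (2 * K) (\<lambda>x. f x + E x)"
  unfolding invertible_with_bound_def
proof (intro conjI allI)
  show "norm x \<le> 2 * K * norm (f x + E x)" for x
  proof -
    have "norm x \<le> K * norm (f x)"
      using inv by (simp add: invertible_with_bound_def)
    also have "\<dots> \<le> K * (norm (f x + E x) + norm (E x))"
      using norm_triangle_ineq4[of "f x + E x" "E x"] K by (intro mult_left_mono) auto
    finally show ?thesis
      using small[of x] by (simp add: algebra_simps)
  qed
  show "surj (\<lambda>x. f x + E x)"
    unfolding surj_def
  proof (rule invertible_with_bound_inverse[OF f inv], rule allI)
    fix R y
    assume R: "bounded_clinear R" "\<And>x. f (R x) = x" "\<And>x. norm (R x) \<le> K * norm x"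
    have "\<exists>!x. R (y - E x) = x"
    proof (rule banach_fix_type[where c = "1 / 2"])
      show "\<forall>x z. dist (R (y - E x)) (R (y - E z)) \<le> 1 / 2 * dist x z"
      proof (intro allI)
        fix x z
        have "R (y - E x) - R (y - E z) = R (E (z - x))"
          by (simp add: bounded_clinearD[OF R(1)] bounded_clinearD[OF E])
        then show "dist (R (y - E x)) (R (y - E z)) \<le> 1 / 2 * dist x z"
          using R(3)[of "E (z - x)"] small[of "z - x"] by (simp add: dist_norm norm_minus_commute)
      qed
    qed auto
    then obtain x where "R (y - E x) = x"
      by blast
    then have "f x = y - E x"
      using R(2) by metis
    then show "\<exists>x. y = f x + E x"
      by (intro exI[of _ x]) simp
  qed
qed

text \<open>
  On \<open>ker A\<^sup>p\<close> the operator \<open>c + A\<close> with \<open>c \<noteq> 0\<close> is invertible, since \<open>A\<close> is nilpotent there.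
\<close>

lemma nilpotent_perturbation:
  fixes A :: "'a::complex_normed_vector \<Rightarrow> 'a"
  assumes A: "bounded_clinear A" and c: "c \<noteq> 0"
  shows "(A ^^ p) y = 0 \<Longrightarrow> \<exists>x. (A ^^ p) x = 0 \<and> c *\<^sub>C x + A x = y"
    and "\<exists>K. \<forall>x. (A ^^ p) x = 0 \<longrightarrow> norm x \<le> K * norm (c *\<^sub>C x + A x)"
proof -
  note fp = bounded_clinearD[OF bounded_clinear_funpow[OF A]]
  show "\<exists>x. (A ^^ p) x = 0 \<and> c *\<^sub>C x + A x = y" if "(A ^^ p) y = 0"
    using that
  proof (induction p arbitrary: y)
    case 0
    then show ?case by (simp add: bounded_clinearD[OF A])
  next
    case (Suc p)
    then obtain z where z: "(A ^^ p) z = 0" "c *\<^sub>C z + A z = A y"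
      by (auto simp: funpow_swap1)
    define x where "x = (1 / c) *\<^sub>C (y - z)"
    have "(A ^^ Suc p) x = (1 / c) *\<^sub>C ((A ^^ Suc p) y - A ((A ^^ p) z))"
      by (simp add: x_def fp bounded_clinearD[OF A])
    then have "(A ^^ Suc p) x = 0"
      using Suc.prems z(1) by (simp add: bounded_clinearD[OF A])
    moreover have "c *\<^sub>C x + A x = (y - z) + (1 / c) *\<^sub>C (A y - A z)"
      using c by (simp add: x_def bounded_clinearD[OF A])
    moreover have "(1 / c) *\<^sub>C (A y - A z) = z"
      unfolding z(2)[symmetric] using c by simp
    ultimately show ?case
      by (intro exI[of _ x]) simp
  qed
  obtain L where L: "L > 0" "\<And>x. norm (A x) \<le> L * norm x"
    using bounded_clinear_bound[OF A] by blast
  show "\<exists>K. \<forall>x. (A ^^ p) x = 0 \<longrightarrow> norm x \<le> K * norm (c *\<^sub>C x + A x)"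
  proof (induction p)
    case 0
    then show ?case by (auto intro: exI[of _ 0])
  next
    case (Suc p)
    then obtain K where K: "\<And>x. (A ^^ p) x = 0 \<Longrightarrow> norm x \<le> K * norm (c *\<^sub>C x + A x)"
      by blast
    have "norm x \<le> ((1 + \<bar>K\<bar> * L) / cmod c) * norm (c *\<^sub>C x + A x)" if x: "(A ^^ Suc p) x = 0" for x
    proof -
      let ?y = "c *\<^sub>C x + A x"
      have "(A ^^ p) (A x) = 0"
        using x by (simp add: funpow_swap1)
      then have "norm (A x) \<le> K * norm (c *\<^sub>C A x + A (A x))"
        by (rule K)
      also have "c *\<^sub>C A x + A (A x) = A ?y"
        by (simp add: bounded_clinearD[OF A])
      also have "K * norm (A ?y) \<le> \<bar>K\<bar> * (L * norm ?y)"
        using L(2)[of ?y] by (intro mult_mono) auto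
      finally have "norm (A x) \<le> \<bar>K\<bar> * (L * norm ?y)" .
      moreover have "cmod c * norm x \<le> norm ?y + norm (A x)"
        using norm_triangle_ineq4[of ?y "A x"] by simp
      ultimately have "cmod c * norm x \<le> (1 + \<bar>K\<bar> * L) * norm ?y"
        by (simp add: algebra_simps)
      then show ?thesis
        using c by (simp add: field_simps)
    qed
    then show ?case by blast
  qed
qed

section \<open>Operators modulo a kernel\<close>

text \<open>
  Throughout, \<open>N\<close> is the kernel of a power of \<open>A = \<mu> - T\<close> at which the kernels stop growing,
  and \<open>Q\<close> is a projection with kernel \<open>N\<close>. The operator induced by \<open>\<nu> - T\<close> on \<open>X / N\<close> is
  represented on the whole of \<open>X\<close> by \<open>x \<mapsto> Q (\<nu> x - T x) + (x - Q x)\<close>, which is the identity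
  on \<open>N\<close>.
\<close>

locale stable_kernel =
  fixes T :: "'a::complex_banach \<Rightarrow> 'a" and \<mu> :: complex and p :: nat and Q :: "'a \<Rightarrow> 'a"
    and N :: "'a set"
  assumes T: "bounded_clinear T"
    and N_def: "N = {x. ((\<lambda>x. \<mu> *\<^sub>C x - T x) ^^ p) x = 0}"
    and stable: "\<And>x. \<mu> *\<^sub>C x - T x \<in> N \<Longrightarrow> x \<in> N"
    and finite_dimensional_N: "finite_dimensional N"
    and Q: "bounded_clinear Q" and Q_in: "\<And>x. x - Q x \<in> N" and Q_0: "\<And>x. x \<in> N \<Longrightarrow> Q x = 0"
begin

definition modulo :: "complex \<Rightarrow> 'a \<Rightarrow> 'a"
  where "modulo \<nu> x = Q (\<nu> *\<^sub>C x - T x) + (x - Q x)"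

lemma shifted: "bounded_clinear (\<lambda>x. \<nu> *\<^sub>C x - T x)"
  by (intro bounded_clinear_diff bounded_clinear_scale bounded_clinear_ident T)

lemma bounded_clinear_modulo: "bounded_clinear (modulo \<nu>)"
  unfolding modulo_def
  by (intro bounded_clinear_add bounded_clinear_diff bounded_clinear_ident Q
      bounded_clinear_compose[OF Q] shifted)

lemma N_subspace: "csubspace N" "closed N"
  using finite_dimensional_closed[OF finite_dimensional_N] .

lemma QQ [simp]: "Q (Q x) = Q x"
  using Q_0[OF Q_in[of x]] by (simp add: bounded_clinearD[OF Q])

lemma Q_eq_0_iff: "Q x = 0 \<longleftrightarrow> x \<in> N"
  using Q_in[of x] Q_0 by auto

lemma A_N: "\<mu> *\<^sub>C x - T x \<in> N" if "x \<in> N"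
proof -
  let ?A = "\<lambda>x. \<mu> *\<^sub>C x - T x"
  have "(?A ^^ p) (?A x) = ?A ((?A ^^ p) x)"
    by (rule funpow_swap1[symmetric])
  then show ?thesis
    using that bounded_clinearD(5)[OF shifted[of \<mu>]] by (simp add: N_def)
qed

lemma T_N: "T x \<in> N" if "x \<in> N"
proof -
  have "\<mu> *\<^sub>C x - (\<mu> *\<^sub>C x - T x) \<in> N"
    using A_N[OF that] that N_subspace(1) complex_vector.subspace_diff complex_vector.subspace_scale
    by blast
  then show ?thesis by simp
qed

lemma shifted_N: "\<nu> *\<^sub>C x - T x \<in> N" if "x \<in> N"
  using T_N[OF that] that N_subspace(1) complex_vector.subspace_diff complex_vector.subspace_scale
  by blast

lemma Q_shifted_Q: "Q (\<nu> *\<^sub>C Q x - T (Q x)) = Q (\<nu> *\<^sub>C x - T x)"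
  using Q_0[OF shifted_N[OF Q_in[of x], of \<nu>]]
  by (simp add: bounded_clinearD[OF Q] bounded_clinearD[OF T])

lemma modulo_Q: "modulo \<nu> (Q x) = Q (\<nu> *\<^sub>C x - T x)"
  by (simp add: modulo_def Q_shifted_Q)

lemma Q_modulo: "Q (modulo \<nu> x) = Q (\<nu> *\<^sub>C x - T x)"
  by (simp add: modulo_def bounded_clinearD[OF Q])

lemma modulo_injective: "x = 0" if "modulo \<mu> x = 0"
proof -
  have "Q (\<mu> *\<^sub>C x - T x) = 0"
    using Q_modulo[of \<mu> x] that by (simp add: bounded_clinearD[OF Q])
  then have "x \<in> N" "x - Q x = 0"
    using that stable Q_eq_0_iff modulo_def[of \<mu> x] by (blast, metis add_0)
  then show ?thesis
    using Q_0[of x] by simp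
qed

text \<open>
  The blow-up of the resolvent at \<open>e\<close> modulo \<open>N\<close> produces normalised vectors that \<open>modulo \<mu>\<close>
  maps to a null sequence. Every other term of a minimal subsequence of them spans, together with
  \<open>N\<close>, a halfspace; it is invariant up to the vector \<open>e\<close> because \<open>T h = \<nu> h - e\<close> if
  \<open>(\<nu> - T) h = e\<close>.
\<close>

lemma halfspace_from_blow_up:
  assumes lam: "\<nu> \<longlonglongrightarrow> \<mu>" and h: "\<And>n. \<nu> n *\<^sub>C h n - T (h n) = e"
    and blow: "filterlim (\<lambda>n. norm (Q (h n))) at_top sequentially"
  shows "\<exists>Y. halfspace Y \<and> almost_invariant T Y \<and> defect T Y \<le> 1"
proof -
  \<comment> \<open>Dropping the first terms keeps \<open>Q (h n)\<close> away from \<open>0\<close>, so that it can be normalised.\<close>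
  obtain n0 where n0: "\<And>n. n \<ge> n0 \<Longrightarrow> 1 \<le> norm (Q (h n))"
  proof -
    have "eventually (\<lambda>n. 1 \<le> norm (Q (h n))) sequentially"
      using blow by (simp add: filterlim_at_top)
    then show thesis
      using that by (auto simp: eventually_sequentially)
  qed
  define t where "t n = norm (Q (h (n + n0)))" for n
  define x where "x n = complex_of_real (1 / t n) *\<^sub>C Q (h (n + n0))" for n
  have t: "t n \<ge> 1" for n
    unfolding t_def by (rule n0) simp
  have x1: "norm (x n) = 1" for n
    using t[of n] by (auto simp: x_def t_def norm_divide)
  have tinf: "filterlim t at_top sequentially"
    unfolding t_def
    by (rule filterlim_compose[OF blow]) (rule filterlim_add_const_nat_at_top)
  have eq: "modulo \<mu> (x n) = (\<mu> - \<nu> (n + n0)) *\<^sub>C x n + complex_of_real (1 / t n) *\<^sub>C Q e" for n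
  proof -
    have "Q (\<mu> *\<^sub>C h (n + n0) - T (h (n + n0)))
        = Q ((\<mu> - \<nu> (n + n0)) *\<^sub>C h (n + n0) + e)"
      unfolding h[of "n + n0", symmetric] by (simp add: complex_vector.scale_left_diff_distrib)
    then show ?thesis
      unfolding x_def bounded_clinearD(2)[OF bounded_clinear_modulo] modulo_Q
      by (simp add: bounded_clinearD[OF Q] scaleC_add_right mult.commute)
  qed
  have lim: "(\<lambda>n. modulo \<mu> (x n)) \<longlonglongrightarrow> 0"
  proof (rule Lim_null_comparison)
    show "\<forall>\<^sub>F n in sequentially. norm (modulo \<mu> (x n))
        \<le> cmod (\<mu> - \<nu> (n + n0)) + inverse (t n) * norm (Q e)"
    proof (intro always_eventually allI)
      fix n
      have "cmod (complex_of_real (1 / t n)) = inverse (t n)"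
        using t[of n] by (simp add: norm_divide inverse_eq_divide)
      then show "norm (modulo \<mu> (x n)) \<le> cmod (\<mu> - \<nu> (n + n0)) + inverse (t n) * norm (Q e)"
        unfolding eq using x1[of n] by (intro order_trans[OF norm_triangle_ineq]) simp
    qed
    have "(\<lambda>n. \<nu> (n + n0)) \<longlonglongrightarrow> \<mu>"
      using lam by (rule LIMSEQ_ignore_initial_segment)
    then have "(\<lambda>n. cmod (\<mu> - \<nu> (n + n0)) + inverse (t n) * norm (Q e)) \<longlonglongrightarrow> cmod (\<mu> - \<mu>) + 0 * norm (Q e)"
      by (intro tendsto_intros tendsto_inverse_0_at_top[OF tinf])
    then show "(\<lambda>n. cmod (\<mu> - \<nu> (n + n0)) + inverse (t n) * norm (Q e)) \<longlonglongrightarrow> 0"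
      by simp
  qed
  show ?thesis
  proof (rule minimal_subsequence[OF bounded_clinear_modulo modulo_injective lim x1])
    fix r and g :: "nat \<Rightarrow> 'a \<Rightarrow> complex"
    assume g: "\<And>k. bounded_clinear (g k)" and bi: "\<And>j k. g k (x (r j)) = (if j = k then 1 else 0)"
    define E where "E = (\<lambda>k. x (r (2 * k))) ` UNIV \<union> N"
    define Y where "Y = closure (cspan E)"
    have Y: "csubspace Y" "closed Y"
      unfolding Y_def by (auto intro: csubspace_closure)
    have EY: "E \<subseteq> Y"
      unfolding Y_def by (rule order_trans[OF complex_vector.span_superset closure_subset])
    have Qx: "Q (x n) = x n" for n
      by (simp add: x_def bounded_clinearD[OF Q])
    have halfspace: "halfspace Y"
    proof (rule halfspace_biorthogonal[of "\<lambda>k y. g k (Q y)" "\<lambda>k. x (r k)", OF _ _ Y])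
      show gQ: "bounded_clinear (\<lambda>y. g k (Q y))" for k
        by (rule bounded_clinear_compose[OF g Q])
      show "g k (Q (x (r j))) = (if j = k then 1 else 0)" for j k
        by (simp add: Qx bi)
      show "x (r (2 * k)) \<in> Y" for k
        using EY by (auto simp: E_def)
      show "g (2 * k + 1) (Q y) = 0" if y: "y \<in> Y" for k y
      proof -
        have "2 * j \<noteq> 2 * k + 1" for j
          by presburger
        then have "E \<subseteq> {y. g (2 * k + 1) (Q y) = 0}"
          by (auto simp: E_def Qx bi Q_0 bounded_clinearD[OF g])
        then have "cspan E \<subseteq> {y. g (2 * k + 1) (Q y) = 0}"
          by (rule complex_vector.span_minimal[OF _ bounded_clinear_kernel(1)[OF gQ]])
        then have zero: "g (2 * k + 1) (Q z) \<in> {0}" if "z \<in> cspan E" for z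
          using that by auto
        have "g (2 * k + 1) (Q y) \<in> {0}"
          by (rule bounded_clinear_closure_image[OF gQ csubspace_zero closed_singleton zero])
            (use y in \<open>simp_all add: Y_def\<close>)
        then show ?thesis by simp
      qed
    qed
    let ?W = "cspan (insert e Y)"
    have W: "csubspace ?W" "closed ?W"
      using closed_cspan_insert[OF Y] by auto
    have YW: "insert e Y \<subseteq> ?W"
      by (rule complex_vector.span_superset)
    have NW: "N \<subseteq> ?W" and EW: "E \<subseteq> ?W"
      using EY YW by (auto simp: E_def)
    have "T z \<in> ?W" if z: "z \<in> E" for z
    proof (cases "z \<in> N")
      case True
      then show ?thesis
        using T_N NW by blast
    next
      case False
      then obtain k where k: "z = x (r (2 * k))"
        using z by (auto simp: E_def)
      define m c where "m = r (2 * k) + n0" and "c = complex_of_real (1 / t (r (2 * k)))"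
      have z': "z = c *\<^sub>C Q (h m)"
        by (simp add: k x_def m_def c_def)
      have "T (h m) = \<nu> m *\<^sub>C h m - e"
        using h[of m] by (simp add: algebra_simps)
      then have "T z = \<nu> m *\<^sub>C z - c *\<^sub>C e + c *\<^sub>C (\<nu> m *\<^sub>C (h m - Q (h m)) - T (h m - Q (h m)))"
        by (simp add: z' bounded_clinearD[OF T] complex_vector.scale_right_diff_distrib mult.commute)
      moreover have "\<nu> m *\<^sub>C (h m - Q (h m)) - T (h m - Q (h m)) \<in> ?W"
        using shifted_N[OF Q_in] NW by blast
      moreover have "z \<in> ?W" "e \<in> ?W"
        using z EW YW by blast+
      ultimately show ?thesis
        by (simp only: complex_vector.subspace_add[OF W(1)] complex_vector.subspace_diff[OF W(1)]
            complex_vector.subspace_scale[OF W(1)])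
    qed
    then have "E \<subseteq> {z. T z \<in> ?W}"
      by blast
    then have "cspan E \<subseteq> {z. T z \<in> ?W}"
      by (rule complex_vector.span_minimal[OF _ bounded_clinear_preimage(1)[OF T W(1)]])
    then have TE: "T z \<in> ?W" if "z \<in> cspan E" for z
      using that by auto
    have "T y \<in> ?W" if "y \<in> Y" for y
      by (rule bounded_clinear_closure_image[OF T W TE]) (use that in \<open>simp_all add: Y_def\<close>)
    then show ?thesis
      using halfspace almost_invariant_one_vector[OF Y(1), of T e] by blast
  qed
qed

end

section \<open>Isolated spectral points\<close>

lemma unbounded_subsequence:
  fixes y :: "nat \<Rightarrow> 'b::real_normed_vector"
  assumes unb: "\<not> bounded (range y)"
  obtains f where "strict_mono f" "filterlim (\<lambda>n. norm (y (f n))) at_top sequentially"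
proof -
  have ex: "\<exists>n>m. k \<le> norm (y n)" for m :: nat and k :: real
  proof (rule ccontr)
    assume "\<not> ?thesis"
    then have "range y \<subseteq> y ` {..m} \<union> cball 0 k"
      by (auto simp: not_le) (metis atMost_iff image_eqI less_imp_le not_le)
    then show False
      using unb bounded_subset[of "y ` {..m} \<union> cball 0 k"] by (auto intro: finite_imp_bounded)
  qed
  have "\<exists>f. \<forall>n. real n \<le> norm (y (f n)) \<and> f n < f (Suc n)"
    by (rule dependent_nat_choice) (use ex in blast)+
  then obtain f where f: "\<And>n. real n \<le> norm (y (f n))" "\<And>n. f n < f (Suc n)"
    by blast
  show thesis
  proof
    show "strict_mono f"
      using f(2) by (simp add: strict_mono_Suc_iff)
    show "filterlim (\<lambda>n. norm (y (f n))) at_top sequentially"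
      by (rule filterlim_at_top_mono[OF filterlim_real_sequentially]) (use f(1) in auto)
  qed
qed

text \<open>
  Requiring a bound on the inverse avoids an appeal to the open mapping theorem.
\<close>

definition resolvent_set :: "('a::complex_normed_vector \<Rightarrow> 'a) \<Rightarrow> complex set"
  where "resolvent_set T = {\<nu>. \<exists>K>0. invertible_with_bound K (\<lambda>x. \<nu> *\<^sub>C x - T x)}"

context stable_kernel
begin

text \<open>
  The inverse of \<open>\<nu> - T\<close> commutes with \<open>\<mu> - T\<close> and so preserves \<open>N\<close>; hence \<open>modulo \<nu>\<close> is
  invertible too, and only the part of the inverse outside \<open>N\<close> enters its bound.
\<close>

lemma invertible_modulo:
  assumes R: "bounded_clinear R" "\<And>x. \<nu> *\<^sub>C R x - T (R x) = x" "\<And>x. R (\<nu> *\<^sub>C x - T x) = x"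
    and L: "\<And>x. norm (Q (R x)) \<le> L * norm x" and q: "\<And>x. norm (Q x) \<le> q * norm x" "q > 0"
    and "0 \<le> L"
  shows "invertible_with_bound (L * q + 1 + q) (modulo \<nu>)"
  unfolding invertible_with_bound_def
proof (intro conjI allI)
  have QR: "Q (R x) = 0" if "x \<in> N" for x
  proof -
    let ?A = "\<lambda>x. \<mu> *\<^sub>C x - T x"
    have comm: "?A (\<nu> *\<^sub>C z - T z) = \<nu> *\<^sub>C ?A z - T (?A z)" for z
      by (simp add: bounded_clinearD[OF T] complex_vector.scale_right_diff_distrib mult.commute)
    have "(?A ^^ n) (\<nu> *\<^sub>C z - T z) = \<nu> *\<^sub>C (?A ^^ n) z - T ((?A ^^ n) z)" for n z
      by (induction n) (simp_all add: comm)
    then have "\<nu> *\<^sub>C (?A ^^ p) (R x) - T ((?A ^^ p) (R x)) = (?A ^^ p) x"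
      using R(2)[of x] by metis
    also have "\<dots> = 0"
      using that by (simp add: N_def)
    finally have "(?A ^^ p) (R x) = 0"
      using R(3)[of "(?A ^^ p) (R x)"] bounded_clinearD(5)[OF R(1)] by metis
    then show ?thesis
      by (intro Q_0) (simp add: N_def)
  qed
  have QRQ: "Q (R (Q x)) = Q (R x)" for x
    using QR[OF Q_in[of x]] by (simp add: bounded_clinearD[OF Q] bounded_clinearD[OF R(1)])
  show "surj (modulo \<nu>)"
  proof (rule surjI)
    fix y
    have "modulo \<nu> (Q (R y) + (y - Q y)) = modulo \<nu> (Q (R y)) + modulo \<nu> (y - Q y)"
      by (rule bounded_clinearD[OF bounded_clinear_modulo])
    also have "modulo \<nu> (Q (R y)) = Q y"
      by (simp add: modulo_Q R(2))
    also have "modulo \<nu> (y - Q y) = y - Q y"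
      using Q_0[OF shifted_N[OF Q_in[of y]], of \<nu>] by (simp add: modulo_def bounded_clinearD[OF Q])
    finally show "modulo \<nu> (Q (R y) + (y - Q y)) = y" by simp
  qed
  show "norm x \<le> (L * q + 1 + q) * norm (modulo \<nu> x)" for x
  proof -
    let ?y = "modulo \<nu> x"
    have "Q (R (Q ?y)) = Q x"
      unfolding Q_modulo QRQ by (simp add: R(3))
    moreover have "?y - Q ?y = x - Q x"
      by (simp add: modulo_def bounded_clinearD[OF Q])
    ultimately have "x = Q (R (Q ?y)) + (?y - Q ?y)"
      by simp
    then have "norm x \<le> norm (Q (R (Q ?y))) + (norm ?y + norm (Q ?y))"
      by (metis norm_triangle_mono norm_triangle_ineq4 order_refl)
    also have "norm (Q (R (Q ?y))) \<le> L * (q * norm ?y)"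
      using L[of "Q ?y"] mult_left_mono[OF q(1)[of ?y] \<open>0 \<le> L\<close>] by simp
    also have "norm (Q ?y) \<le> q * norm ?y"
      by (rule q)
    finally show ?thesis
      by (simp add: algebra_simps)
  qed
qed

text \<open>
  Conversely, \<open>\<nu> - T\<close> is invertible if it is so modulo \<open>N\<close> and \<open>\<nu> \<noteq> \<mu>\<close>, because then
  it is invertible on \<open>N\<close>.
\<close>

lemma resolvent_set_of_modulo:
  assumes inv: "invertible_with_bound K (modulo \<nu>)" and "K > 0" and "\<nu> \<noteq> \<mu>"
  shows "\<nu> \<in> resolvent_set T"
proof -
  define A where "A x = \<mu> *\<^sub>C x - T x" for x
  have A: "bounded_clinear A"
    unfolding A_def by (rule shifted)
  have N: "x \<in> N \<longleftrightarrow> (A ^^ p) x = 0" for x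
    by (simp add: N_def A_def[abs_def])
  have shift: "(\<nu> - \<mu>) *\<^sub>C x + A x = \<nu> *\<^sub>C x - T x" for x
    by (simp add: A_def complex_vector.scale_left_diff_distrib)
  have "\<nu> - \<mu> \<noteq> 0"
    using \<open>\<nu> \<noteq> \<mu>\<close> by simp
  obtain L where L: "\<And>x. x \<in> N \<Longrightarrow> norm x \<le> L * norm (\<nu> *\<^sub>C x - T x)"
    using nilpotent_perturbation(2)[OF A \<open>\<nu> - \<mu> \<noteq> 0\<close>, of p] unfolding shift N by blast
  obtain q where q: "q > 0" "\<And>x. norm (Q x) \<le> q * norm x"
    using bounded_clinear_bound[OF Q] by blast
  obtain s where s: "s > 0" "\<And>x. norm (\<nu> *\<^sub>C x - T x) \<le> s * norm x"
    using bounded_clinear_bound[OF shifted] by blast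
  define J where "J = K * q + \<bar>L\<bar> * (1 + s * (K * q))"
  have "surj (\<lambda>x. \<nu> *\<^sub>C x - T x)"
    unfolding surj_def
  proof
    fix y
    obtain x where "modulo \<nu> x = Q y"
      using inv unfolding invertible_with_bound_def by (metis surjD)
    then have "Q (\<nu> *\<^sub>C x - T x) = Q y"
      using Q_modulo[of \<nu> x] by simp
    then have "y - (\<nu> *\<^sub>C x - T x) \<in> N"
      by (simp add: Q_eq_0_iff[symmetric] bounded_clinearD[OF Q])
    then obtain z where "\<nu> *\<^sub>C z - T z = y - (\<nu> *\<^sub>C x - T x)"
      using nilpotent_perturbation(1)[OF A \<open>\<nu> - \<mu> \<noteq> 0\<close>, of p] unfolding shift N by blast
    then show "\<exists>x. y = \<nu> *\<^sub>C x - T x"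
      by (intro exI[of _ "z + x"]) (simp add: scaleC_add_right bounded_clinearD[OF T] algebra_simps)
  qed
  moreover have "norm x \<le> (J + 1) * norm (\<nu> *\<^sub>C x - T x)" for x
  proof -
    let ?y = "\<nu> *\<^sub>C x - T x"
    have "norm (Q x) \<le> K * norm (modulo \<nu> (Q x))"
      using inv by (simp add: invertible_with_bound_def)
    also have "\<dots> \<le> K * (q * norm ?y)"
      unfolding modulo_Q using q(2)[of ?y] \<open>K > 0\<close> by (intro mult_left_mono) auto
    finally have 1: "norm (Q x) \<le> K * q * norm ?y" by simp
    have "\<nu> *\<^sub>C (x - Q x) - T (x - Q x) = ?y - (\<nu> *\<^sub>C Q x - T (Q x))"
      by (simp add: bounded_clinearD[OF T] complex_vector.scale_right_diff_distrib)
    then have "norm (\<nu> *\<^sub>C (x - Q x) - T (x - Q x)) \<le> norm ?y + s * norm (Q x)"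
      using norm_triangle_ineq4[of ?y "\<nu> *\<^sub>C Q x - T (Q x)"] s(2)[of "Q x"] by simp
    also have "\<dots> \<le> norm ?y + s * (K * q * norm ?y)"
      using 1 s(1) by simp
    finally have "norm (x - Q x) \<le> \<bar>L\<bar> * (norm ?y + s * (K * q * norm ?y))"
      by (intro order_trans[OF L[OF Q_in]] mult_mono) auto
    then have "norm x \<le> J * norm ?y"
      using 1 norm_triangle_ineq[of "Q x" "x - Q x"] by (simp add: J_def algebra_simps)
    then show ?thesis
      by (simp add: distrib_right add_increasing2)
  qed
  moreover have "J + 1 > 0"
    using q(1) s(1) \<open>K > 0\<close> by (auto simp: J_def intro!: add_nonneg_pos add_nonneg_nonneg)
  ultimately show ?thesis
    by (auto simp: resolvent_set_def invertible_with_bound_def)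
qed

text \<open>
  If the resolvent does not blow up modulo \<open>N\<close> along a sequence tending to \<open>\<mu>\<close>, the uniform
  boundedness principle makes \<open>modulo \<nu>\<close> invertible for all \<open>\<nu>\<close> near \<open>\<mu>\<close>.
\<close>

lemma blow_up_or_isolated:
  assumes "\<mu> \<in> closure (resolvent_set T)"
  shows "(\<exists>Y. halfspace Y \<and> almost_invariant T Y \<and> defect T Y \<le> 1) \<or>
    (\<exists>d>0. \<exists>K>0. \<forall>\<nu>. dist \<nu> \<mu> < d \<longrightarrow> invertible_with_bound K (modulo \<nu>))"
proof -
  obtain \<nu> where \<nu>: "\<And>n. \<nu> n \<in> resolvent_set T" "\<nu> \<longlonglongrightarrow> \<mu>"
    using assms unfolding closure_sequential by blast
  have "\<exists>R. bounded_clinear R \<and> (\<forall>x. \<nu> n *\<^sub>C R x - T (R x) = x) \<and> (\<forall>x. R (\<nu> n *\<^sub>C x - T x) = x)" for n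
  proof -
    obtain K where "invertible_with_bound K (\<lambda>x. \<nu> n *\<^sub>C x - T x)"
      using \<nu>(1)[of n] by (auto simp: resolvent_set_def)
    then show ?thesis
      by (rule invertible_with_bound_inverse[OF shifted]) blast
  qed
  then obtain R where R: "\<And>n. bounded_clinear (R n)" "\<And>n x. \<nu> n *\<^sub>C R n x - T (R n x) = x"
      "\<And>n x. R n (\<nu> n *\<^sub>C x - T x) = x"
    by metis
  show ?thesis
  proof (cases "\<forall>x. bounded (range (\<lambda>n. Q (R n x)))")
    case True
    obtain L where L: "L > 0" "\<And>n x. norm (Q (R n x)) \<le> L * norm x"
      using uniform_boundedness[of "\<lambda>n x. Q (R n x)", OF bounded_clinear_compose[OF Q R(1)]] True
      by blast
    obtain q where q: "q > 0" "\<And>x. norm (Q x) \<le> q * norm x"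
      using bounded_clinear_bound[OF Q] by blast
    define K where "K = L * q + 1 + q"
    have K: "K > 0"
      using L q by (simp add: K_def add_pos_pos)
    have inv: "invertible_with_bound K (modulo (\<nu> n))" for n
      unfolding K_def using invertible_modulo[OF R(1-3) L(2) q(2,1)] L(1) by simp
    \<comment> \<open>If \<open>z\<close> and \<open>\<nu> n\<close> are both within \<open>d\<close> of \<open>\<mu>\<close>, then \<open>(z - \<nu> n) * Q\<close> has norm at most
      \<open>1 / (2 * K)\<close>, a perturbation that leaves \<open>modulo (\<nu> n)\<close> invertible.\<close>
    define d where "d = 1 / (4 * K * q)"
    have d: "d > 0"
      using K q by (simp add: d_def)
    have "invertible_with_bound (2 * K) (modulo z)" if z: "dist z \<mu> < d" for z
    proof -
      obtain n where n: "dist (\<nu> n) \<mu> < d"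
        using LIMSEQ_D[OF \<nu>(2) d] by (auto simp: dist_norm)
      have "cmod (z - \<nu> n) \<le> 2 * d"
        using dist_triangle2[of z "\<nu> n" \<mu>] n z by (simp add: dist_norm)
      have "invertible_with_bound (2 * K) (\<lambda>x. modulo (\<nu> n) x + (z - \<nu> n) *\<^sub>C Q x)"
      proof (rule invertible_with_bound_perturb[OF bounded_clinear_modulo inv K])
        show "bounded_clinear (\<lambda>x. (z - \<nu> n) *\<^sub>C Q x)"
          by (rule bounded_clinear_scale[OF Q])
        have "2 * K * (cmod (z - \<nu> n) * norm (Q x)) \<le> 2 * K * (2 * d * (q * norm x))" for x
          using K q d \<open>cmod (z - \<nu> n) \<le> 2 * d\<close> by (intro mult_left_mono mult_mono) auto
        also have "2 * K * (2 * d * (q * norm x)) = norm x" for x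
          using K q by (simp add: d_def)
        finally show "2 * K * norm ((z - \<nu> n) *\<^sub>C Q x) \<le> norm x" for x
          by simp
      qed
      moreover have "modulo (\<nu> n) x + (z - \<nu> n) *\<^sub>C Q x = modulo z x" for x
        by (simp add: modulo_def bounded_clinearD[OF Q] complex_vector.scale_left_diff_distrib)
      ultimately show ?thesis
        by simp
    qed
    then show ?thesis
      using d K by (intro disjI2 exI[of _ d] conjI exI[of _ "2 * K"]) auto
  next
    case False
    then obtain e where "\<not> bounded (range (\<lambda>n. Q (R n e)))"
      by blast
    then obtain f :: "nat \<Rightarrow> nat" where f: "strict_mono f"
        "filterlim (\<lambda>n. norm (Q (R (f n) e))) at_top sequentially"
      by (rule unbounded_subsequence)
    have "(\<lambda>n. \<nu> (f n)) \<longlonglongrightarrow> \<mu>"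
      using LIMSEQ_subseq_LIMSEQ[OF \<nu>(2) f(1)] by (simp add: comp_def)
    then show ?thesis
      using halfspace_from_blow_up[of "\<lambda>n. \<nu> (f n)" "\<lambda>n. R (f n) e" e] R(2) f(2) by blast
  qed
qed

end

section \<open>The resolvent as a holomorphic function\<close>

lemma resolvent_set_local:
  fixes T :: "'a::complex_banach \<Rightarrow> 'a"
  assumes T: "bounded_clinear T" and "\<nu> \<in> resolvent_set T"
  obtains d K where "d > 0" "K > 0"
    "\<And>z. dist z \<nu> < d \<Longrightarrow> invertible_with_bound K (\<lambda>x. z *\<^sub>C x - T x)"
proof -
  obtain K where K: "K > 0" "invertible_with_bound K (\<lambda>x. \<nu> *\<^sub>C x - T x)"
    using assms(2) by (auto simp: resolvent_set_def)
  have shifted: "bounded_clinear (\<lambda>x. \<nu> *\<^sub>C x - T x)"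
    by (intro bounded_clinear_diff bounded_clinear_scale bounded_clinear_ident T)
  show thesis
  proof (rule that[of "1 / (2 * K)" "2 * K"])
    fix z assume z: "dist z \<nu> < 1 / (2 * K)"
    have "invertible_with_bound (2 * K) (\<lambda>x. (\<nu> *\<^sub>C x - T x) + (z - \<nu>) *\<^sub>C x)"
    proof (rule invertible_with_bound_perturb[OF shifted K(2,1)])
      show "bounded_clinear (\<lambda>x. (z - \<nu>) *\<^sub>C x)"
        by (intro bounded_clinear_scale bounded_clinear_ident)
      have "2 * K * cmod (z - \<nu>) \<le> 1"
        using z K(1) by (simp add: dist_norm field_simps)
      then show "2 * K * norm ((z - \<nu>) *\<^sub>C x) \<le> norm x" for x :: 'a
        using mult_right_mono[of "2 * K * cmod (z - \<nu>)" 1 "norm x"] by simp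
    qed
    then show "invertible_with_bound (2 * K) (\<lambda>x. z *\<^sub>C x - T x)"
      by (simp add: complex_vector.scale_left_diff_distrib)
  qed (use K(1) in auto)
qed

lemma invertible_far_out:
  fixes T :: "'a::complex_banach \<Rightarrow> 'a"
  assumes T: "bounded_clinear T" and L: "\<And>x. norm (T x) \<le> L * norm x" "L > 0"
    and z: "4 * L \<le> cmod z"
  shows "invertible_with_bound (2 / cmod z) (\<lambda>x. z *\<^sub>C x - T x)"
proof -
  have pos: "cmod z > 0"
    using z L(2) by linarith
  then have "z \<noteq> 0" by auto
  have "invertible_with_bound (2 * (1 / cmod z)) (\<lambda>x. z *\<^sub>C x + (- 1) *\<^sub>C T x)"
  proof (rule invertible_with_bound_perturb)
    show "invertible_with_bound (1 / cmod z) (\<lambda>x :: 'a. z *\<^sub>C x)"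
      unfolding invertible_with_bound_def
    proof
      show "surj (\<lambda>x :: 'a. z *\<^sub>C x)"
        using \<open>z \<noteq> 0\<close> by (intro surjI[of _ "\<lambda>x. (1 / z) *\<^sub>C x"]) simp
    qed (use pos in simp)
    show "2 * (1 / cmod z) * norm ((- 1) *\<^sub>C T x) \<le> norm x" for x
    proof -
      have "2 * norm (T x) \<le> cmod z * norm x"
      proof -
        have "0 \<le> L * norm x"
          using L(2) by simp
        then show ?thesis
          using L(1)[of x] mult_right_mono[OF z, of "norm x"] by (simp add: mult.assoc)
      qed
      then show ?thesis
        using pos by (simp add: field_simps)
    qed
    show "bounded_clinear (\<lambda>x. (- 1) *\<^sub>C T x)"
      by (rule bounded_clinear_scale[OF T])
  qed (use pos in \<open>auto intro: bounded_clinear_scale bounded_clinear_ident\<close>)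
  then show ?thesis
    by (simp add: scaleC_minus1)
qed

definition resolvent :: "('a::complex_vector \<Rightarrow> 'a) \<Rightarrow> complex \<Rightarrow> 'a \<Rightarrow> 'a"
  where "resolvent T \<nu> = inv (\<lambda>x. \<nu> *\<^sub>C x - T x)"

lemma resolvent:
  fixes T :: "'a::complex_banach \<Rightarrow> 'a"
  assumes T: "bounded_clinear T" and inv: "invertible_with_bound K (\<lambda>x. \<nu> *\<^sub>C x - T x)"
  shows "bounded_clinear (resolvent T \<nu>)"
    "\<nu> *\<^sub>C resolvent T \<nu> x - T (resolvent T \<nu> x) = x"
    "resolvent T \<nu> (\<nu> *\<^sub>C x - T x) = x" "norm (resolvent T \<nu> x) \<le> K * norm x"
proof -
  have shifted: "bounded_clinear (\<lambda>x. \<nu> *\<^sub>C x - T x)"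
    by (intro bounded_clinear_diff bounded_clinear_scale bounded_clinear_ident T)
  obtain R where R: "bounded_clinear R" "\<And>x. \<nu> *\<^sub>C R x - T (R x) = x" "\<And>x. R (\<nu> *\<^sub>C x - T x) = x"
    "\<And>x. norm (R x) \<le> K * norm x"
    by (rule invertible_with_bound_inverse[OF shifted inv]) blast
  have "resolvent T \<nu> = R"
    unfolding resolvent_def using R(2,3) by (intro inv_equality)
  then show "bounded_clinear (resolvent T \<nu>)"
    "\<nu> *\<^sub>C resolvent T \<nu> x - T (resolvent T \<nu> x) = x"
    "resolvent T \<nu> (\<nu> *\<^sub>C x - T x) = x" "norm (resolvent T \<nu> x) \<le> K * norm x"
    using R by simp_all
qed

lemma resolvent_identity:
  fixes T :: "'a::complex_banach \<Rightarrow> 'a"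
  assumes T: "bounded_clinear T" and "\<nu> \<in> resolvent_set T" "z \<in> resolvent_set T"
  shows "resolvent T z x - resolvent T \<nu> x = - ((z - \<nu>) *\<^sub>C resolvent T z (resolvent T \<nu> x))"
proof -
  let ?y = "resolvent T \<nu> x"
  obtain K L where "invertible_with_bound K (\<lambda>x. \<nu> *\<^sub>C x - T x)"
    and L: "invertible_with_bound L (\<lambda>x. z *\<^sub>C x - T x)"
    using assms by (auto simp: resolvent_set_def)
  then have "x = (z *\<^sub>C ?y - T ?y) - (z - \<nu>) *\<^sub>C ?y"
    using resolvent(2)[OF T, of K \<nu> x] by (simp add: complex_vector.scale_left_diff_distrib)
  then have "resolvent T z x = resolvent T z ((z *\<^sub>C ?y - T ?y) - (z - \<nu>) *\<^sub>C ?y)"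
    by simp
  also have "\<dots> = ?y - (z - \<nu>) *\<^sub>C resolvent T z ?y"
    unfolding bounded_clinearD(4)[OF resolvent(1)[OF T L], of "z *\<^sub>C ?y - T ?y"]
    by (simp only: bounded_clinearD(2)[OF resolvent(1)[OF T L]] resolvent(3)[OF T L])
  finally show ?thesis by simp
qed

text \<open>
  By the resolvent identity the derivative is minus the square of the resolvent; continuity comes
  from the same identity and the local bound.
\<close>

lemma resolvent_holomorphic:
  fixes T :: "'a::complex_banach \<Rightarrow> 'a" and f :: "'a \<Rightarrow> complex"
  assumes T: "bounded_clinear T" and f: "bounded_clinear f"
  shows "(\<lambda>z. f (resolvent T z x)) holomorphic_on resolvent_set T"
proof (rule holomorphic_onI)
  fix \<nu> assume \<nu>: "\<nu> \<in> resolvent_set T"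
  obtain d K where d: "d > 0" "K > 0"
      "\<And>z. dist z \<nu> < d \<Longrightarrow> invertible_with_bound K (\<lambda>x. z *\<^sub>C x - T x)"
    by (rule resolvent_set_local[OF T \<nu>]) blast
  have near: "eventually (\<lambda>z. z \<noteq> \<nu> \<and> dist z \<nu> < d) (at \<nu>)"
    using d(1) by (auto simp: eventually_at)
  have res: "z \<in> resolvent_set T" if "dist z \<nu> < d" for z
    using d(2) d(3)[OF that] by (auto simp: resolvent_set_def)
  have cont: "((\<lambda>z. resolvent T z y) \<longlongrightarrow> resolvent T \<nu> y) (at \<nu>)" for y
  proof (rule LIM_zero_cancel, rule Lim_null_comparison)
    show "\<forall>\<^sub>F z in at \<nu>. norm (resolvent T z y - resolvent T \<nu> y)
        \<le> cmod (z - \<nu>) * (K * norm (resolvent T \<nu> y))"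
      using near
    proof eventually_elim
      case (elim z)
      then show ?case
        using resolvent_identity[OF T \<nu> res[of z], of y]
          resolvent(4)[OF T d(3)[of z], of "resolvent T \<nu> y"]
        by (simp add: mult_left_mono)
    qed
    show "((\<lambda>z. cmod (z - \<nu>) * (K * norm (resolvent T \<nu> y))) \<longlongrightarrow> 0) (at \<nu>)"
      by (rule tendsto_eq_intros refl | simp)+
  qed
  let ?D = "- f (resolvent T \<nu> (resolvent T \<nu> x))"
  have "((\<lambda>z. - f (resolvent T z (resolvent T \<nu> x))) \<longlongrightarrow> ?D) (at \<nu>)"
    by (intro tendsto_minus bounded_linear.tendsto[OF bounded_clinearD(1)[OF f]] cont)
  moreover have "eventually (\<lambda>z. - f (resolvent T z (resolvent T \<nu> x))
      = (f (resolvent T z x) - f (resolvent T \<nu> x)) / (z - \<nu>)) (at \<nu>)"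
    using near
  proof eventually_elim
    case (elim z)
    have "f (resolvent T z x) - f (resolvent T \<nu> x) = f (resolvent T z x - resolvent T \<nu> x)"
      by (simp add: bounded_clinearD[OF f])
    also have "\<dots> = - ((z - \<nu>) * f (resolvent T z (resolvent T \<nu> x)))"
      using elim by (simp add: resolvent_identity[OF T \<nu> res] bounded_clinearD[OF f])
    finally show ?case
      using elim by simp
  qed
  ultimately have "((\<lambda>z. (f (resolvent T z x) - f (resolvent T \<nu> x)) / (z - \<nu>)) \<longlongrightarrow> ?D) (at \<nu>)"
    by (rule Lim_transform_eventually)
  then have "((\<lambda>z. f (resolvent T z x)) has_field_derivative ?D) (at \<nu>)"
    by (simp add: has_field_derivative_iff)
  then show "(\<lambda>z. f (resolvent T z x)) field_differentiable at \<nu> within resolvent_set T"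
    using field_differentiable_at_within field_differentiable_def by blast
qed

text \<open>
  The singularities are removed one at a time; what remains is Liouville's theorem.
\<close>

lemma holomorphic_bounded_singularities_eq_0:
  fixes g :: "complex \<Rightarrow> complex"
  assumes "finite S" "g holomorphic_on - S"
    and "\<And>s. s \<in> S \<Longrightarrow> \<exists>B. eventually (\<lambda>z. cmod (g z) \<le> B) (at s)"
    and "(g \<longlongrightarrow> 0) at_infinity" and "z \<notin> S"
  shows "g z = 0"
  using assms
proof (induction S arbitrary: g z rule: finite_induct)
  case empty
  then show ?case
    using Liouville_weak[of g 0] by simp
next
  case (insert a S)
  have "open (- S)"
    using insert.hyps(1) by (simp add: finite_imp_closed open_Compl)
  then have int: "a \<in> interior (- S)"
    using insert.hyps(2) by (simp add: interior_open)
  have "g holomorphic_on (- S) - {a}"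
  proof -
    have "(- S) - {a} = - insert a S"
      by auto
    then show ?thesis
      using insert.prems(1) by simp
  qed
  then obtain g' where g': "g' holomorphic_on - S" "\<And>z. z \<in> - S - {a} \<Longrightarrow> g' z = g z"
    using holomorphic_on_extend_bounded(1)[OF _ int, of g] insert.prems(2)[of a] by auto
  have "\<exists>B. eventually (\<lambda>z. cmod (g' z) \<le> B) (at s)" if s: "s \<in> S" for s
  proof -
    obtain B where B: "eventually (\<lambda>z. cmod (g z) \<le> B) (at s)"
      using insert.prems(2)[of s] s by blast
    have "open (- (insert a S - {s}))"
      using insert.hyps(1) by (intro open_Compl finite_imp_closed) auto
    then have "eventually (\<lambda>z. z \<in> - (insert a S - {s}) - {s}) (at s)"
      by (rule eventually_at_in_open) auto
    then have "eventually (\<lambda>z. cmod (g' z) \<le> B) (at s)"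
      using B by eventually_elim (auto simp: g'(2))
    then show ?thesis by blast
  qed
  moreover have "(g' \<longlongrightarrow> 0) at_infinity"
  proof (rule Lim_transform_eventually[OF insert.prems(3)])
    obtain b where b: "\<And>z. z \<in> insert a S \<Longrightarrow> cmod z \<le> b"
      using finite_imp_bounded[of "insert a S"] insert.hyps(1) by (auto simp: bounded_iff)
    have "eventually (\<lambda>z. b + 1 \<le> cmod z) at_infinity"
      by (auto simp: eventually_at_infinity)
    then show "eventually (\<lambda>z. g z = g' z) at_infinity"
    proof eventually_elim
      case (elim z)
      then have "z \<notin> insert a S"
        using b[of z] by auto
      then show ?case
        using g'(2)[of z] by simp
    qed
  qed
  ultimately have "g' z = 0"
    using insert.IH[OF g'(1)] insert.prems(4) by blast
  then show ?case
    using g'(2)[of z] insert.prems(4) by auto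
qed

section \<open>Existence of a useful spectral point\<close>

lemma stable_kernel_exists:
  fixes T :: "'a::complex_banach \<Rightarrow> 'a"
  assumes T: "bounded_clinear T" and ker: "finite_dimensional {x. \<mu> *\<^sub>C x - T x = 0}"
    and stop: "\<And>x. ((\<lambda>x. \<mu> *\<^sub>C x - T x) ^^ Suc p) x = 0 \<Longrightarrow> ((\<lambda>x. \<mu> *\<^sub>C x - T x) ^^ p) x = 0"
  shows "\<exists>Q. stable_kernel T \<mu> p Q {x. ((\<lambda>x. \<mu> *\<^sub>C x - T x) ^^ p) x = 0}"
proof -
  define A where "A x = \<mu> *\<^sub>C x - T x" for x
  have A: "bounded_clinear A"
    unfolding A_def
    by (intro bounded_clinear_diff bounded_clinear_scale bounded_clinear_ident T)
  have fin: "finite_dimensional {x. (A ^^ n) x = 0}" for n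
  proof (induction n)
    case 0
    have "cspan {} = ({0} :: 'a set)"
      by (rule complex_vector.span_empty)
    then show ?case
      unfolding finite_dimensional_def by (intro exI[of _ "{}"]) simp
  next
    case (Suc n)
    then show ?case
      using finite_dimensional_preimage[OF A Suc] ker
      by (simp add: A_def[symmetric] funpow_Suc_right del: funpow.simps(2))
  qed
  show ?thesis
  proof (rule finite_dimensional_projection[OF fin[of p]])
    fix R assume R: "bounded_clinear R" "\<And>x. R x \<in> {x. (A ^^ p) x = 0}"
      "\<And>x. x \<in> {x. (A ^^ p) x = 0} \<Longrightarrow> R x = x"
    have "stable_kernel T \<mu> p (\<lambda>x. x - R x) {x. (A ^^ p) x = 0}"
    proof
      show "x \<in> {x. (A ^^ p) x = 0}" if "\<mu> *\<^sub>C x - T x \<in> {x. (A ^^ p) x = 0}" for x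
        using stop[of x] that unfolding A_def[abs_def]
        by (simp add: funpow_Suc_right del: funpow.simps(2))
    qed (use T fin R in \<open>auto simp: A_def[abs_def] bounded_clinear_diff bounded_clinear_ident\<close>)
    then show ?thesis
      unfolding A_def[abs_def] by blast
  qed
qed

text \<open>
  Without such a halfspace no resolvent blows up modulo a stable kernel, and every boundary point
  of the resolvent set is an isolated point of the spectrum. So the closure of the resolvent set is open, hence
  everything, and the spectrum is finite. For a functional \<open>f\<close> that annihilates all the stable
  kernels \<open>z \<mapsto> f (R z x)\<close>, with \<open>R z\<close> the inverse of \<open>z - T\<close>, has only removable singularities
  and vanishes at infinity, so it is \<open>0\<close> and \<open>f = 0\<close>. Consequently the sum of the stable kernels
  is the whole space.
\<close>

lemma finite_dimensional_if_no_blow_up: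
  fixes T :: "'a::complex_banach \<Rightarrow> 'a"
  assumes T: "bounded_clinear T"
    and kernels: "\<And>\<mu>. \<exists>p Q N. stable_kernel T \<mu> p Q N"
    and no: "\<nexists>Y. halfspace Y \<and> almost_invariant T Y \<and> defect T Y \<le> 1"
  shows "finite_dimensional (UNIV :: 'a set)"
proof -
  obtain p Q N where sk: "\<And>\<mu>. stable_kernel T \<mu> (p \<mu>) (Q \<mu>) (N \<mu>)"
    using kernels by metis
  let ?\<rho> = "resolvent_set T"
  have iso: "\<exists>d>0. \<exists>K>0. \<forall>\<nu>. dist \<nu> \<mu> < d \<longrightarrow>
      invertible_with_bound K (stable_kernel.modulo T (Q \<mu>) \<nu>)" if "\<mu> \<in> closure ?\<rho>" for \<mu>
    using stable_kernel.blow_up_or_isolated[OF sk that] no by blast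
  have punctured: "\<exists>d>0. \<forall>\<nu>. dist \<nu> \<mu> < d \<and> \<nu> \<noteq> \<mu> \<longrightarrow> \<nu> \<in> ?\<rho>" if "\<mu> \<in> closure ?\<rho>" for \<mu>
    using iso[OF that] stable_kernel.resolvent_set_of_modulo[OF sk] by meson
  obtain L where L: "L > 0" "\<And>x. norm (T x) \<le> L * norm x"
    using bounded_clinear_bound[OF T] by blast
  have far: "z \<in> ?\<rho>" if "4 * L \<le> cmod z" for z
    using invertible_far_out[OF T L(2,1) that] that L(1)
    unfolding resolvent_set_def by (intro CollectI exI[of _ "2 / cmod z"]) auto
  have "complex_of_real (4 * L) \<in> ?\<rho>"
    using L(1) by (intro far) simp
  then have ne: "?\<rho> \<noteq> {}"
    by blast
  have "open (closure ?\<rho>)"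
    unfolding open_dist
  proof
    fix \<mu> assume "\<mu> \<in> closure ?\<rho>"
    then obtain d where "d > 0" "\<And>\<nu>. dist \<nu> \<mu> < d \<Longrightarrow> \<nu> \<noteq> \<mu> \<Longrightarrow> \<nu> \<in> ?\<rho>"
      using punctured by blast
    then show "\<exists>e>0. \<forall>y. dist y \<mu> < e \<longrightarrow> y \<in> closure ?\<rho>"
      using \<open>\<mu> \<in> closure ?\<rho>\<close> closure_subset[of ?\<rho>] by (intro exI[of _ d]) auto
  qed
  then have cl: "closure ?\<rho> = UNIV"
    using clopen[of "closure ?\<rho>"] ne by auto
  define S where "S = - ?\<rho>"
  have "\<not> \<mu> islimpt S" for \<mu>
    using punctured[of \<mu>] cl by (auto simp: S_def islimpt_approachable)
  then have "finite (cball 0 (4 * L) \<inter> S)"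
    by (intro finite_not_islimpt_in_compact) auto
  moreover have "S \<subseteq> cball 0 (4 * L)"
    using far by (auto simp: S_def) (meson linear)
  ultimately have "finite S"
    by (simp add: Int_absorb1)
  have "\<exists>B. finite B \<and> cspan B = N s" for s
    using stable_kernel.finite_dimensional_N[OF sk] by (auto simp: finite_dimensional_def)
  then obtain B where B: "\<And>s. finite (B s)" "\<And>s. cspan (B s) = N s"
    by metis
  define M where "M = cspan (\<Union>s\<in>S. B s)"
  have M: "finite_dimensional M"
    unfolding M_def finite_dimensional_def using \<open>finite S\<close> B(1)
    by (intro exI[of _ "\<Union>s\<in>S. B s"]) simp
  note M' = finite_dimensional_closed[OF M]
  have NM: "N s \<subseteq> M" if "s \<in> S" for s
    unfolding M_def B(2)[symmetric] using that by (intro complex_vector.span_mono) blast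
  have "M = UNIV"
  proof (rule ccontr)
    assume "M \<noteq> UNIV"
    then obtain x0 where "x0 \<notin> M"
      by blast
    then obtain f :: "'a \<Rightarrow> complex" where f: "bounded_clinear f" "\<And>y. y \<in> M \<Longrightarrow> f y = 0" "f x0 = 1"
      using separating_functional[OF M'(1), of x0] M'(2) by auto
    obtain J where J: "J > 0" "\<And>y. cmod (f y) \<le> J * norm y"
      using bounded_clinear_bound[OF f(1)] by blast
    obtain z where z: "z \<in> ?\<rho>"
      using ne by blast
    define x where "x = z *\<^sub>C x0 - T x0"
    define g where "g w = f (resolvent T w x)" for w
    have "g z = 0"
    proof (rule holomorphic_bounded_singularities_eq_0[where g = g and z = z, OF \<open>finite S\<close>])
      show "g holomorphic_on - S"
        unfolding g_def S_def using resolvent_holomorphic[OF T f(1)] by simp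
      show "z \<notin> S"
        using z by (simp add: S_def)
      show "\<exists>B. eventually (\<lambda>w. cmod (g w) \<le> B) (at s)" if s: "s \<in> S" for s
      proof -
        interpret stable_kernel T s "p s" "Q s" "N s"
          by (rule sk)
        obtain d K where d: "d > 0" "K > 0"
            "\<And>\<nu>. dist \<nu> s < d \<Longrightarrow> invertible_with_bound K (modulo \<nu>)"
          using iso[of s] cl by auto
        have "cmod (g w) \<le> J * (K * norm (Q s x))" if w: "w \<noteq> s" "dist w s < d" for w
        proof -
          have "w \<in> ?\<rho>"
            using resolvent_set_of_modulo[OF d(3)[OF w(2)] d(2) w(1)] .
          then obtain K' where K': "invertible_with_bound K' (\<lambda>x. w *\<^sub>C x - T x)"
            by (auto simp: resolvent_set_def)
          let ?h = "resolvent T w x"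
          have "f (?h - Q s ?h) = 0"
            using f(2) NM[OF s] Q_in by blast
          then have "g w = f (Q s ?h)"
            by (simp add: g_def bounded_clinearD[OF f(1)])
          also have "cmod \<dots> \<le> J * norm (Q s ?h)"
            by (rule J)
          also have "norm (Q s ?h) \<le> K * norm (modulo w (Q s ?h))"
            using d(3)[OF w(2)] by (simp add: invertible_with_bound_def)
          also have "modulo w (Q s ?h) = Q s x"
            by (simp add: modulo_Q resolvent(2)[OF T K'])
          finally show ?thesis
            using J(1) by simp
        qed
        then show ?thesis
          using d(1) unfolding eventually_at by blast
      qed
      show "(g \<longlongrightarrow> 0) at_infinity"
      proof (rule Lim_null_comparison)
        have "eventually (\<lambda>w. 4 * L \<le> cmod w) at_infinity"
          by (auto simp: eventually_at_infinity)
        then show "eventually (\<lambda>w. norm (g w) \<le> (J * 2 * norm x) * norm (inverse w)) at_infinity"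
        proof eventually_elim
          case (elim w)
          have "norm (g w) \<le> J * norm (resolvent T w x)"
            unfolding g_def by (rule J)
          also have "\<dots> \<le> J * (2 / cmod w * norm x)"
            using resolvent(4)[OF T invertible_far_out[OF T L(2,1) elim], of x] J(1)
            by (intro mult_left_mono) auto
          finally show ?case
            by (simp add: norm_inverse divide_inverse mult_ac)
        qed
        show "((\<lambda>w::complex. (J * 2 * norm x) * norm (inverse w)) \<longlongrightarrow> 0) at_infinity"
          by (rule tendsto_mult_right_zero[OF tendsto_norm_zero[OF tendsto_inverse_0]])
      qed
    qed
    moreover have "resolvent T z x = x0"
      using z resolvent(3)[OF T] by (auto simp: x_def resolvent_set_def)
    ultimately show False
      using f(3) by (simp add: g_def)
  qed
  then show ?thesis
    using M by simp
qed

theorem theorem3p6: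
  fixes T :: "'a::complex_banach \<Rightarrow> 'a"
  assumes "\<not> finite_dimensional (UNIV :: 'a set)"
    and "T \<in> operators"
  shows "(\<exists>Y. halfspace Y \<and> almost_invariant T Y \<and> defect T Y \<le> 1) \<or>
    (\<exists>V P \<mu> v S.
       csubspace V \<and> closed V \<and> finite_codimensional V \<and>
       projection_onto V P \<and>
       \<mu> \<in> point_spectrum UNIV T \<inter> point_spectrum V (P \<circ> T) \<and>
       inj_on v {1::nat..} \<and> \<not> cdependent (v ` {1..}) \<and> v ` {1..} \<subseteq> V \<and>
       closure (cspan (v ` {1..})) = V \<and>
       (\<forall>x\<in>V. S x = P (\<mu> *\<^sub>C x - T x) \<and> S x = \<mu> *\<^sub>C x - P (T x)) \<and>
       (\<forall>n\<ge>1. S (v (n + 1)) = v n) \<and> S (v 1) = 0)"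
    (is "?half \<or> _")
proof (cases "?half \<or> (\<exists>\<mu> w. w (0::nat) \<noteq> 0 \<and> \<mu> *\<^sub>C w 0 - T (w 0) = 0 \<and>
    (\<forall>n. \<mu> *\<^sub>C w (Suc n) - T (w (Suc n)) = w n))")
  case True
  have T: "bounded_clinear T"
    using assms(2) by (simp add: operators_iff_bounded_clinear)
  show ?thesis
  proof (cases ?half)
    case False
    then obtain \<mu> w where "w 0 \<noteq> 0" "\<mu> *\<^sub>C w 0 - T (w 0) = 0"
        "\<And>n. \<mu> *\<^sub>C w (Suc n) - T (w (Suc n)) = w n"
      using True by blast
    then show ?thesis
      by (rule chain_dichotomy[OF T])
  qed simp
next
  case False
  have T: "bounded_clinear T"
    using assms(2) by (simp add: operators_iff_bounded_clinear)
  have no: "\<not> ?half"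
    using False by blast
  have "\<exists>p Q N. stable_kernel T \<mu> p Q N" for \<mu>
  proof -
    let ?A = "\<lambda>x. \<mu> *\<^sub>C x - T x"
    have A: "bounded_clinear ?A"
      by (intro bounded_clinear_diff bounded_clinear_scale bounded_clinear_ident T)
    have ker: "finite_dimensional {x. ?A x = 0}"
      using halfspace_in_infinite_kernel[OF T, of \<mu>] no by blast
    have "\<not> (\<forall>p. \<exists>x. (?A ^^ Suc p) x = 0 \<and> (?A ^^ p) x \<noteq> 0)"
    proof
      assume grow: "\<forall>p. \<exists>x. (?A ^^ Suc p) x = 0 \<and> (?A ^^ p) x \<noteq> 0"
      show False
      proof (rule backward_chain_exists[OF A ker])
        show "\<exists>x. (?A ^^ Suc p) x = 0 \<and> (?A ^^ p) x \<noteq> 0" for p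
          using grow by blast
        show False if "w 0 \<noteq> 0" "?A (w 0) = 0" "\<And>n. ?A (w (Suc n)) = w n" for w
          using False that by blast
      qed
    qed
    then obtain p where "\<And>x. (?A ^^ Suc p) x = 0 \<Longrightarrow> (?A ^^ p) x = 0"
      by blast
    then show ?thesis
      using stable_kernel_exists[OF T ker] by blast
  qed
  then show ?thesis
    using finite_dimensional_if_no_blow_up[OF T _ no] assms(1) by blast
qed

end
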